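(* Let $(M,I,J,K,g_M)$ be a hyperkähler manifold, $(N,g_N)$ a Riemannian manifold, and $F:(M,g_M)\to(N,g_N)$ a h-Lagrangian submersion such that $(I,J,K)$ is a h-Lagrangian basis, i.e. $F$ is a Riemannian submersion with $I(\ker F_* )=(\ker F_* )^{\perp}$, $J(\ker F_* )=\ker F_*$ and $K(\ker F_* )=(\ker F_* )^{\perp}$. Then the map $F$ is harmonic.
   Context: A hyperkähler manifold $(M,I,J,K,g_M)$ is a $4m$-dimensional Riemannian manifold with endomorphism fields $I,J,K$ of $TM$ satisfying $I^2=J^2=K^2=-\mathrm{id}$, $IJ=-JI=K$, $JK=-KJ=I$, $KI=-IK=J$, $g_M(RX,RY)=g_M(X,Y)$ for $R\in\{I,J,K\}$, and $\nabla I=\nabla J=\nabla K=0$, where $\nabla$ is the Levi-Civita connection of $g_M$. A Riemannian submersion $F:(M,g_M)\to(N,g_N)$ is a smooth surjective submersion such that $(F_* )_p:(\ker (F_* )_p)^{\perp}\to T_{F(p)}N$ is a linear isometry for every $p\in M$. The second fundamental form of $F$ is $(\nabla F_* )(U,W)=\nabla^F_U F_*W-F_*(\nabla_UW)$ for $U,W\in\Gamma(TM)$, where $\nabla^F$ is the pullback connection along $F$; $F$ is harmonic if and only if the trace of $\nabla F_*$ with respect to $g_M$ vanishes. *)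

theory Defs
  imports "HOL-Analysis.Analysis" "HOL-Library.Function_Algebras"
begin

text \<open>
  Manifolds are finite-dimensional, without boundary, and modelled on a Euclidean space
  \<open>'a\<close>, so the dimension is \<open>DIM('a)\<close>. The underlying topological space is a type of class
  \<open>t2_space\<close> and \<open>second_countable_topology\<close>, and the smooth structure is given by an atlas.
\<close>

subsection \<open>Smooth functions on open subsets of Euclidean space\<close>

text \<open>The predicates \<open>Ck_on\<close> and \<open>smooth_on\<close> are only used for open \<open>S\<close>.\<close>

primrec Ck_on :: "nat \<Rightarrow> 'a::euclidean_space set \<Rightarrow> ('a \<Rightarrow> 'b::real_normed_vector) \<Rightarrow> bool" where
  "Ck_on 0 S f \<longleftrightarrow> continuous_on S f"
| "Ck_on (Suc k) S f \<longleftrightarrow>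
     (\<forall>x\<in>S. f differentiable (at x)) \<and> (\<forall>v. Ck_on k S (\<lambda>x. frechet_derivative f (at x) v))"

definition smooth_on :: "'a::euclidean_space set \<Rightarrow> ('a \<Rightarrow> 'b::real_normed_vector) \<Rightarrow> bool" where
  "smooth_on S f \<longleftrightarrow> (\<forall>k. Ck_on k S f)"

subsection \<open>Smooth manifolds\<close>

text \<open>A chart is its domain together with its coordinate map; only the values of the
  coordinate map on the domain matter.\<close>

type_synonym ('p, 'a) chart = "'p set \<times> ('p \<Rightarrow> 'a)"

abbreviation chart_dom :: "('p, 'a) chart \<Rightarrow> 'p set" where
  "chart_dom c \<equiv> fst c"

abbreviation coord :: "('p, 'a) chart \<Rightarrow> 'p \<Rightarrow> 'a" where
  "coord c \<equiv> snd c"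

definition param :: "('p, 'a) chart \<Rightarrow> 'a \<Rightarrow> 'p" where
  "param c = inv_into (chart_dom c) (coord c)"

definition smooth_atlas ::
  "('p::{t2_space, second_countable_topology}, 'a::euclidean_space) chart set \<Rightarrow> bool" where
  "smooth_atlas A \<longleftrightarrow>
     (\<Union>c\<in>A. chart_dom c) = UNIV \<and>
     (\<forall>c\<in>A. open (chart_dom c) \<and> open (coord c ` chart_dom c) \<and>
        homeomorphism (chart_dom c) (coord c ` chart_dom c) (coord c) (param c)) \<and>
     (\<forall>c\<in>A. \<forall>d\<in>A.
        smooth_on (coord c ` (chart_dom c \<inter> chart_dom d)) (\<lambda>x. coord d (param c x)))"

definition chart_at :: "('p, 'a) chart set \<Rightarrow> 'p \<Rightarrow> ('p, 'a) chart" where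
  "chart_at A p = (SOME c. c \<in> A \<and> p \<in> chart_dom c)"

definition smooth_fun_on ::
  "('p, 'a::euclidean_space) chart set \<Rightarrow> 'p set \<Rightarrow> ('p \<Rightarrow> real) \<Rightarrow> bool" where
  "smooth_fun_on A W f \<longleftrightarrow>
     (\<forall>c\<in>A. smooth_on (coord c ` (chart_dom c \<inter> W)) (\<lambda>x. f (param c x)))"

definition smooth_map ::
  "('p::topological_space, 'a::euclidean_space) chart set \<Rightarrow>
   ('q::topological_space, 'b::euclidean_space) chart set \<Rightarrow> ('p \<Rightarrow> 'q) \<Rightarrow> bool" where
  "smooth_map A B F \<longleftrightarrow> continuous_on UNIV F \<and>
     (\<forall>c\<in>A. \<forall>d\<in>B. smooth_on (coord c ` (chart_dom c \<inter> F -` chart_dom d))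
                       (\<lambda>x. coord d (F (param c x))))"

subsection \<open>Tangent vectors and vector fields\<close>

text \<open>
  A tangent vector at \<open>p\<close> is the family of its coordinate representations in all charts
  around \<open>p\<close>, related by the derivatives of the transition maps (and extended by zero to the
  remaining charts). The vector space operations are the pointwise ones.
\<close>

type_synonym ('p, 'a) tvec = "('p, 'a) chart \<Rightarrow> 'a"

abbreviation tscale :: "real \<Rightarrow> ('p, 'a::real_vector) tvec \<Rightarrow> ('p, 'a) tvec"  (infixr \<open>*\<^sub>T\<close> 75) where
  "r *\<^sub>T v \<equiv> (\<lambda>c. r *\<^sub>R v c)"

definition tangent_space ::
  "('p, 'a::euclidean_space) chart set \<Rightarrow> 'p \<Rightarrow> ('p, 'a) tvec set" where
  "tangent_space A p =
     {v. (\<forall>c\<in>A. \<forall>d\<in>A. p \<in> chart_dom c \<longrightarrow> p \<in> chart_dom d \<longrightarrow>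
            v d = frechet_derivative (\<lambda>x. coord d (param c x)) (at (coord c p)) (v c)) \<and>
         (\<forall>c. c \<notin> A \<or> p \<notin> chart_dom c \<longrightarrow> v c = 0)}"

text \<open>The differentials of a real function and of a map. By the chain rule they do not depend
  on the chart used around \<open>p\<close>.\<close>

definition dfun ::
  "('p, 'a::euclidean_space) chart set \<Rightarrow> ('p \<Rightarrow> real) \<Rightarrow> 'p \<Rightarrow> ('p, 'a) tvec \<Rightarrow> real" where
  "dfun A f p v =
     (let c = chart_at A p in frechet_derivative (\<lambda>x. f (param c x)) (at (coord c p)) (v c))"

definition dmap ::
  "('p, 'a::euclidean_space) chart set \<Rightarrow> ('q, 'b::euclidean_space) chart set \<Rightarrow> ('p \<Rightarrow> 'q) \<Rightarrow>
   'p \<Rightarrow> ('p, 'a) tvec \<Rightarrow> ('q, 'b) tvec" where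
  "dmap A B F p v =
     (let c = chart_at A p in
      (\<lambda>d. if d \<in> B \<and> F p \<in> chart_dom d
           then frechet_derivative (\<lambda>x. coord d (F (param c x))) (at (coord c p)) (v c)
           else 0))"

text \<open>Smooth sections over the open set \<open>W\<close> of the pullback bundle \<open>F\<^sup>*TN\<close>, i.e. smooth vector
  fields along \<open>F\<close>; vector fields are the case \<open>F = id\<close>. Values outside \<open>W\<close> are irrelevant.\<close>

definition section_along ::
  "('p, 'a::euclidean_space) chart set \<Rightarrow> ('q, 'b::euclidean_space) chart set \<Rightarrow> ('p \<Rightarrow> 'q) \<Rightarrow>
   'p set \<Rightarrow> ('p \<Rightarrow> ('q, 'b) tvec) \<Rightarrow> bool" where
  "section_along A B F W \<xi> \<longleftrightarrow>
     (\<forall>p\<in>W. \<xi> p \<in> tangent_space B (F p)) \<and>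
     (\<forall>c\<in>A. \<forall>d\<in>B. smooth_on (coord c ` (chart_dom c \<inter> W \<inter> F -` chart_dom d))
                       (\<lambda>x. \<xi> (param c x) d))"

abbreviation vector_field ::
  "('p, 'a::euclidean_space) chart set \<Rightarrow> 'p set \<Rightarrow> ('p \<Rightarrow> ('p, 'a) tvec) \<Rightarrow> bool" where
  "vector_field A \<equiv> section_along A A id"

text \<open>In each chart, \<open>[X, Y] = DY(X) - DX(Y)\<close>.\<close>

definition lie_bracket ::
  "('p, 'a::euclidean_space) chart set \<Rightarrow> ('p \<Rightarrow> ('p, 'a) tvec) \<Rightarrow> ('p \<Rightarrow> ('p, 'a) tvec) \<Rightarrow>
   'p \<Rightarrow> ('p, 'a) tvec" where
  "lie_bracket A X Y p =
     (\<lambda>c. if c \<in> A \<and> p \<in> chart_dom c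
          then frechet_derivative (\<lambda>x. Y (param c x) c) (at (coord c p)) (X p c)
             - frechet_derivative (\<lambda>x. X (param c x) c) (at (coord c p)) (Y p c)
          else 0)"

text \<open>Smooth endomorphism fields of the tangent bundle.\<close>

definition endomorphism_field ::
  "('p::topological_space, 'a::euclidean_space) chart set \<Rightarrow>
   ('p \<Rightarrow> ('p, 'a) tvec \<Rightarrow> ('p, 'a) tvec) \<Rightarrow> bool" where
  "endomorphism_field A R \<longleftrightarrow>
     (\<forall>p. \<forall>v\<in>tangent_space A p. \<forall>w\<in>tangent_space A p. \<forall>r.
        R p v \<in> tangent_space A p \<and>
        R p (v + w) = R p v + R p w \<and> R p (r *\<^sub>T v) = r *\<^sub>T R p v) \<and>
     (\<forall>W Y. open W \<longrightarrow> vector_field A W Y \<longrightarrow> vector_field A W (\<lambda>p. R p (Y p)))"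

subsection \<open>Riemannian manifolds and connections\<close>

type_synonym ('p, 'a) metric = "'p \<Rightarrow> ('p, 'a) tvec \<Rightarrow> ('p, 'a) tvec \<Rightarrow> real"

definition riemannian_manifold ::
  "('p::{t2_space, second_countable_topology}, 'a::euclidean_space) chart set \<Rightarrow>
   ('p, 'a) metric \<Rightarrow> bool" where
  "riemannian_manifold A g \<longleftrightarrow> smooth_atlas A \<and>
     (\<forall>p. \<forall>u\<in>tangent_space A p. \<forall>v\<in>tangent_space A p. \<forall>w\<in>tangent_space A p. \<forall>r.
        g p u v = g p v u \<and>
        g p (u + v) w = g p u w + g p v w \<and>
        g p (r *\<^sub>T u) w = r * g p u w \<and>
        (u \<noteq> 0 \<longrightarrow> 0 < g p u u)) \<and>
     (\<forall>W X Y. open W \<longrightarrow> vector_field A W X \<longrightarrow> vector_field A W Y \<longrightarrow>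
        smooth_fun_on A W (\<lambda>p. g p (X p) (Y p)))"

text \<open>
  A linear connection \<open>D\<close> on \<open>F\<^sup>*TN\<close>: \<open>D p v \<xi>\<close> is the covariant derivative at \<open>p\<close>, in direction
  \<open>v \<in> T\<^sub>pM\<close>, of a smooth section \<open>\<xi>\<close> defined on some open neighbourhood \<open>W\<close> of \<open>p\<close>. The last
  clause but one says that it only depends on the germ of \<open>\<xi>\<close> at \<open>p\<close>. Affine connections are
  the case \<open>F = id\<close>.
\<close>

type_synonym ('p, 'a, 'q, 'b) connection =
  "'p \<Rightarrow> ('p, 'a) tvec \<Rightarrow> ('p \<Rightarrow> ('q, 'b) tvec) \<Rightarrow> ('q, 'b) tvec"

definition connection_along ::
  "('p::topological_space, 'a::euclidean_space) chart set \<Rightarrow>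
   ('q, 'b::euclidean_space) chart set \<Rightarrow> ('p \<Rightarrow> 'q) \<Rightarrow> ('p, 'a, 'q, 'b) connection \<Rightarrow> bool" where
  "connection_along A B F D \<longleftrightarrow>
     (\<forall>W \<xi>. open W \<longrightarrow> section_along A B F W \<xi> \<longrightarrow>
        (\<forall>p\<in>W. \<forall>v\<in>tangent_space A p. \<forall>w\<in>tangent_space A p. \<forall>r.
           D p v \<xi> \<in> tangent_space B (F p) \<and>
           D p (v + w) \<xi> = D p v \<xi> + D p w \<xi> \<and>
           D p (r *\<^sub>T v) \<xi> = r *\<^sub>T D p v \<xi>)) \<and>
     (\<forall>W \<xi> \<eta>. open W \<longrightarrow> section_along A B F W \<xi> \<longrightarrow> section_along A B F W \<eta> \<longrightarrow>
        (\<forall>p\<in>W. \<forall>v\<in>tangent_space A p. D p v (\<lambda>q. \<xi> q + \<eta> q) = D p v \<xi> + D p v \<eta>)) \<and>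
     (\<forall>W f \<xi>. open W \<longrightarrow> smooth_fun_on A W f \<longrightarrow> section_along A B F W \<xi> \<longrightarrow>
        (\<forall>p\<in>W. \<forall>v\<in>tangent_space A p.
           D p v (\<lambda>q. f q *\<^sub>T \<xi> q) = dfun A f p v *\<^sub>T \<xi> p + f p *\<^sub>T D p v \<xi>)) \<and>
     (\<forall>W \<xi> \<eta>. open W \<longrightarrow> section_along A B F W \<xi> \<longrightarrow> section_along A B F W \<eta> \<longrightarrow>
        (\<forall>q\<in>W. \<xi> q = \<eta> q) \<longrightarrow> (\<forall>p\<in>W. \<forall>v\<in>tangent_space A p. D p v \<xi> = D p v \<eta>)) \<and>
     (\<forall>W V \<xi>. open W \<longrightarrow> vector_field A W V \<longrightarrow> section_along A B F W \<xi> \<longrightarrow>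
        section_along A B F W (\<lambda>p. D p (V p) \<xi>))"

text \<open>The torsion-free metric connection.\<close>

definition levi_civita ::
  "('p::topological_space, 'a::euclidean_space) chart set \<Rightarrow> ('p, 'a) metric \<Rightarrow>
   ('p, 'a, 'p, 'a) connection \<Rightarrow> bool" where
  "levi_civita A g nabla \<longleftrightarrow> connection_along A A id nabla \<and>
     (\<forall>W X Y. open W \<longrightarrow> vector_field A W X \<longrightarrow> vector_field A W Y \<longrightarrow>
        (\<forall>p\<in>W. nabla p (X p) Y - nabla p (Y p) X = lie_bracket A X Y p)) \<and>
     (\<forall>W X Y. open W \<longrightarrow> vector_field A W X \<longrightarrow> vector_field A W Y \<longrightarrow>
        (\<forall>p\<in>W. \<forall>v\<in>tangent_space A p.
           dfun A (\<lambda>q. g q (X q) (Y q)) p v = g p (nabla p v X) (Y p) + g p (X p) (nabla p v Y)))"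

text \<open>The pullback connection \<open>\<nabla>\<^sup>F\<close> is the connection on \<open>F\<^sup>*TN\<close> determined by
  \<open>\<nabla>\<^sup>F\<^sub>v (Y \<circ> F) = \<nabla>\<^sub>w Y\<close> with \<open>w = F\<^sub>* v\<close>, for vector fields \<open>Y\<close> on open subsets of \<open>N\<close>.\<close>

definition pullback_connection ::
  "('p::topological_space, 'a::euclidean_space) chart set \<Rightarrow>
   ('q::topological_space, 'b::euclidean_space) chart set \<Rightarrow> ('p \<Rightarrow> 'q) \<Rightarrow>
   ('q, 'b, 'q, 'b) connection \<Rightarrow> ('p, 'a, 'q, 'b) connection \<Rightarrow> bool" where
  "pullback_connection A B F nabla D \<longleftrightarrow> connection_along A B F D \<and>
     (\<forall>W Y. open W \<longrightarrow> vector_field B W Y \<longrightarrow>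
        (\<forall>p\<in>F -` W. \<forall>v\<in>tangent_space A p.
           D p v (\<lambda>q. Y (F q)) = nabla (F p) (dmap A B F p v) Y))"

text \<open>\<open>\<nabla>R = 0\<close>, i.e. \<open>\<nabla>\<^sub>v (RY) = R (\<nabla>\<^sub>v Y)\<close>.\<close>

definition parallel_endomorphism ::
  "('p::topological_space, 'a::euclidean_space) chart set \<Rightarrow> ('p, 'a, 'p, 'a) connection \<Rightarrow>
   ('p \<Rightarrow> ('p, 'a) tvec \<Rightarrow> ('p, 'a) tvec) \<Rightarrow> bool" where
  "parallel_endomorphism A nabla R \<longleftrightarrow>
     (\<forall>W Y. open W \<longrightarrow> vector_field A W Y \<longrightarrow>
        (\<forall>p\<in>W. \<forall>v\<in>tangent_space A p. nabla p v (\<lambda>q. R q (Y q)) = R p (nabla p v Y)))"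

subsection \<open>Hyperkaehler manifolds\<close>

definition hyperkaehler_manifold ::
  "('p::{t2_space, second_countable_topology}, 'a::euclidean_space) chart set \<Rightarrow>
   ('p \<Rightarrow> ('p, 'a) tvec \<Rightarrow> ('p, 'a) tvec) \<Rightarrow> ('p \<Rightarrow> ('p, 'a) tvec \<Rightarrow> ('p, 'a) tvec) \<Rightarrow>
   ('p \<Rightarrow> ('p, 'a) tvec \<Rightarrow> ('p, 'a) tvec) \<Rightarrow> ('p, 'a) metric \<Rightarrow> bool" where
  "hyperkaehler_manifold A I J K g \<longleftrightarrow>
     riemannian_manifold A g \<and> (\<exists>m. DIM('a) = 4 * m) \<and>
     endomorphism_field A I \<and> endomorphism_field A J \<and> endomorphism_field A K \<and>
     (\<forall>p. \<forall>v\<in>tangent_space A p.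
        I p (I p v) = - v \<and> J p (J p v) = - v \<and> K p (K p v) = - v \<and>
        I p (J p v) = K p v \<and> J p (I p v) = - K p v \<and>
        J p (K p v) = I p v \<and> K p (J p v) = - I p v \<and>
        K p (I p v) = J p v \<and> I p (K p v) = - J p v) \<and>
     (\<forall>R\<in>{I, J, K}. \<forall>p. \<forall>v\<in>tangent_space A p. \<forall>w\<in>tangent_space A p.
        g p (R p v) (R p w) = g p v w) \<and>
     (\<exists>nabla. levi_civita A g nabla \<and> (\<forall>R\<in>{I, J, K}. parallel_endomorphism A nabla R))"

subsection \<open>Riemannian and h-Lagrangian submersions\<close>

definition vertical_space ::
  "('p, 'a::euclidean_space) chart set \<Rightarrow> ('q, 'b::euclidean_space) chart set \<Rightarrow> ('p \<Rightarrow> 'q) \<Rightarrow>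
   'p \<Rightarrow> ('p, 'a) tvec set" where
  "vertical_space A B F p = {v \<in> tangent_space A p. dmap A B F p v = 0}"

definition horizontal_space ::
  "('p, 'a::euclidean_space) chart set \<Rightarrow> ('p, 'a) metric \<Rightarrow> ('q, 'b::euclidean_space) chart set \<Rightarrow>
   ('p \<Rightarrow> 'q) \<Rightarrow> 'p \<Rightarrow> ('p, 'a) tvec set" where
  "horizontal_space A g B F p =
     {v \<in> tangent_space A p. \<forall>w\<in>vertical_space A B F p. g p v w = 0}"

definition riemannian_submersion ::
  "('p::topological_space, 'a::euclidean_space) chart set \<Rightarrow> ('p, 'a) metric \<Rightarrow>
   ('q::topological_space, 'b::euclidean_space) chart set \<Rightarrow> ('q, 'b) metric \<Rightarrow>
   ('p \<Rightarrow> 'q) \<Rightarrow> bool" where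
  "riemannian_submersion A g B h F \<longleftrightarrow>
     smooth_map A B F \<and> surj F \<and>
     (\<forall>p. dmap A B F p ` tangent_space A p = tangent_space B (F p)) \<and>
     (\<forall>p. \<forall>u\<in>horizontal_space A g B F p. \<forall>v\<in>horizontal_space A g B F p.
        h (F p) (dmap A B F p u) (dmap A B F p v) = g p u v)"

definition h_lagrangian_submersion ::
  "('p::topological_space, 'a::euclidean_space) chart set \<Rightarrow>
   ('p \<Rightarrow> ('p, 'a) tvec \<Rightarrow> ('p, 'a) tvec) \<Rightarrow> ('p \<Rightarrow> ('p, 'a) tvec \<Rightarrow> ('p, 'a) tvec) \<Rightarrow>
   ('p \<Rightarrow> ('p, 'a) tvec \<Rightarrow> ('p, 'a) tvec) \<Rightarrow> ('p, 'a) metric \<Rightarrow>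
   ('q::topological_space, 'b::euclidean_space) chart set \<Rightarrow> ('q, 'b) metric \<Rightarrow>
   ('p \<Rightarrow> 'q) \<Rightarrow> bool" where
  "h_lagrangian_submersion A I J K g B h F \<longleftrightarrow>
     riemannian_submersion A g B h F \<and>
     (\<forall>p. I p ` vertical_space A B F p = horizontal_space A g B F p \<and>
          J p ` vertical_space A B F p = vertical_space A B F p \<and>
          K p ` vertical_space A B F p = horizontal_space A g B F p)"

subsection \<open>Harmonic maps\<close>

text \<open>\<open>(\<nabla>F\<^sub>*)(U, W) = \<nabla>\<^sup>F\<^sub>U (F\<^sub>* W) - F\<^sub>* (\<nabla>\<^sub>U W)\<close>, where \<open>nabla\<close> is the connection of the domain and
  \<open>D\<close> the pullback connection.\<close>

definition second_fundamental_form ::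
  "('p, 'a::euclidean_space) chart set \<Rightarrow> ('q, 'b::euclidean_space) chart set \<Rightarrow> ('p \<Rightarrow> 'q) \<Rightarrow>
   ('p, 'a, 'p, 'a) connection \<Rightarrow> ('p, 'a, 'q, 'b) connection \<Rightarrow>
   ('p \<Rightarrow> ('p, 'a) tvec) \<Rightarrow> ('p \<Rightarrow> ('p, 'a) tvec) \<Rightarrow> 'p \<Rightarrow> ('q, 'b) tvec" where
  "second_fundamental_form A B F nabla D U W p =
     D p (U p) (\<lambda>q. dmap A B F q (W q)) - dmap A B F p (nabla p (U p) W)"

text \<open>
  The trace at \<open>p\<close> is the sum of \<open>(\<nabla>F\<^sub>*)(E\<^sub>b, E\<^sub>b)\<close> over local vector fields \<open>E\<^sub>b\<close> whose values at
  \<open>p\<close> form an orthonormal basis of \<open>T\<^sub>pM\<close>. They are indexed by the standard basis of \<open>'a\<close>,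
  which serves only as an index set with \<open>DIM('a)\<close> elements. Because \<open>\<nabla>F\<^sub>*\<close> is a tensor, the
  sum does not depend on the choice. The Levi-Civita connections and the pullback connection
  are uniquely determined on smooth local sections, so the quantification over \<open>nabla\<close>,
  \<open>nabla'\<close> and \<open>D\<close> merely introduces them.
\<close>

definition harmonic_map ::
  "('p::topological_space, 'a::euclidean_space) chart set \<Rightarrow> ('p, 'a) metric \<Rightarrow>
   ('q::topological_space, 'b::euclidean_space) chart set \<Rightarrow> ('q, 'b) metric \<Rightarrow>
   ('p \<Rightarrow> 'q) \<Rightarrow> bool" where
  "harmonic_map A g B h F \<longleftrightarrow> smooth_map A B F \<and>
     (\<forall>nabla nabla' D. levi_civita A g nabla \<longrightarrow> levi_civita B h nabla' \<longrightarrow>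
        pullback_connection A B F nabla' D \<longrightarrow>
        (\<forall>p W E. open W \<longrightarrow> p \<in> W \<longrightarrow> (\<forall>b\<in>Basis. vector_field A W (E b)) \<longrightarrow>
           (\<forall>b\<in>Basis. \<forall>b'\<in>Basis. g p (E b p) (E b' p) = (if b = b' then 1 else 0)) \<longrightarrow>
           (\<Sum>b\<in>(Basis::'a set). second_fundamental_form A B F nabla D (E b) (E b) p) = 0))"

end

theory Submission
  imports Defs
begin

text \<open>
  Write \<open>S(U, Y) = (\<nabla>F\<^sub>*)(U, Y)\<close>. It is symmetric because both Levi-Civita connections are
  torsion-free, hence tensorial in both arguments.

  If \<open>Y\<close> is horizontal at \<open>p\<close>, then \<open>g(Y, Y) - h(F\<^sub>* Y, F\<^sub>* Y) \<ge> 0\<close> has a minimum at \<open>p\<close>;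
  its derivative vanishes, which says \<open>h(S(U, Y), F\<^sub>* Y) = 0\<close>. So \<open>h(S(X, Y), F\<^sub>* Z)\<close> is symmetric
  in \<open>X, Y\<close> and skew in \<open>Y, Z\<close> on horizontal vectors, and vanishes there.

  The fibres are complex submanifolds with respect to \<open>J\<close>. Hence \<open>h(F\<^sub>* JY, F\<^sub>* Z) = - h(F\<^sub>* Y, F\<^sub>* JZ)\<close>
  for all fields, and differentiating this where \<open>Y\<close> is vertical gives
  \<open>h(S(U, JY), F\<^sub>* Z) = - h(S(U, Y), F\<^sub>* JZ)\<close>, so that \<open>S(JV, JW) = - S(V, W)\<close> for vertical \<open>V, W\<close>.
  The trace of \<open>S\<close> over the vertical space is thus its own negative. Working with the minimum
  argument and the derived identity avoids extending vertical or horizontal vectors to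
  vertical or horizontal fields.
\<close>

section \<open>Smooth functions on open sets\<close>

text \<open>The identity for \<open>J\<close> rests on the fact that
  \<open>h(F\<^sub>* u, F\<^sub>* w)\<close> is the metric product of the horizontal parts of
  \<open>u\<close> and \<open>w\<close>: \<open>J\<close> preserves the vertical and the horizontal
  spaces and is skew. Using its derived form twice, with the symmetry of \<open>S\<close> in
  between, moves two copies of \<open>J\<close> onto the test vector, and their product is -1. Since
  \<open>F\<^sub>*\<close> is onto, products with \<open>F\<^sub>* Z\<close> determine
  \<open>S\<close>.

  Mixed values of \<open>S\<close>, with one vertical and one horizontal argument, are not shown to
  vanish. They drop out of the trace because the two orthogonal projections annihilate each other,
  and this works for any orthonormal basis, adapted to the splitting or not.

  The connections are known only through their axioms. \<open>D\<close> is prescribed only on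
  composites of \<open>F\<close> with fields on the target, so its torsion and metric properties are
  obtained by expanding sections in a coordinate frame along \<open>F\<close>. And \<open>J\<close>
  is parallel for one Levi-Civita connection, while harmonicity quantifies over all of them;
  uniqueness of that connection closes the gap.\<close>

lemma frechet_derivative_at_apply:
  "(f has_derivative f') (at x) \<Longrightarrow> frechet_derivative f (at x) v = f' v"
  using frechet_derivative_at[of f f' x] by simp

text \<open>Derivatives are taken with \<open>at x\<close> and not within \<open>S\<close>, so
  agreement on \<open>S\<close> passes to them because \<open>S\<close> is open. The closure lemmas
  below establish a formula for the derivative pointwise and transfer regularity through it.\<close>

lemma Ck_on_cong:
  fixes f g :: "'a::euclidean_space \<Rightarrow> 'b::real_normed_vector"
  assumes "open S" "Ck_on k S f" "\<And>x. x \<in> S \<Longrightarrow> f x = g x"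
  shows "Ck_on k S g"
  using assms(2,3)
proof (induction k arbitrary: f g)
  case 0
  then show ?case by (auto cong: continuous_on_cong)
next
  case (Suc k)
  have diff: "g differentiable (at x)" if "x \<in> S" for x
  proof -
    have "(f has_derivative frechet_derivative f (at x)) (at x)"
      using Suc.prems(1) that by (auto simp: frechet_derivative_works)
    then have "(g has_derivative frechet_derivative f (at x)) (at x)"
      by (rule has_derivative_transform_within_open[OF _ \<open>open S\<close> that Suc.prems(2)])
    then show ?thesis by (auto simp: differentiable_def)
  qed
  have eq: "frechet_derivative f (at x) v = frechet_derivative g (at x) v" if "x \<in> S" for x v
  proof -
    have "f differentiable (at x)" using Suc.prems(1) that by auto
    from frechet_derivative_transform_within_open[OF this \<open>open S\<close> that Suc.prems(2)]
    show ?thesis by simp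
  qed
  have "Ck_on k S (\<lambda>x. frechet_derivative g (at x) v)" for v
  proof (rule Suc.IH)
    show "Ck_on k S (\<lambda>x. frechet_derivative f (at x) v)" using Suc.prems(1) by simp
  qed (rule eq)
  then show ?case using diff by simp
qed

lemma Ck_on_Suc_imp: "Ck_on (Suc k) S f \<Longrightarrow> Ck_on k S f"
proof (induction k arbitrary: f)
  case 0
  then have "f differentiable_on S"
    by (intro differentiable_at_imp_differentiable_on) auto
  then show ?case by (simp add: differentiable_imp_continuous_on)
next
  case (Suc k)
  then show ?case
    by (metis Ck_on.simps(2))
qed

lemma Ck_on_subset: "Ck_on k S f \<Longrightarrow> T \<subseteq> S \<Longrightarrow> Ck_on k T f"
  by (induction k arbitrary: f) (auto intro: continuous_on_subset)

text \<open>For functions whose smoothness is visible only in a target chart that changes with the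
  point, as in \<open>smooth_fun_on_compose\<close>.\<close>

lemma Ck_on_local:
  assumes "\<And>x. x \<in> S \<Longrightarrow> \<exists>U. open U \<and> x \<in> U \<and> U \<subseteq> S \<and> Ck_on k U f"
  shows "Ck_on k S f"
  using assms
proof (induction k arbitrary: f)
  case 0
  then have "\<exists>U. open U \<and> x \<in> U \<and> continuous_on U f" if "x \<in> S" for x
    using that by fastforce
  then have "isCont f x" if "x \<in> S" for x
    using that by (metis continuous_on_eq_continuous_at)
  then show ?case by (simp add: continuous_at_imp_continuous_on)
next
  case (Suc k)
  have "f differentiable (at x)" if "x \<in> S" for x
    using Suc.prems[OF that] by auto
  moreover have "Ck_on k S (\<lambda>x. frechet_derivative f (at x) v)" for v
    by (rule Suc.IH) (use Suc.prems in fastforce)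
  ultimately show ?case by simp
qed

lemma Ck_on_const: "Ck_on k S (\<lambda>x. c)"
  by (induction k arbitrary: c) auto

lemma Ck_on_bounded_linear:
  fixes f :: "'a::euclidean_space \<Rightarrow> 'b::real_normed_vector"
  assumes "open S" "bounded_linear h" "Ck_on k S f"
  shows "Ck_on k S (\<lambda>x. h (f x))"
  using assms(3)
proof (induction k arbitrary: f)
  case 0
  then show ?case
    by (simp add: bounded_linear.continuous_on[OF assms(2)])
next
  case (Suc k)
  have der: "((\<lambda>x. h (f x)) has_derivative (\<lambda>v. h (frechet_derivative f (at x) v))) (at x)"
    if "x \<in> S" for x
    using Suc.prems that
    by (intro bounded_linear.has_derivative[OF assms(2)]) (auto simp: frechet_derivative_works)
  have "Ck_on k S (\<lambda>x. frechet_derivative (\<lambda>x. h (f x)) (at x) v)" for v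
  proof (rule Ck_on_cong[OF \<open>open S\<close>])
    show "Ck_on k S (\<lambda>x. h (frechet_derivative f (at x) v))"
      using Suc by auto
    show "h (frechet_derivative f (at x) v) = frechet_derivative (\<lambda>x. h (f x)) (at x) v"
      if "x \<in> S" for x
      by (rule frechet_derivative_at_apply[OF der[OF that], symmetric])
  qed
  then show ?case using der by (auto simp: differentiable_def)
qed

lemma Ck_on_add:
  fixes f g :: "'a::euclidean_space \<Rightarrow> 'b::real_normed_vector"
  assumes "open S" "Ck_on k S f" "Ck_on k S g"
  shows "Ck_on k S (\<lambda>x. f x + g x)"
  using assms(2,3)
proof (induction k arbitrary: f g)
  case 0
  then show ?case by (simp add: continuous_on_add)
next
  case (Suc k)
  have der: "((\<lambda>x. f x + g x) has_derivative
      (\<lambda>v. frechet_derivative f (at x) v + frechet_derivative g (at x) v)) (at x)"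
    if "x \<in> S" for x
    using Suc.prems that
    by (intro has_derivative_add) (auto simp: frechet_derivative_works)
  have "Ck_on k S (\<lambda>x. frechet_derivative (\<lambda>x. f x + g x) (at x) v)" for v
  proof (rule Ck_on_cong[OF \<open>open S\<close>])
    show "Ck_on k S (\<lambda>x. frechet_derivative f (at x) v + frechet_derivative g (at x) v)"
      using Suc by auto
    show "frechet_derivative f (at x) v + frechet_derivative g (at x) v =
        frechet_derivative (\<lambda>x. f x + g x) (at x) v" if "x \<in> S" for x
      by (rule frechet_derivative_at_apply[OF der[OF that], symmetric])
  qed
  then show ?case using der by (auto simp: differentiable_def)
qed

lemma Ck_on_sum:
  fixes f :: "'i \<Rightarrow> 'a::euclidean_space \<Rightarrow> 'b::real_normed_vector"
  assumes "open S" "\<And>i. i \<in> T \<Longrightarrow> Ck_on k S (f i)"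
  shows "Ck_on k S (\<lambda>x. \<Sum>i\<in>T. f i x)"
  using assms(2)
proof (induction T rule: infinite_finite_induct)
  case (insert i T)
  then show ?case by (simp add: Ck_on_add[OF \<open>open S\<close>])
qed (simp_all add: Ck_on_const)

lemma Ck_on_scaleR:
  fixes r :: "'a::euclidean_space \<Rightarrow> real" and f :: "'a \<Rightarrow> 'b::real_normed_vector"
  assumes "open S" "Ck_on k S r" "Ck_on k S f"
  shows "Ck_on k S (\<lambda>x. r x *\<^sub>R f x)"
  using assms(2,3)
proof (induction k arbitrary: r f)
  case 0
  then show ?case by (simp add: continuous_on_scaleR)
next
  case (Suc k)
  have der: "((\<lambda>x. r x *\<^sub>R f x) has_derivative
      (\<lambda>v. r x *\<^sub>R frechet_derivative f (at x) v + frechet_derivative r (at x) v *\<^sub>R f x)) (at x)"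
    if "x \<in> S" for x
    using Suc.prems that
    by (intro has_derivative_scaleR) (auto simp: frechet_derivative_works)
  have "Ck_on k S (\<lambda>x. frechet_derivative (\<lambda>x. r x *\<^sub>R f x) (at x) v)" for v
  proof (rule Ck_on_cong[OF \<open>open S\<close>])
    \<comment> \<open>Each product pairs a differentiated factor of class k with an undifferentiated
      one of class k + 1, which is lowered to k before the induction hypothesis applies.\<close>
    show "Ck_on k S (\<lambda>x. r x *\<^sub>R frechet_derivative f (at x) v + frechet_derivative r (at x) v *\<^sub>R f x)"
      using Suc.prems Ck_on_Suc_imp[OF Suc.prems(1)] Ck_on_Suc_imp[OF Suc.prems(2)]
      by (intro Ck_on_add[OF \<open>open S\<close>] Suc.IH) auto
    show "r x *\<^sub>R frechet_derivative f (at x) v + frechet_derivative r (at x) v *\<^sub>R f x =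
        frechet_derivative (\<lambda>x. r x *\<^sub>R f x) (at x) v" if "x \<in> S" for x
      by (rule frechet_derivative_at_apply[OF der[OF that], symmetric])
  qed
  then show ?case using der by (auto simp: differentiable_def)
qed

text \<open>\<open>Ck_on\<close> speaks of derivatives in a fixed direction. This expansion reduces
  a derivative applied to a varying vector to fixed directions with varying coefficients.\<close>

lemma linear_euclidean_expansion:
  fixes h :: "'a::euclidean_space \<Rightarrow> 'b::real_vector"
  assumes "linear h"
  shows "h x = (\<Sum>b\<in>Basis. (x \<bullet> b) *\<^sub>R h b)"
proof -
  have "h x = h (\<Sum>b\<in>Basis. (x \<bullet> b) *\<^sub>R b)" by (simp add: euclidean_representation)
  also have "\<dots> = (\<Sum>b\<in>Basis. (x \<bullet> b) *\<^sub>R h b)"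
    using assms by (simp add: linear_sum linear_scale)
  finally show ?thesis .
qed

text \<open>The chain rule applies the derivative of \<open>f\<close> at \<open>g x\<close> to a
  vector that varies with \<open>x\<close>. Expanding that vector over \<open>Basis\<close> leaves
  composites of \<open>g\<close> with \<open>\<lambda>y. frechet_derivative f (at y) b\<close>, so
  the induction varies \<open>f\<close> and keeps \<open>g\<close> fixed.\<close>

lemma Ck_on_compose:
  fixes g :: "'a::euclidean_space \<Rightarrow> 'b::euclidean_space" and f :: "'b \<Rightarrow> 'c::real_normed_vector"
  assumes "open S" "open T" "g ` S \<subseteq> T" "Ck_on k S g" "Ck_on k T f"
  shows "Ck_on k S (\<lambda>x. f (g x))"
  using assms(4,5)
proof (induction k arbitrary: f)
  case 0
  then show ?case
    using assms(3) by (auto intro: continuous_on_compose2)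
next
  case (Suc k)
  have gS: "g x \<in> T" if "x \<in> S" for x using assms(3) that by auto
  have der: "((\<lambda>x. f (g x)) has_derivative
      (\<lambda>v. frechet_derivative f (at (g x)) (frechet_derivative g (at x) v))) (at x)"
    if "x \<in> S" for x
    using Suc.prems that gS[OF that]
    by (intro has_derivative_compose[of g _ _ _ f])
       (auto simp: frechet_derivative_works intro: has_derivative_at_withinI)
  have "Ck_on k S (\<lambda>x. frechet_derivative (\<lambda>x. f (g x)) (at x) v)" for v
  proof (rule Ck_on_cong[OF \<open>open S\<close>])
    show "Ck_on k S (\<lambda>x. \<Sum>b\<in>Basis. (frechet_derivative g (at x) v \<bullet> b) *\<^sub>R
        frechet_derivative f (at (g x)) b)"
    proof (intro Ck_on_sum[OF \<open>open S\<close>] Ck_on_scaleR[OF \<open>open S\<close>])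
      fix b :: 'b assume "b \<in> Basis"
      show "Ck_on k S (\<lambda>x. frechet_derivative g (at x) v \<bullet> b)"
        using Suc.prems
        by (intro Ck_on_bounded_linear[OF \<open>open S\<close> bounded_linear_inner_left]) auto
      show "Ck_on k S (\<lambda>x. frechet_derivative f (at (g x)) b)"
        using Suc.prems(2) Ck_on_Suc_imp[OF Suc.prems(1)] by (intro Suc.IH) auto
    qed
    show "(\<Sum>b\<in>Basis. (frechet_derivative g (at x) v \<bullet> b) *\<^sub>R frechet_derivative f (at (g x)) b)
        = frechet_derivative (\<lambda>x. f (g x)) (at x) v" if "x \<in> S" for x
    proof -
      have "linear (frechet_derivative f (at (g x)))"
        using Suc.prems(2) gS[OF that] by (auto intro: linear_frechet_derivative)
      then show ?thesis
        unfolding frechet_derivative_at[OF der[OF that], symmetric]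
        by (rule linear_euclidean_expansion[symmetric])
    qed
  qed
  then show ?case using der by (auto simp: differentiable_def)
qed

lemma smooth_on_cong:
  "open S \<Longrightarrow> smooth_on S f \<Longrightarrow> (\<And>x. x \<in> S \<Longrightarrow> f x = g x) \<Longrightarrow> smooth_on S g"
  unfolding smooth_on_def using Ck_on_cong by blast

lemma smooth_on_subset: "smooth_on S f \<Longrightarrow> T \<subseteq> S \<Longrightarrow> smooth_on T f"
  unfolding smooth_on_def using Ck_on_subset by blast

lemma smooth_on_const: "smooth_on S (\<lambda>x. c)"
  by (simp add: smooth_on_def Ck_on_const)

lemma smooth_on_add:
  "open S \<Longrightarrow> smooth_on S f \<Longrightarrow> smooth_on S g \<Longrightarrow> smooth_on S (\<lambda>x. f x + g x)"
  by (simp add: smooth_on_def Ck_on_add)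

lemma smooth_on_sum:
  "open S \<Longrightarrow> (\<And>i. i \<in> T \<Longrightarrow> smooth_on S (f i)) \<Longrightarrow> smooth_on S (\<lambda>x. \<Sum>i\<in>T. f i x)"
  by (simp add: smooth_on_def Ck_on_sum)

lemma smooth_on_scaleR:
  "open S \<Longrightarrow> smooth_on S r \<Longrightarrow> smooth_on S f \<Longrightarrow> smooth_on S (\<lambda>x. r x *\<^sub>R f x)"
  by (simp add: smooth_on_def Ck_on_scaleR)

lemma smooth_on_inner_left:
  "open S \<Longrightarrow> smooth_on S f \<Longrightarrow> smooth_on S (\<lambda>x. f x \<bullet> b)"
  by (simp add: smooth_on_def Ck_on_bounded_linear[OF _ bounded_linear_inner_left])

lemma smooth_on_compose:
  "open S \<Longrightarrow> open T \<Longrightarrow> g ` S \<subseteq> T \<Longrightarrow> smooth_on S g \<Longrightarrow> smooth_on T f \<Longrightarrow>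
    smooth_on S (\<lambda>x. f (g x))"
  by (metis smooth_on_def Ck_on_compose)

lemma smooth_on_imp_differentiable:
  "smooth_on S f \<Longrightarrow> x \<in> S \<Longrightarrow> f differentiable (at x)"
  unfolding smooth_on_def using Ck_on.simps(2) by blast

lemma smooth_on_imp_has_derivative:
  "smooth_on S f \<Longrightarrow> x \<in> S \<Longrightarrow> (f has_derivative frechet_derivative f (at x)) (at x)"
  using smooth_on_imp_differentiable frechet_derivative_works by blast

lemma smooth_on_imp_continuous_on: "smooth_on S f \<Longrightarrow> continuous_on S f"
  unfolding smooth_on_def using Ck_on.simps(1) by blast

lemma smooth_on_frechet_derivative:
  "smooth_on S f \<Longrightarrow> smooth_on S (\<lambda>x. frechet_derivative f (at x) v)"
  unfolding smooth_on_def using Ck_on.simps(2) by blast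

lemma smooth_on_frechet_derivative_apply:
  fixes f :: "'a::euclidean_space \<Rightarrow> 'b::real_normed_vector"
  assumes "open S" "smooth_on S f" "smooth_on S Y"
  shows "smooth_on S (\<lambda>x. frechet_derivative f (at x) (Y x))"
proof (rule smooth_on_cong[OF \<open>open S\<close>])
  show "smooth_on S (\<lambda>x. \<Sum>b\<in>Basis. (Y x \<bullet> b) *\<^sub>R frechet_derivative f (at x) b)"
    using assms
    by (intro smooth_on_sum smooth_on_scaleR smooth_on_inner_left smooth_on_frechet_derivative)
  show "(\<Sum>b\<in>Basis. (Y x \<bullet> b) *\<^sub>R frechet_derivative f (at x) b) = frechet_derivative f (at x) (Y x)"
    if "x \<in> S" for x
    by (rule linear_euclidean_expansion[symmetric])
       (use assms that in \<open>blast intro: linear_frechet_derivative smooth_on_imp_differentiable\<close>)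
qed

text \<open>The second difference of \<open>f\<close> along \<open>u\<close> and \<open>v\<close> is symmetric in \<open>u\<close> and \<open>v\<close>; by the mean
  value theorem, applied twice, it is \<open>h\<^sup>2\<close> times a second derivative at a nearby point.\<close>

lemma second_difference_mean_value:
  fixes f :: "'a::euclidean_space \<Rightarrow> real"
  assumes "smooth_on S f" "h > 0"
    and S: "\<And>s t. 0 \<le> s \<Longrightarrow> s \<le> h \<Longrightarrow> 0 \<le> t \<Longrightarrow> t \<le> h \<Longrightarrow> x + s *\<^sub>R u + t *\<^sub>R v \<in> S"
  obtains s t where "0 < s" "s < h" "0 < t" "t < h"
    "f (x + h *\<^sub>R u + h *\<^sub>R v) - f (x + h *\<^sub>R u) - (f (x + h *\<^sub>R v) - f x) =
     h * h * frechet_derivative (\<lambda>y. frechet_derivative f (at y) u) (at (x + s *\<^sub>R u + t *\<^sub>R v)) v"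
proof -
  define fu where "fu = (\<lambda>y. frechet_derivative f (at y) u)"
  define fuv where "fuv = (\<lambda>y. frechet_derivative fu (at y) v)"
  have fu: "smooth_on S fu"
    unfolding fu_def by (rule smooth_on_frechet_derivative[OF assms(1)])
  have D1: "((\<lambda>s. f (x + s *\<^sub>R u + t *\<^sub>R v)) has_real_derivative fu (x + s *\<^sub>R u + t *\<^sub>R v)) (at s)"
    if "0 \<le> s" "s \<le> h" "0 \<le> t" "t \<le> h" for s t
  proof -
    have "linear (frechet_derivative f (at (x + s *\<^sub>R u + t *\<^sub>R v)))"
      using S[OF that] assms(1) by (blast intro: linear_frechet_derivative smooth_on_imp_differentiable)
    then have eq: "frechet_derivative f (at (x + s *\<^sub>R u + t *\<^sub>R v)) (r *\<^sub>R u) =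
        fu (x + s *\<^sub>R u + t *\<^sub>R v) * r" for r
      by (simp add: fu_def linear_scale)
    have "((\<lambda>s. f (x + s *\<^sub>R u + t *\<^sub>R v)) has_derivative
        (\<lambda>r. frechet_derivative f (at (x + s *\<^sub>R u + t *\<^sub>R v)) (r *\<^sub>R u))) (at s)"
      by (rule has_derivative_compose[of "\<lambda>s. x + s *\<^sub>R u + t *\<^sub>R v" "\<lambda>r. r *\<^sub>R u"])
         (auto intro!: derivative_eq_intros smooth_on_imp_has_derivative[OF assms(1)] S that)
    then show ?thesis by (simp add: has_field_derivative_def eq)
  qed
  have D2: "((\<lambda>t. fu (x + s *\<^sub>R u + t *\<^sub>R v)) has_real_derivative fuv (x + s *\<^sub>R u + t *\<^sub>R v)) (at t)"
    if "0 \<le> s" "s \<le> h" "0 \<le> t" "t \<le> h" for s t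
  proof -
    have "linear (frechet_derivative fu (at (x + s *\<^sub>R u + t *\<^sub>R v)))"
      using S[OF that] fu by (blast intro: linear_frechet_derivative smooth_on_imp_differentiable)
    then have eq: "frechet_derivative fu (at (x + s *\<^sub>R u + t *\<^sub>R v)) (r *\<^sub>R v) =
        fuv (x + s *\<^sub>R u + t *\<^sub>R v) * r" for r
      by (simp add: fuv_def linear_scale)
    have "((\<lambda>t. fu (x + s *\<^sub>R u + t *\<^sub>R v)) has_derivative
        (\<lambda>r. frechet_derivative fu (at (x + s *\<^sub>R u + t *\<^sub>R v)) (r *\<^sub>R v))) (at t)"
      by (rule has_derivative_compose[of "\<lambda>t. x + s *\<^sub>R u + t *\<^sub>R v" "\<lambda>r. r *\<^sub>R v"])
         (auto intro!: derivative_eq_intros smooth_on_imp_has_derivative[OF fu] S that)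
    then show ?thesis by (simp add: has_field_derivative_def eq)
  qed
  \<comment> \<open>The summand \<open>0 *\<^sub>R v\<close> keeps both terms in the form covered by
    \<open>D1\<close>, with t = h and t = 0.\<close>
  define g where "g = (\<lambda>s. f (x + s *\<^sub>R u + h *\<^sub>R v) - f (x + s *\<^sub>R u + 0 *\<^sub>R v))"
  have "\<exists>s. 0 < s \<and> s < h \<and> g h - g 0 = (h - 0) * (fu (x + s *\<^sub>R u + h *\<^sub>R v) - fu (x + s *\<^sub>R u + 0 *\<^sub>R v))"
    unfolding g_def using \<open>h > 0\<close> by (intro MVT2 DERIV_diff D1) auto
  then obtain s where s: "0 < s" "s < h"
    "g h - g 0 = h * (fu (x + s *\<^sub>R u + h *\<^sub>R v) - fu (x + s *\<^sub>R u + 0 *\<^sub>R v))" by auto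
  have "\<exists>t. 0 < t \<and> t < h \<and> fu (x + s *\<^sub>R u + h *\<^sub>R v) - fu (x + s *\<^sub>R u + 0 *\<^sub>R v) =
      (h - 0) * fuv (x + s *\<^sub>R u + t *\<^sub>R v)"
    using \<open>h > 0\<close> s by (intro MVT2 D2) auto
  then obtain t where t: "0 < t" "t < h" "fu (x + s *\<^sub>R u + h *\<^sub>R v) - fu (x + s *\<^sub>R u + 0 *\<^sub>R v) =
      h * fuv (x + s *\<^sub>R u + t *\<^sub>R v)" by auto
  show thesis
  proof (rule that[OF s(1,2) t(1,2)])
    show "f (x + h *\<^sub>R u + h *\<^sub>R v) - f (x + h *\<^sub>R u) - (f (x + h *\<^sub>R v) - f x) =
      h * h * frechet_derivative (\<lambda>y. frechet_derivative f (at y) u) (at (x + s *\<^sub>R u + t *\<^sub>R v)) v"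
      using s(3) t(3) by (simp add: g_def fuv_def fu_def)
  qed
qed

text \<open>Both orders of differentiation represent the same second difference, each at some point
  near \<open>x\<close>. Continuity of the second derivatives moves both values to \<open>x\<close>
  up to e / 2.\<close>

lemma symmetric_second_derivative_real:
  fixes f :: "'a::euclidean_space \<Rightarrow> real"
  assumes "open S" "smooth_on S f" "x \<in> S"
  shows "frechet_derivative (\<lambda>y. frechet_derivative f (at y) u) (at x) v =
         frechet_derivative (\<lambda>y. frechet_derivative f (at y) v) (at x) u"
proof -
  define D where "D = (\<lambda>u v y. frechet_derivative (\<lambda>y. frechet_derivative f (at y) u) (at y) v)"
  have near: "\<exists>d>0. \<forall>y. dist y x < d \<longrightarrow> y \<in> S \<and> dist (D u v y) (D u v x) < e" if "e > 0" for e u v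
  proof -
    have "continuous_on S (D u v)"
      unfolding D_def
      by (intro smooth_on_imp_continuous_on smooth_on_frechet_derivative assms)
    then have "continuous (at x) (D u v)"
      using assms by (simp add: continuous_on_eq_continuous_at)
    then obtain d1 where "d1 > 0" "\<And>y. dist y x < d1 \<Longrightarrow> dist (D u v y) (D u v x) < e"
      using \<open>e > 0\<close> by (auto simp: continuous_at_eps_delta)
    moreover obtain d2 where "d2 > 0" "\<And>y. dist y x < d2 \<Longrightarrow> y \<in> S"
      using assms by (metis open_dist)
    ultimately show ?thesis by (intro exI[of _ "min d1 d2"]) auto
  qed
  have "\<bar>D u v x - D v u x\<bar> \<le> e" if "e > 0" for e
  proof -
    obtain d where d: "d > 0" "\<And>y. dist y x < d \<Longrightarrow> y \<in> S" "\<And>y. dist y x < d \<Longrightarrow> dist (D u v y) (D u v x) < e / 2"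
      using near[of "e / 2" u v] \<open>e > 0\<close> by auto
    obtain d' where d': "d' > 0" "\<And>y. dist y x < d' \<Longrightarrow> dist (D v u y) (D v u x) < e / 2"
      using near[of "e / 2" v u] \<open>e > 0\<close> by auto
    \<comment> \<open>With this side length the whole parallelogram spanned by
      \<open>h *\<^sub>R u\<close> and \<open>h *\<^sub>R v\<close> stays closer to \<open>x\<close>
      than \<open>min d d'\<close>. The summand 1 keeps the denominator positive when
      \<open>u\<close> and \<open>v\<close> vanish.\<close>
    define h where "h = min d d' / (2 * (norm u + norm v + 1))"
    have n: "0 < norm u + norm v + 1" by (smt (verit) norm_ge_zero)
    have "h > 0" using d d' n by (simp add: h_def)
    have hd: "h * (norm u + norm v) < min d d'"
    proof -
      have "h * (norm u + norm v) \<le> h * (norm u + norm v + 1)"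
        using \<open>h > 0\<close> by (intro mult_left_mono) auto
      also have "\<dots> = min d d' / 2" unfolding h_def using n by (simp add: divide_simps del: distrib_left_numeral)
      also have "\<dots> < min d d'" using d d' by auto
      finally show ?thesis .
    qed
    have close: "dist (x + s *\<^sub>R u + t *\<^sub>R v) x < min d d'"
      if "0 \<le> s" "s \<le> h" "0 \<le> t" "t \<le> h" for s t
    proof -
      have "dist (x + s *\<^sub>R u + t *\<^sub>R v) x = norm (s *\<^sub>R u + t *\<^sub>R v)"
        by (simp add: dist_norm algebra_simps)
      also have "\<dots> \<le> s * norm u + t * norm v"
        using norm_triangle_ineq[of "s *\<^sub>R u" "t *\<^sub>R v"] that by simp
      also have "\<dots> \<le> h * (norm u + norm v)"
        using that by (auto simp: distrib_left intro!: add_mono mult_right_mono)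
      finally show ?thesis using hd by simp
    qed
    have close': "dist (x + s *\<^sub>R v + t *\<^sub>R u) x < min d d'"
      if "0 \<le> s" "s \<le> h" "0 \<le> t" "t \<le> h" for s t
      using close[of t s] that by (simp add: algebra_simps)
    obtain s t where st: "0 < s" "s < h" "0 < t" "t < h"
      "f (x + h *\<^sub>R u + h *\<^sub>R v) - f (x + h *\<^sub>R u) - (f (x + h *\<^sub>R v) - f x) =
       h * h * D u v (x + s *\<^sub>R u + t *\<^sub>R v)"
      unfolding D_def
      by (rule second_difference_mean_value[OF assms(2) \<open>h > 0\<close>, of x u v]) (use close d in auto)
    obtain s' t' where st': "0 < s'" "s' < h" "0 < t'" "t' < h"
      "f (x + h *\<^sub>R v + h *\<^sub>R u) - f (x + h *\<^sub>R v) - (f (x + h *\<^sub>R u) - f x) =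
       h * h * D v u (x + s' *\<^sub>R v + t' *\<^sub>R u)"
      unfolding D_def
      by (rule second_difference_mean_value[OF assms(2) \<open>h > 0\<close>, of x v u]) (use close' d in auto)
    have "h * h * D u v (x + s *\<^sub>R u + t *\<^sub>R v) = h * h * D v u (x + s' *\<^sub>R v + t' *\<^sub>R u)"
      using st(5) st'(5) by (simp add: algebra_simps)
    then have eq: "D u v (x + s *\<^sub>R u + t *\<^sub>R v) = D v u (x + s' *\<^sub>R v + t' *\<^sub>R u)"
      using \<open>h > 0\<close> by simp
    have "dist (D u v (x + s *\<^sub>R u + t *\<^sub>R v)) (D u v x) < e / 2"
      using d(3) close st by auto
    moreover have "dist (D v u (x + s' *\<^sub>R v + t' *\<^sub>R u)) (D v u x) < e / 2"
      using d'(2) close' st' by auto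
    ultimately show ?thesis unfolding eq dist_real_def by linarith
  qed
  then have "\<bar>D u v x - D v u x\<bar> \<le> 0" by (metis dense_ge)
  then show ?thesis by (simp add: D_def)
qed

lemma frechet_derivative_inner_left:
  assumes "f differentiable (at x)"
  shows "frechet_derivative (\<lambda>y. f y \<bullet> b) (at x) v = frechet_derivative f (at x) v \<bullet> b"
proof -
  have "((\<lambda>y. f y \<bullet> b) has_derivative (\<lambda>v. frechet_derivative f (at x) v \<bullet> b)) (at x)"
    using assms
    by (intro bounded_linear.has_derivative[OF bounded_linear_inner_left]) (simp add: frechet_derivative_works)
  then show ?thesis by (rule frechet_derivative_at_apply)
qed

text \<open>The mean value equality fails for vector-valued functions, hence the reduction to the
  components \<open>f y \<bullet> b\<close>.\<close>

lemma symmetric_second_derivative: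
  fixes f :: "'a::euclidean_space \<Rightarrow> 'b::euclidean_space"
  assumes "open S" "smooth_on S f" "x \<in> S"
  shows "frechet_derivative (\<lambda>y. frechet_derivative f (at y) u) (at x) v =
         frechet_derivative (\<lambda>y. frechet_derivative f (at y) v) (at x) u"
proof (rule euclidean_eqI)
  fix b :: 'b assume "b \<in> Basis"
  have eq: "frechet_derivative (\<lambda>y. frechet_derivative (\<lambda>y. f y \<bullet> b) (at y) u) (at x) v =
      frechet_derivative (\<lambda>y. frechet_derivative f (at y) u) (at x) v \<bullet> b" for u v
  proof -
    have d: "(\<lambda>y. frechet_derivative f (at y) u) differentiable (at x)"
      by (rule smooth_on_imp_differentiable[OF smooth_on_frechet_derivative[OF assms(2)] assms(3)])
    have "frechet_derivative (\<lambda>y. frechet_derivative f (at y) u \<bullet> b) (at x) =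
          frechet_derivative (\<lambda>y. frechet_derivative (\<lambda>y. f y \<bullet> b) (at y) u) (at x)"
    proof (rule frechet_derivative_transform_within_open[OF _ assms(1,3)])
      show "(\<lambda>y. frechet_derivative f (at y) u \<bullet> b) differentiable (at x)"
        by (rule smooth_on_imp_differentiable[OF smooth_on_inner_left[OF assms(1)
              smooth_on_frechet_derivative[OF assms(2)]] assms(3)])
    qed (simp add: frechet_derivative_inner_left smooth_on_imp_differentiable[OF assms(2)])
    with frechet_derivative_inner_left[OF d, of b v] show ?thesis by simp
  qed
  show "frechet_derivative (\<lambda>y. frechet_derivative f (at y) u) (at x) v \<bullet> b =
        frechet_derivative (\<lambda>y. frechet_derivative f (at y) v) (at x) u \<bullet> b"
    using symmetric_second_derivative_real[OF assms(1) smooth_on_inner_left[OF assms(1,2)] assms(3), of b u v]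
    by (simp add: eq)
qed

text \<open>A product rule. Freezing the direction at \<open>Y x\<close> isolates the second
  derivative of \<open>f\<close>, which cancels by symmetry in \<open>pullback_torsion_free\<close>;
  the other term produces the image of the Lie bracket.\<close>

lemma frechet_derivative_apply_field:
  fixes f :: "'a::euclidean_space \<Rightarrow> 'b::euclidean_space"
  assumes "open S" "smooth_on S f" "smooth_on S Y" "x \<in> S"
  shows "frechet_derivative (\<lambda>y. frechet_derivative f (at y) (Y y)) (at x) v =
    frechet_derivative (\<lambda>y. frechet_derivative f (at y) (Y x)) (at x) v +
    frechet_derivative f (at x) (frechet_derivative Y (at x) v)"
proof -
  have lin: "linear (frechet_derivative f (at y))" if "y \<in> S" for y
    using that assms by (blast intro: linear_frechet_derivative smooth_on_imp_differentiable)
  let ?G = "\<lambda>z y. \<Sum>b\<in>Basis. (z \<bullet> b) *\<^sub>R frechet_derivative f (at y) b"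
  have eqG: "frechet_derivative f (at y) z = ?G z y" if "y \<in> S" for y z
    by (rule linear_euclidean_expansion[OF lin[OF that]])
  have sm: "smooth_on S (\<lambda>y. frechet_derivative f (at y) b)" for b
    by (rule smooth_on_frechet_derivative[OF assms(2)])
  note der = smooth_on_imp_has_derivative[OF sm assms(4)] smooth_on_imp_has_derivative[OF assms(3,4)]
  have "((\<lambda>y. ?G (Y y) y) has_derivative (\<lambda>v. \<Sum>b\<in>Basis.
      (Y x \<bullet> b) *\<^sub>R frechet_derivative (\<lambda>y. frechet_derivative f (at y) b) (at x) v +
      (frechet_derivative Y (at x) v \<bullet> b) *\<^sub>R frechet_derivative f (at x) b)) (at x)"
    by (intro has_derivative_sum has_derivative_scaleR der has_derivative_inner_left)
  then have 1: "((\<lambda>y. frechet_derivative f (at y) (Y y)) has_derivative (\<lambda>v. \<Sum>b\<in>Basis.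
      (Y x \<bullet> b) *\<^sub>R frechet_derivative (\<lambda>y. frechet_derivative f (at y) b) (at x) v +
      (frechet_derivative Y (at x) v \<bullet> b) *\<^sub>R frechet_derivative f (at x) b)) (at x)"
    by (rule has_derivative_transform_within_open[OF _ assms(1,4)]) (simp add: eqG)
  have "((\<lambda>y. ?G (Y x) y) has_derivative (\<lambda>v. \<Sum>b\<in>Basis.
      (Y x \<bullet> b) *\<^sub>R frechet_derivative (\<lambda>y. frechet_derivative f (at y) b) (at x) v)) (at x)"
    by (intro has_derivative_sum has_derivative_scaleR_right der)
  then have 2: "((\<lambda>y. frechet_derivative f (at y) (Y x)) has_derivative (\<lambda>v. \<Sum>b\<in>Basis.
      (Y x \<bullet> b) *\<^sub>R frechet_derivative (\<lambda>y. frechet_derivative f (at y) b) (at x) v)) (at x)"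
    by (rule has_derivative_transform_within_open[OF _ assms(1,4)]) (simp add: eqG)
  show ?thesis
    unfolding frechet_derivative_at[OF 1, symmetric] frechet_derivative_at[OF 2, symmetric]
      eqG[OF assms(4), of "frechet_derivative Y (at x) v"]
    by (simp add: sum.distrib)
qed

section \<open>Charts and tangent vectors\<close>

locale manifold =
  fixes A :: "('p::{t2_space, second_countable_topology}, 'a::euclidean_space) chart set"
  assumes atlas: "smooth_atlas A"
begin

lemma homeo:
  "c \<in> A \<Longrightarrow> homeomorphism (chart_dom c) (coord c ` chart_dom c) (coord c) (param c)"
  using atlas by (auto simp: smooth_atlas_def)

lemma open_chart_dom: "c \<in> A \<Longrightarrow> open (chart_dom c)"
  using atlas by (auto simp: smooth_atlas_def)

lemma param_coord [simp]: "c \<in> A \<Longrightarrow> p \<in> chart_dom c \<Longrightarrow> param c (coord c p) = p"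
  using homeomorphism_apply1[OF homeo] by blast

lemma open_coord_image:
  assumes "c \<in> A" "open W"
  shows "open (coord c ` (chart_dom c \<inter> W))"
proof -
  have "openin (top_of_set (coord c ` chart_dom c)) (coord c ` (chart_dom c \<inter> W))"
    by (rule homeomorphism_imp_open_map[OF homeo]) (use assms in auto)
  moreover have "open (coord c ` chart_dom c)"
    using atlas assms by (auto simp: smooth_atlas_def)
  ultimately show ?thesis by (rule openin_open_trans)
qed

lemma smooth_transition:
  "c \<in> A \<Longrightarrow> d \<in> A \<Longrightarrow>
    smooth_on (coord c ` (chart_dom c \<inter> chart_dom d)) (\<lambda>x. coord d (param c x))"
  using atlas by (auto simp: smooth_atlas_def)

lemma chart_at: "chart_at A p \<in> A" "p \<in> chart_dom (chart_at A p)"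
proof -
  have "p \<in> (\<Union>c\<in>A. chart_dom c)" using atlas by (auto simp: smooth_atlas_def)
  then have "\<exists>c. c \<in> A \<and> p \<in> chart_dom c" by auto
  from someI_ex[OF this] show "chart_at A p \<in> A" "p \<in> chart_dom (chart_at A p)"
    by (auto simp: chart_at_def)
qed

abbreviation transition_derivative :: "('p, 'a) chart \<Rightarrow> ('p, 'a) chart \<Rightarrow> 'p \<Rightarrow> 'a \<Rightarrow> 'a" where
  "transition_derivative c d p \<equiv> frechet_derivative (\<lambda>x. coord d (param c x)) (at (coord c p))"

lemma transition_has_derivative:
  assumes "c \<in> A" "d \<in> A" "p \<in> chart_dom c" "p \<in> chart_dom d"
  shows "((\<lambda>x. coord d (param c x)) has_derivative transition_derivative c d p) (at (coord c p))"
  using smooth_on_imp_has_derivative[OF smooth_transition[OF assms(1,2)]] assms by auto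

lemma linear_transition_derivative:
  assumes "c \<in> A" "d \<in> A" "p \<in> chart_dom c" "p \<in> chart_dom d"
  shows "linear (transition_derivative c d p)"
  using transition_has_derivative[OF assms] has_derivative_linear by blast

text \<open>The chain rule behind all chart independence:
  \<open>transition_derivative_compose\<close>, \<open>dfun_eq\<close> and \<open>dmap_eq\<close>
  are applications of it.\<close>

lemma chart_change_has_derivative:
  assumes "c \<in> A" "d \<in> A" "p \<in> chart_dom c" "p \<in> chart_dom d"
    and "((\<lambda>x. f (param d x)) has_derivative f') (at (coord d p))"
  shows "((\<lambda>x. f (param c x)) has_derivative (\<lambda>z. f' (transition_derivative c d p z))) (at (coord c p))"
proof -
  have "((\<lambda>x. f (param d (coord d (param c x)))) has_derivative
      (\<lambda>z. f' (transition_derivative c d p z))) (at (coord c p))"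
    using has_derivative_compose[OF transition_has_derivative[OF assms(1-4)],
        of "\<lambda>x. f (param d x)" f'] assms by simp
  then show ?thesis
    by (rule has_derivative_transform_within_open[where s = "coord c ` (chart_dom c \<inter> chart_dom d)"])
       (use assms open_coord_image open_chart_dom in auto)
qed

lemma transition_derivative_self:
  assumes "c \<in> A" "p \<in> chart_dom c"
  shows "transition_derivative c c p z = z"
proof -
  have "((\<lambda>x. x) has_derivative (\<lambda>z. z)) (at (coord c p))" by simp
  then have "((\<lambda>x. coord c (param c x)) has_derivative (\<lambda>z. z)) (at (coord c p))"
    by (rule has_derivative_transform_within_open[where s = "coord c ` (chart_dom c \<inter> UNIV)"])
       (use assms open_coord_image[of c UNIV] in auto)
  then show ?thesis by (rule frechet_derivative_at_apply)
qed

lemma transition_derivative_compose: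
  assumes "c \<in> A" "d \<in> A" "e \<in> A" "p \<in> chart_dom c" "p \<in> chart_dom d" "p \<in> chart_dom e"
  shows "transition_derivative c e p z = transition_derivative d e p (transition_derivative c d p z)"
  by (rule frechet_derivative_at_apply[OF chart_change_has_derivative[OF assms(1,2,4,5)
        transition_has_derivative[OF assms(2,3,5,6)]]])

section \<open>The tangent space as a vector space, and coordinate vectors\<close>

lemma tangent_spaceD:
  assumes "v \<in> tangent_space A p" "c \<in> A" "d \<in> A" "p \<in> chart_dom c" "p \<in> chart_dom d"
  shows "v d = transition_derivative c d p (v c)"
  using assms unfolding tangent_space_def by blast

lemma tangent_space_outside:
  "v \<in> tangent_space A p \<Longrightarrow> c \<notin> A \<or> p \<notin> chart_dom c \<Longrightarrow> v c = 0"
  unfolding tangent_space_def by blast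

lemma tangent_spaceI:
  assumes "\<And>c d. c \<in> A \<Longrightarrow> d \<in> A \<Longrightarrow> p \<in> chart_dom c \<Longrightarrow> p \<in> chart_dom d \<Longrightarrow>
      v d = transition_derivative c d p (v c)"
    and "\<And>c. c \<notin> A \<or> p \<notin> chart_dom c \<Longrightarrow> v c = 0"
  shows "v \<in> tangent_space A p"
  unfolding tangent_space_def using assms by blast

text \<open>Transition derivatives determine the components in the other charts around
  \<open>p\<close>, and all remaining components are zero. Identities between tangent vectors can
  therefore be checked in a single chart.\<close>

lemma tangent_space_eqI:
  assumes "v \<in> tangent_space A p" "w \<in> tangent_space A p" "c \<in> A" "p \<in> chart_dom c" "v c = w c"
  shows "v = w"
proof
  fix d
  show "v d = w d"
  proof (cases "d \<in> A \<and> p \<in> chart_dom d")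
    case True
    then show ?thesis using tangent_spaceD assms by metis
  next
    case False
    then show ?thesis using tangent_space_outside assms by metis
  qed
qed

lemma tangent_zero: "0 \<in> tangent_space A p"
proof (rule tangent_spaceI)
  fix c d assume "c \<in> A" "d \<in> A" "p \<in> chart_dom c" "p \<in> chart_dom d"
  from linear_0[OF linear_transition_derivative[OF this]]
  show "0 d = transition_derivative c d p (0 c)" by simp
qed simp

lemma tangent_add:
  assumes "v \<in> tangent_space A p" "w \<in> tangent_space A p"
  shows "v + w \<in> tangent_space A p"
proof (rule tangent_spaceI)
  fix c d assume "c \<in> A" "d \<in> A" "p \<in> chart_dom c" "p \<in> chart_dom d"
  note cd = this
  show "(v + w) d = transition_derivative c d p ((v + w) c)"
    unfolding plus_fun_apply linear_add[OF linear_transition_derivative[OF cd]]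
    by (simp only: tangent_spaceD[OF assms(1) cd, symmetric] tangent_spaceD[OF assms(2) cd, symmetric])
next
  fix c assume "c \<notin> A \<or> p \<notin> chart_dom c"
  with tangent_space_outside[OF assms(1)] tangent_space_outside[OF assms(2)]
  show "(v + w) c = 0" by auto
qed

lemma tangent_scale:
  assumes "v \<in> tangent_space A p"
  shows "r *\<^sub>T v \<in> tangent_space A p"
proof (rule tangent_spaceI)
  fix c d assume "c \<in> A" "d \<in> A" "p \<in> chart_dom c" "p \<in> chart_dom d"
  note cd = this
  show "r *\<^sub>R v d = transition_derivative c d p (r *\<^sub>R v c)"
    unfolding linear_scale[OF linear_transition_derivative[OF cd]]
    by (simp only: tangent_spaceD[OF assms cd, symmetric])
next
  fix c assume "c \<notin> A \<or> p \<notin> chart_dom c"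
  with tangent_space_outside[OF assms] show "r *\<^sub>R v c = 0" by auto
qed

lemma tangent_sum:
  "(\<And>i. i \<in> S \<Longrightarrow> v i \<in> tangent_space A p) \<Longrightarrow> (\<Sum>i\<in>S. v i) \<in> tangent_space A p"
  by (induction S rule: infinite_finite_induct) (auto intro: tangent_add tangent_zero)

lemma tangent_uminus:
  "v \<in> tangent_space A p \<Longrightarrow> - v \<in> tangent_space A p"
  using tangent_scale[of v p "-1"] by (simp add: fun_Compl_def)

lemma tangent_diff:
  assumes "v \<in> tangent_space A p" "w \<in> tangent_space A p"
  shows "v - w \<in> tangent_space A p"
  using tangent_add[OF assms(1) tangent_uminus[OF assms(2)]] by simp

text \<open>As a function of \<open>p\<close> this is the field on \<open>chart_dom c\<close> with
  constant coordinates \<open>z\<close>: the coordinate frame when \<open>z\<close> runs through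
  \<open>Basis\<close>, and an extension of a given tangent vector \<open>v\<close> when
  \<open>z = v c\<close>.\<close>

definition coord_vec :: "('p, 'a) chart \<Rightarrow> 'a \<Rightarrow> 'p \<Rightarrow> ('p, 'a) tvec" where
  "coord_vec c z p = (\<lambda>d. if d \<in> A \<and> p \<in> chart_dom d then transition_derivative c d p z else 0)"

lemma coord_vec_tangent:
  "c \<in> A \<Longrightarrow> p \<in> chart_dom c \<Longrightarrow> coord_vec c z p \<in> tangent_space A p"
  by (rule tangent_spaceI)
     (auto simp: coord_vec_def intro: transition_derivative_compose)

lemma coord_vec_self: "c \<in> A \<Longrightarrow> p \<in> chart_dom c \<Longrightarrow> coord_vec c z p c = z"
  by (simp add: coord_vec_def transition_derivative_self)

lemma coord_vec_tangent_eq: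
  assumes "v \<in> tangent_space A p" "c \<in> A" "p \<in> chart_dom c"
  shows "coord_vec c (v c) p = v"
  by (rule tangent_space_eqI[OF coord_vec_tangent[OF assms(2,3)] assms(1-3)])
     (simp add: coord_vec_self assms)

lemma coord_vec_add:
  assumes "c \<in> A" "p \<in> chart_dom c"
  shows "coord_vec c (x + y) p = coord_vec c x p + coord_vec c y p"
  by (rule tangent_space_eqI[OF _ _ assms])
     (simp_all add: coord_vec_self assms coord_vec_tangent tangent_add)

lemma coord_vec_scale:
  assumes "c \<in> A" "p \<in> chart_dom c"
  shows "coord_vec c (r *\<^sub>R x) p = r *\<^sub>T coord_vec c x p"
  by (rule tangent_space_eqI[OF _ _ assms])
     (simp_all add: coord_vec_self assms coord_vec_tangent tangent_scale)

end

lemma sum_fun_apply: "(\<Sum>i\<in>S. f i) x = (\<Sum>i\<in>S. f i x)"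
  by (induction S rule: infinite_finite_induct) auto

section \<open>Smooth maps, sections and differentials\<close>

locale manifold_map = dom: manifold A + cod: manifold B
  for A :: "('p::{t2_space, second_countable_topology}, 'a::euclidean_space) chart set"
    and B :: "('q::{t2_space, second_countable_topology}, 'b::euclidean_space) chart set" +
  fixes F :: "'p \<Rightarrow> 'q"
  assumes smooth_F: "smooth_map A B F"

text \<open>Makes vector fields and affine connections instances of sections and connections along a
  map, so that each fact about them is proved once.\<close>

lemma (in manifold) manifold_map_id: "manifold_map A A id"
  by unfold_locales (auto simp: smooth_map_def smooth_transition atlas)

context manifold
begin

section \<open>Smooth real functions and their differentials\<close>

lemma smooth_fun_on_chart:
  "smooth_fun_on A W f \<Longrightarrow> c \<in> A \<Longrightarrow> smooth_on (coord c ` (chart_dom c \<inter> W)) (\<lambda>x. f (param c x))"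
  by (auto simp: smooth_fun_on_def)

lemma smooth_fun_on_subset: "smooth_fun_on A W f \<Longrightarrow> V \<subseteq> W \<Longrightarrow> smooth_fun_on A V f"
  unfolding smooth_fun_on_def by (meson Int_mono image_mono order_refl smooth_on_subset)

lemma smooth_fun_on_const: "smooth_fun_on A W (\<lambda>q. r)"
  by (simp add: smooth_fun_on_def smooth_on_const)

lemma smooth_fun_on_add:
  "open W \<Longrightarrow> smooth_fun_on A W f \<Longrightarrow> smooth_fun_on A W g \<Longrightarrow> smooth_fun_on A W (\<lambda>q. f q + g q)"
  by (simp add: smooth_fun_on_def smooth_on_add open_coord_image)

lemma smooth_fun_on_mult:
  assumes "open W" "smooth_fun_on A W f" "smooth_fun_on A W g"
  shows "smooth_fun_on A W (\<lambda>q. f q * g q)"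
  unfolding smooth_fun_on_def
proof
  fix c assume "c \<in> A"
  with smooth_on_scaleR[OF open_coord_image[OF this \<open>open W\<close>]]
  show "smooth_on (coord c ` (chart_dom c \<inter> W)) (\<lambda>x. f (param c x) * g (param c x))"
    using assms by (fastforce simp: smooth_fun_on_def)
qed

lemma smooth_fun_on_diff:
  assumes "open W" "smooth_fun_on A W f" "smooth_fun_on A W g"
  shows "smooth_fun_on A W (\<lambda>q. f q - g q)"
  using smooth_fun_on_add[OF assms(1,2) smooth_fun_on_mult[OF assms(1) smooth_fun_on_const[of W "-1"] assms(3)]]
  by simp

lemma smooth_fun_on_cong:
  assumes "open W" "smooth_fun_on A W f" "\<And>q. q \<in> W \<Longrightarrow> f q = g q"
  shows "smooth_fun_on A W g"
  unfolding smooth_fun_on_def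
proof
  fix c assume "c \<in> A"
  show "smooth_on (coord c ` (chart_dom c \<inter> W)) (\<lambda>x. g (param c x))"
    by (rule smooth_on_cong[OF open_coord_image[OF \<open>c \<in> A\<close> \<open>open W\<close>] smooth_fun_on_chart[OF assms(2) \<open>c \<in> A\<close>]])
       (use assms \<open>c \<in> A\<close> in auto)
qed

lemma smooth_fun_has_derivative:
  assumes "smooth_fun_on A W f" "p \<in> W" "c \<in> A" "p \<in> chart_dom c"
  shows "((\<lambda>x. f (param c x)) has_derivative
          frechet_derivative (\<lambda>x. f (param c x)) (at (coord c p))) (at (coord c p))"
  using smooth_on_imp_has_derivative[OF smooth_fun_on_chart[OF assms(1,3)]] assms by auto

lemma dfun_eq:
  assumes "smooth_fun_on A W f" "p \<in> W" "c \<in> A" "p \<in> chart_dom c" "v \<in> tangent_space A p"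
  shows "dfun A f p v = frechet_derivative (\<lambda>x. f (param c x)) (at (coord c p)) (v c)"
proof -
  let ?d = "chart_at A p"
  have "((\<lambda>x. f (param ?d x)) has_derivative (\<lambda>z. frechet_derivative (\<lambda>x. f (param c x)) (at (coord c p))
     (transition_derivative ?d c p z))) (at (coord ?d p))"
    by (intro chart_change_has_derivative smooth_fun_has_derivative[OF assms(1,2)] chart_at assms)
  then show ?thesis
    using tangent_spaceD[OF assms(5) chart_at(1) assms(3) chart_at(2) assms(4)]
    by (simp add: dfun_def Let_def frechet_derivative_at_apply)
qed

lemma dfun_eqI:
  assumes "((\<lambda>x. f (param (chart_at A p) x)) has_derivative f') (at (coord (chart_at A p) p))"
  shows "dfun A f p v = f' (v (chart_at A p))"
  by (simp add: dfun_def Let_def frechet_derivative_at_apply[OF assms])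

lemma dfun_has_derivative:
  assumes "smooth_fun_on A W f" "p \<in> W"
  shows "((\<lambda>x. f (param (chart_at A p) x)) has_derivative
    frechet_derivative (\<lambda>x. f (param (chart_at A p) x)) (at (coord (chart_at A p) p)))
    (at (coord (chart_at A p) p))"
  by (intro smooth_fun_has_derivative[OF assms] chart_at)

lemma dfun_add:
  assumes "smooth_fun_on A W f" "smooth_fun_on A W g" "p \<in> W"
  shows "dfun A (\<lambda>q. f q + g q) p v = dfun A f p v + dfun A g p v"
  using dfun_eqI[OF has_derivative_add[OF dfun_has_derivative[OF assms(1,3)] dfun_has_derivative[OF assms(2,3)]]]
  by (simp add: dfun_def Let_def)

lemma dfun_diff:
  assumes "smooth_fun_on A W f" "smooth_fun_on A W g" "p \<in> W"
  shows "dfun A (\<lambda>q. f q - g q) p v = dfun A f p v - dfun A g p v"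
  using dfun_eqI[OF has_derivative_diff[OF dfun_has_derivative[OF assms(1,3)] dfun_has_derivative[OF assms(2,3)]]]
  by (simp add: dfun_def Let_def)

lemma dfun_mult:
  assumes "smooth_fun_on A W f" "smooth_fun_on A W g" "p \<in> W"
  shows "dfun A (\<lambda>q. f q * g q) p v = dfun A f p v * g p + f p * dfun A g p v"
  using dfun_eqI[OF has_derivative_mult[OF dfun_has_derivative[OF assms(1,3)] dfun_has_derivative[OF assms(2,3)]]]
  by (simp add: dfun_def Let_def chart_at mult.commute)

lemma dfun_cong:
  assumes "open W" "smooth_fun_on A W f" "p \<in> W" "\<And>q. q \<in> W \<Longrightarrow> f q = g q"
  shows "dfun A f p v = dfun A g p v"
proof -
  let ?c = "chart_at A p"
  have "((\<lambda>x. g (param ?c x)) has_derivative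
    frechet_derivative (\<lambda>x. f (param ?c x)) (at (coord ?c p))) (at (coord ?c p))"
    by (rule has_derivative_transform_within_open[OF dfun_has_derivative[OF assms(2,3)]
          open_coord_image[OF chart_at(1) assms(1)]])
       (use assms chart_at in auto)
  from dfun_eqI[OF this] show ?thesis by (simp add: dfun_def Let_def)
qed

lemma dfun_const: "dfun A (\<lambda>q. r) p v = 0"
  by (simp add: dfun_def)

lemma dfun_local_min:
  assumes "open W" "smooth_fun_on A W f" "p \<in> W" "\<And>q. q \<in> W \<Longrightarrow> f p \<le> f q"
  shows "dfun A f p v = 0"
proof -
  let ?c = "chart_at A p"
  have "frechet_derivative (\<lambda>x. f (param ?c x)) (at (coord ?c p)) = (\<lambda>v. 0)"
    by (rule differential_zero_maxmin[OF _ open_coord_image[OF chart_at(1)[of p] assms(1)]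
          dfun_has_derivative[OF assms(2,3)]])
       (use assms chart_at in auto)
  then show ?thesis by (simp add: dfun_def)
qed

end

context manifold_map
begin

section \<open>Sections along a map and the differential of the map\<close>

lemma continuous_F: "continuous_on UNIV F"
  using smooth_F by (simp add: smooth_map_def)

lemma open_preimage: "open V \<Longrightarrow> open (F -` V)"
  using continuous_F by (simp add: continuous_on_open_vimage)

lemma open_section_dom: "c \<in> A \<Longrightarrow> d \<in> B \<Longrightarrow> open W \<Longrightarrow>
    open (coord c ` (chart_dom c \<inter> W \<inter> F -` chart_dom d))"
  using dom.open_coord_image[of c "W \<inter> F -` chart_dom d"]
    open_preimage[OF cod.open_chart_dom[of d]] by (auto simp: Int_assoc)

lemma smooth_coord_rep: "c \<in> A \<Longrightarrow> d \<in> B \<Longrightarrow>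
    smooth_on (coord c ` (chart_dom c \<inter> F -` chart_dom d)) (\<lambda>x. coord d (F (param c x)))"
  using smooth_F by (simp add: smooth_map_def)

lemma section_tangent: "section_along A B F W \<xi> \<Longrightarrow> p \<in> W \<Longrightarrow> \<xi> p \<in> tangent_space B (F p)"
  by (simp add: section_along_def)

lemma section_smooth: "section_along A B F W \<xi> \<Longrightarrow> c \<in> A \<Longrightarrow> d \<in> B \<Longrightarrow>
    smooth_on (coord c ` (chart_dom c \<inter> W \<inter> F -` chart_dom d)) (\<lambda>x. \<xi> (param c x) d)"
  by (simp add: section_along_def)

lemma section_subset:
  assumes "section_along A B F W \<xi>" "V \<subseteq> W"
  shows "section_along A B F V \<xi>"
proof -
  have "coord c ` (chart_dom c \<inter> V \<inter> F -` chart_dom d) \<subseteq>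
      coord c ` (chart_dom c \<inter> W \<inter> F -` chart_dom d)" for c :: "('p, 'a) chart" and d :: "('q, 'b) chart"
    using assms(2) by auto
  then show ?thesis
    using assms unfolding section_along_def by (meson smooth_on_subset subsetD)
qed

lemma section_zero: "section_along A B F W (\<lambda>q. 0)"
  by (simp add: section_along_def cod.tangent_zero smooth_on_const)

lemma section_add:
  "open W \<Longrightarrow> section_along A B F W \<xi> \<Longrightarrow> section_along A B F W \<eta> \<Longrightarrow>
    section_along A B F W (\<lambda>q. \<xi> q + \<eta> q)"
  by (simp add: section_along_def cod.tangent_add smooth_on_add open_section_dom)

lemma section_sum:
  assumes "open W" "\<And>i. i \<in> S \<Longrightarrow> section_along A B F W (\<xi> i)"
  shows "section_along A B F W (\<lambda>q. \<Sum>i\<in>S. \<xi> i q)"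
  using assms(2)
  by (induction S rule: infinite_finite_induct) (auto intro: section_zero section_add[OF assms(1)])

lemma section_scale:
  assumes "open W" "smooth_fun_on A W f" "section_along A B F W \<xi>"
  shows "section_along A B F W (\<lambda>q. f q *\<^sub>T \<xi> q)"
  unfolding section_along_def
proof (intro conjI ballI)
  fix p assume "p \<in> W"
  then show "f p *\<^sub>T \<xi> p \<in> tangent_space B (F p)"
    by (intro cod.tangent_scale section_tangent[OF assms(3)])
next
  fix c d assume "c \<in> A" "d \<in> B"
  have "smooth_on (coord c ` (chart_dom c \<inter> W \<inter> F -` chart_dom d)) (\<lambda>x. f (param c x))"
    by (rule smooth_on_subset[OF dom.smooth_fun_on_chart[OF assms(2) \<open>c \<in> A\<close>]]) auto
  then show "smooth_on (coord c ` (chart_dom c \<inter> W \<inter> F -` chart_dom d))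
      (\<lambda>x. f (param c x) *\<^sub>R \<xi> (param c x) d)"
    using \<open>c \<in> A\<close> \<open>d \<in> B\<close> assms by (intro smooth_on_scaleR open_section_dom section_smooth)
qed

lemma section_scale_const:
  "open W \<Longrightarrow> section_along A B F W \<xi> \<Longrightarrow> section_along A B F W (\<lambda>q. r *\<^sub>T \<xi> q)"
  using section_scale[OF _ dom.smooth_fun_on_const] by blast

lemma section_component:
  assumes "open W" "section_along A B F W \<xi>" "d \<in> B"
  shows "smooth_fun_on A (W \<inter> F -` chart_dom d) (\<lambda>q. \<xi> q d \<bullet> b)"
  unfolding smooth_fun_on_def
proof
  fix c assume "c \<in> A"
  show "smooth_on (coord c ` (chart_dom c \<inter> (W \<inter> F -` chart_dom d))) (\<lambda>x. \<xi> (param c x) d \<bullet> b)"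
    using smooth_on_inner_left[OF open_section_dom[OF \<open>c \<in> A\<close> assms(3,1)] section_smooth[OF assms(2) \<open>c \<in> A\<close> assms(3)]]
    by (simp add: Int_assoc)
qed

abbreviation coord_rep_derivative ::
  "('p, 'a) chart \<Rightarrow> ('q, 'b) chart \<Rightarrow> 'p \<Rightarrow> 'a \<Rightarrow> 'b" where
  "coord_rep_derivative c d p \<equiv> frechet_derivative (\<lambda>x. coord d (F (param c x))) (at (coord c p))"

lemma coord_rep_has_derivative:
  assumes "c \<in> A" "d \<in> B" "p \<in> chart_dom c" "F p \<in> chart_dom d"
  shows "((\<lambda>x. coord d (F (param c x))) has_derivative coord_rep_derivative c d p) (at (coord c p))"
  using smooth_on_imp_has_derivative[OF smooth_coord_rep[OF assms(1,2)]] assms by auto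

lemma linear_coord_rep_derivative:
  assumes "c \<in> A" "d \<in> B" "p \<in> chart_dom c" "F p \<in> chart_dom d"
  shows "linear (coord_rep_derivative c d p)"
  using coord_rep_has_derivative[OF assms] has_derivative_linear by blast

lemma dmap_eq:
  assumes "c \<in> A" "d \<in> B" "p \<in> chart_dom c" "F p \<in> chart_dom d" "v \<in> tangent_space A p"
  shows "dmap A B F p v d = coord_rep_derivative c d p (v c)"
proof -
  let ?c = "chart_at A p"
  have "((\<lambda>x. coord d (F (param ?c x))) has_derivative
      (\<lambda>z. coord_rep_derivative c d p (dom.transition_derivative ?c c p z))) (at (coord ?c p))"
    by (intro dom.chart_change_has_derivative coord_rep_has_derivative dom.chart_at assms)
  then show ?thesis
    using dom.tangent_spaceD[OF assms(5) dom.chart_at(1) assms(1) dom.chart_at(2) assms(3)] assms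
    by (simp add: dmap_def Let_def frechet_derivative_at_apply)
qed

lemma dmap_outside: "d \<notin> B \<or> F p \<notin> chart_dom d \<Longrightarrow> dmap A B F p v d = 0"
  by (auto simp: dmap_def Let_def)

lemma F_compose_has_derivative:
  assumes "c \<in> A" "d \<in> B" "p \<in> chart_dom c" "F p \<in> chart_dom d"
    and "((\<lambda>y. f (param d y)) has_derivative f') (at (coord d (F p)))"
  shows "((\<lambda>x. f (F (param c x))) has_derivative (\<lambda>z. f' (coord_rep_derivative c d p z))) (at (coord c p))"
proof -
  have "((\<lambda>x. f (param d (coord d (F (param c x))))) has_derivative
      (\<lambda>z. f' (coord_rep_derivative c d p z))) (at (coord c p))"
    using has_derivative_compose[OF coord_rep_has_derivative[OF assms(1-4)],
        of "\<lambda>x. f (param d x)" f'] assms by simp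
  then show ?thesis
    by (rule has_derivative_transform_within_open[where s = "coord c ` (chart_dom c \<inter> F -` chart_dom d)"])
       (use assms dom.open_coord_image open_preimage cod.open_chart_dom in auto)
qed

lemma dmap_tangent:
  assumes "v \<in> tangent_space A p"
  shows "dmap A B F p v \<in> tangent_space B (F p)"
proof -
  let ?c = "chart_at A p"
  have "dmap A B F p v e = cod.transition_derivative d e (F p) (dmap A B F p v d)"
    if "d \<in> B" "e \<in> B" "F p \<in> chart_dom d" "F p \<in> chart_dom e" for d e
  proof -
    have "((\<lambda>x. coord e (F (param ?c x))) has_derivative
        (\<lambda>z. cod.transition_derivative d e (F p) (coord_rep_derivative ?c d p z))) (at (coord ?c p))"
      by (intro F_compose_has_derivative cod.transition_has_derivative dom.chart_at that)
    from frechet_derivative_at_apply[OF this] show ?thesis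
      using that dom.chart_at by (simp add: dmap_eq[OF dom.chart_at(1) _ dom.chart_at(2) _ assms])
  qed
  then show ?thesis by (rule cod.tangent_spaceI) (assumption+, rule dmap_outside)
qed

lemma dmap_add:
  assumes "v \<in> tangent_space A p" "w \<in> tangent_space A p"
  shows "dmap A B F p (v + w) = dmap A B F p v + dmap A B F p w"
proof
  fix d
  show "dmap A B F p (v + w) d = (dmap A B F p v + dmap A B F p w) d"
    by (cases "d \<in> B \<and> F p \<in> chart_dom d")
       (auto simp: dmap_outside dmap_eq[OF dom.chart_at(1) _ dom.chart_at(2)] assms dom.tangent_add
          linear_add[OF linear_coord_rep_derivative[OF dom.chart_at(1) _ dom.chart_at(2)]])
qed

lemma dmap_scale:
  assumes "v \<in> tangent_space A p"
  shows "dmap A B F p (r *\<^sub>T v) = r *\<^sub>T dmap A B F p v"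
proof
  fix d
  show "dmap A B F p (r *\<^sub>T v) d = r *\<^sub>R dmap A B F p v d"
    by (cases "d \<in> B \<and> F p \<in> chart_dom d")
       (auto simp: dmap_outside dmap_eq[OF dom.chart_at(1) _ dom.chart_at(2)] assms dom.tangent_scale
          linear_scale[OF linear_coord_rep_derivative[OF dom.chart_at(1) _ dom.chart_at(2)]])
qed

lemma dmap_zero: "dmap A B F p 0 = 0"
  using dmap_scale[OF dom.tangent_zero, of p 0] by (simp add: zero_fun_def)

lemma dmap_uminus: "v \<in> tangent_space A p \<Longrightarrow> dmap A B F p (- v) = - dmap A B F p v"
  using dmap_scale[of v p "-1"] by (simp add: fun_Compl_def)

lemma dmap_diff:
  "v \<in> tangent_space A p \<Longrightarrow> w \<in> tangent_space A p \<Longrightarrow>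
    dmap A B F p (v - w) = dmap A B F p v - dmap A B F p w"
  using dmap_add[OF _ dom.tangent_uminus, of v p w] by (simp add: dmap_uminus)

text \<open>In charts the image of \<open>Y\<close> is the derivative of the coordinate
  representation of \<open>F\<close>, applied to the component of \<open>Y\<close>.\<close>

lemma section_dmap:
  assumes "open W" "vector_field A W Y"
  shows "section_along A B F W (\<lambda>q. dmap A B F q (Y q))"
  unfolding section_along_def
proof (intro conjI ballI)
  fix p assume "p \<in> W"
  then show "dmap A B F p (Y p) \<in> tangent_space B (F p)"
    using assms by (intro dmap_tangent) (simp add: section_along_def)
next
  fix c d assume cd: "c \<in> A" "d \<in> B"
  let ?S = "coord c ` (chart_dom c \<inter> W \<inter> F -` chart_dom d)"
  have op: "open ?S" by (intro open_section_dom cd assms)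
  have "smooth_on (coord c ` (chart_dom c \<inter> W \<inter> id -` chart_dom c)) (\<lambda>x. Y (param c x) c)"
    using assms(2) cd by (simp add: section_along_def)
  then have Y: "smooth_on ?S (\<lambda>x. Y (param c x) c)"
    by (rule smooth_on_subset) auto
  have F: "smooth_on ?S (\<lambda>x. coord d (F (param c x)))"
    by (rule smooth_on_subset[OF smooth_coord_rep[OF cd]]) auto
  show "smooth_on ?S (\<lambda>x. dmap A B F (param c x) (Y (param c x)) d)"
  proof (rule smooth_on_cong[OF op smooth_on_frechet_derivative_apply[OF op F Y]])
    fix x assume x: "x \<in> ?S"
    then have "param c x \<in> chart_dom c" "param c x \<in> W" "F (param c x) \<in> chart_dom d"
      "coord c (param c x) = x" using cd by auto
    moreover have "Y (param c x) \<in> tangent_space A (param c x)"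
      using assms(2) \<open>param c x \<in> W\<close> by (simp add: section_along_def)
    ultimately show "frechet_derivative (\<lambda>x. coord d (F (param c x))) (at x) (Y (param c x) c) =
        dmap A B F (param c x) (Y (param c x)) d"
      using cd by (simp add: dmap_eq)
  qed
qed

text \<open>\<open>f\<close> is smooth in charts of the target, and a single such chart need not
  contain the image of a whole chart of the domain. Smoothness is therefore shown near each
  point.\<close>

lemma smooth_fun_on_compose:
  assumes "open W" "smooth_fun_on B W f"
  shows "smooth_fun_on A (F -` W) (\<lambda>q. f (F q))"
  unfolding smooth_fun_on_def smooth_on_def
proof (intro ballI allI)
  fix c k assume c: "c \<in> A"
  let ?S = "coord c ` (chart_dom c \<inter> F -` W)"
  have loc: "\<exists>U. open U \<and> x \<in> U \<and> U \<subseteq> ?S \<and> smooth_on U (\<lambda>x. f (F (param c x)))" if x: "x \<in> ?S" for x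
  proof -
    let ?d = "chart_at B (F (param c x))"
    note d = cod.chart_at[of "F (param c x)"]
    let ?U = "coord c ` (chart_dom c \<inter> F -` W \<inter> F -` chart_dom ?d)"
    have op: "open ?U"
      by (intro open_section_dom c d open_preimage assms)
    have "smooth_on ?U (\<lambda>x. f (param ?d (coord ?d (F (param c x)))))"
    proof (rule smooth_on_compose[OF op cod.open_coord_image[OF d(1) assms(1)]])
      show "smooth_on ?U (\<lambda>x. coord ?d (F (param c x)))"
        by (rule smooth_on_subset[OF smooth_coord_rep[OF c d(1)]]) auto
      show "smooth_on (coord ?d ` (chart_dom ?d \<inter> W)) (\<lambda>y. f (param ?d y))"
        by (rule cod.smooth_fun_on_chart[OF assms(2) d(1)])
    qed (use c in auto)
    then have "smooth_on ?U (\<lambda>x. f (F (param c x)))"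
      by (rule smooth_on_cong[OF op]) (use c d in auto)
    moreover have "x \<in> ?U" using x c d by auto
    ultimately show ?thesis using op by blast
  qed
  show "Ck_on k ?S (\<lambda>x. f (F (param c x)))"
    by (rule Ck_on_local) (use loc in \<open>fastforce simp: smooth_on_def\<close>)
qed

lemma dfun_compose:
  assumes "open W" "smooth_fun_on B W f" "F p \<in> W" "v \<in> tangent_space A p"
  shows "dfun A (\<lambda>q. f (F q)) p v = dfun B f (F p) (dmap A B F p v)"
proof -
  let ?c = "chart_at A p" and ?d = "chart_at B (F p)"
  have "((\<lambda>x. f (F (param ?c x))) has_derivative
     (\<lambda>z. frechet_derivative (\<lambda>y. f (param ?d y)) (at (coord ?d (F p))) (coord_rep_derivative ?c ?d p z)))
     (at (coord ?c p))"
    by (intro F_compose_has_derivative cod.dfun_has_derivative[OF assms(2)] dom.chart_at cod.chart_at assms)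
  from dom.dfun_eqI[OF this, of v] show ?thesis
    using dmap_eq[OF dom.chart_at(1) cod.chart_at(1) dom.chart_at(2) cod.chart_at(2) assms(4)]
    by (simp add: dfun_def[of B] Let_def)
qed

end

section \<open>Linear algebra\<close>

text \<open>\<open>\<beta>\<close> will be the Riemannian metric read in a chart, not the inner
  product of the type. The proof is Gram-Schmidt, adding one vector of a spanning set at a
  time.\<close>

lemma orthogonal_decomposition:
  fixes \<beta> :: "'a::euclidean_space \<Rightarrow> 'a \<Rightarrow> real"
  assumes bil: "bilinear \<beta>" and sym: "\<And>x y. \<beta> x y = \<beta> y x"
    and pos: "\<And>x. x \<noteq> 0 \<Longrightarrow> \<beta> x x > 0" and V: "subspace V"
  obtains v where "v \<in> V" "\<And>w. w \<in> V \<Longrightarrow> \<beta> (x - v) w = 0"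
proof -
  note bs = bilinear_ladd[OF bil] bilinear_radd[OF bil] bilinear_lsub[OF bil] bilinear_rsub[OF bil]
    bilinear_lmul[OF bil] bilinear_rmul[OF bil]
  have main: "\<exists>v\<in>span S. \<forall>w\<in>span S. \<beta> (x - v) w = 0" if "finite S" for S x
    using that
  proof (induction S arbitrary: x)
    case empty
    then show ?case by (simp add: bilinear_rzero[OF bil])
  next
    case (insert s S)
    obtain a where a: "a \<in> span S" "\<And>w. w \<in> span S \<Longrightarrow> \<beta> (s - a) w = 0"
      using insert.IH[of s] by auto
    obtain v where v: "v \<in> span S" "\<And>w. w \<in> span S \<Longrightarrow> \<beta> (x - v) w = 0"
      using insert.IH[of x] by auto
    \<comment> \<open>\<open>s'\<close> is the part of \<open>s\<close> orthogonal to
      \<open>span S\<close>, and \<open>k\<close> is the coefficient of \<open>x\<close> along it.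
      If \<open>s' = 0\<close>, division by zero gives \<open>k = 0\<close>, and the equation for
      \<open>k\<close> holds with both sides zero.\<close>
    define s' where "s' = s - a"
    define k where "k = \<beta> x s' / \<beta> s' s'"
    have k: "k * \<beta> s' s' = \<beta> x s'"
      using pos[of s'] by (cases "s' = 0") (auto simp: k_def bilinear_rzero[OF bil])
    have inS: "w \<in> span (insert s S)" if "w \<in> span S" for w
      using that span_mono[of S "insert s S"] by auto
    have "v + k *\<^sub>R s' \<in> span (insert s S)"
      unfolding s'_def using inS a v by (intro span_add span_scale span_diff) (auto intro: span_base)
    moreover have "\<beta> (x - (v + k *\<^sub>R s')) w = 0" if w: "w \<in> span (insert s S)" for w
    proof -
      obtain r where r: "w - r *\<^sub>R s \<in> span S"
        using w span_breakdown_eq by blast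
      define w' where "w' = w - r *\<^sub>R s + r *\<^sub>R a"
      have w': "w' \<in> span S" unfolding w'_def by (intro span_add span_scale r a)
      have w: "w = r *\<^sub>R s' + w'" by (simp add: w'_def s'_def algebra_simps)
      have "\<beta> (x - (v + k *\<^sub>R s')) w' = 0"
        using v(2)[OF w'] a(2)[OF w'] by (simp add: bs s'_def[symmetric] algebra_simps)
      moreover have "\<beta> (x - (v + k *\<^sub>R s')) s' = 0"
        using k a(2)[OF v(1)] sym[of v s'] by (simp add: bs s'_def[symmetric])
      ultimately show ?thesis unfolding w by (simp add: bs)
    qed
    ultimately show ?case by blast
  qed
  obtain S where "finite S" "span S = V"
    using V by (metis basis_subspace_exists)
  with main[of S x] that show thesis by auto
qed

text \<open>The formula over an orthonormal basis of \<open>V\<close> makes the projection visibly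
  linear, which \<open>trace_eq_zero\<close> relies on.\<close>

lemma orthogonal_projection_exists:
  fixes V :: "'a::euclidean_space set"
  assumes "subspace V"
  obtains Q where "linear Q" "\<And>x. Q x \<in> V" "\<And>x w. w \<in> V \<Longrightarrow> (x - Q x) \<bullet> w = 0"
proof -
  obtain B where B: "B \<subseteq> V" "pairwise orthogonal B" "\<And>x. x \<in> B \<Longrightarrow> norm x = 1"
    "independent B" "span B = V"
    using orthonormal_basis_subspace[OF assms] by metis
  have fin: "finite B" using B(4) by (rule independent_imp_finite)
  define Q where "Q = (\<lambda>x. \<Sum>b\<in>B. (x \<bullet> b) *\<^sub>R b)"
  have "linear Q"
    by (rule linearI) (simp_all add: Q_def inner_add_left scaleR_add_left sum.distrib scaleR_sum_right)
  moreover have "Q x \<in> V" for x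
    unfolding Q_def using B(1) by (intro subspace_sum[OF assms] subspace_scale[OF assms]) auto
  moreover have "(x - Q x) \<bullet> w = 0" if "w \<in> V" for x w
  proof -
    have ob: "(x - Q x) \<bullet> b = 0" if "b \<in> B" for b
    proof -
      have "Q x \<bullet> b = (\<Sum>b'\<in>B. if b' = b then x \<bullet> b else 0)"
        unfolding Q_def inner_sum_left
      proof (rule sum.cong[OF refl])
        fix b' assume "b' \<in> B"
        then show "(x \<bullet> b') *\<^sub>R b' \<bullet> b = (if b' = b then x \<bullet> b else 0)"
          using B(2,3) that by (auto simp: pairwise_def orthogonal_def norm_eq_1)
      qed
      then show ?thesis using fin that by (simp add: inner_diff_left)
    qed
    have "w \<in> span B" using that B(5) by simp
    then show ?thesis
      by (induction rule: span_induct_alt) (simp_all add: ob inner_add_right)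
  qed
  ultimately show thesis by (rule that)
qed

text \<open>Expand \<open>M b\<close> over \<open>Basis\<close> with coefficients
  \<open>b \<bullet> N c\<close> and exchange the sums. Moving a map to its adjoint under a trace
  replaces the choice of a basis adapted to a subspace or to \<open>J\<close>.\<close>

lemma sum_Basis_adjoint:
  fixes t :: "'a::euclidean_space \<Rightarrow> 'a \<Rightarrow> real"
  assumes t: "bilinear t" and L: "linear L" and adj: "\<And>x y. M x \<bullet> y = x \<bullet> N y"
  shows "(\<Sum>b\<in>Basis. t (L b) (M b)) = (\<Sum>b\<in>Basis. t (L (N b)) b)"
proof -
  have "t (L b) (M b) = (\<Sum>c\<in>Basis. (b \<bullet> N c) *\<^sub>R t (L b) c)" for b
    using linear_euclidean_expansion[of "t (L b)" "M b"] t by (simp add: bilinear_def adj)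
  then have "(\<Sum>b\<in>Basis. t (L b) (M b)) = (\<Sum>b\<in>Basis. \<Sum>c\<in>Basis. (b \<bullet> N c) *\<^sub>R t (L b) c)"
    by simp
  also have "\<dots> = (\<Sum>c\<in>Basis. \<Sum>b\<in>Basis. (N c \<bullet> b) *\<^sub>R t (L b) c)"
    by (subst sum.swap) (simp add: inner_commute)
  also have "\<dots> = (\<Sum>c\<in>Basis. t (L (N c)) c)"
  proof (rule sum.cong[OF refl])
    fix c :: 'a
    have "linear (\<lambda>x. t x c)" using t by (simp add: bilinear_def)
    from linear_compose[OF L this] have "linear (\<lambda>x. t (L x) c)" by (simp add: o_def)
    from linear_euclidean_expansion[OF this, of "N c"]
    show "(\<Sum>b\<in>Basis. (N c \<bullet> b) *\<^sub>R t (L b) c) = t (L (N c)) c" by simp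
  qed
  finally show ?thesis .
qed

text \<open>With \<open>Q\<close> and \<open>P\<close> the projections onto \<open>V\<close> and its complement, the mixed and the \<open>P\<close>-part
  of the trace vanish, and replacing the basis \<open>b\<close> by \<open>J b\<close> changes the sign of the \<open>Q\<close>-part.\<close>

lemma trace_eq_zero:
  fixes t :: "'a::euclidean_space \<Rightarrow> 'a \<Rightarrow> real"
  assumes t: "bilinear t" and J: "linear J" and JJ: "\<And>x. J (J x) = - x"
    and iso: "\<And>x y. J x \<bullet> J y = x \<bullet> y"
    and V: "subspace V" and JV: "\<And>x. x \<in> V \<Longrightarrow> J x \<in> V"
    and hor: "\<And>x y. (\<And>w. w \<in> V \<Longrightarrow> x \<bullet> w = 0) \<Longrightarrow> (\<And>w. w \<in> V \<Longrightarrow> y \<bullet> w = 0) \<Longrightarrow> t x y = 0"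
    and ver: "\<And>x y. x \<in> V \<Longrightarrow> y \<in> V \<Longrightarrow> t (J x) (J y) = - t x y"
  shows "(\<Sum>b\<in>Basis. t b b) = 0"
proof -
  obtain Q where Q: "linear Q" "\<And>x. Q x \<in> V" "\<And>x w. w \<in> V \<Longrightarrow> (x - Q x) \<bullet> w = 0"
    using orthogonal_projection_exists[OF V] by blast
  define P where "P = (\<lambda>x. x - Q x)"
  have P: "linear P"
    unfolding P_def by (intro linear_compose_sub Q linear_id[unfolded id_def])
  have uniq: "Q x = v" if "v \<in> V" "\<And>w. w \<in> V \<Longrightarrow> (x - v) \<bullet> w = 0" for x v
  proof -
    have "Q x - v \<in> V" by (intro subspace_diff V Q that)
    then have "(Q x - v) \<bullet> (Q x - v) = 0"
      using that(2)[of "Q x - v"] Q(3)[of "Q x - v" x] by (simp add: inner_diff_left)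
    then show ?thesis by simp
  qed
  have QV: "Q x = x" if "x \<in> V" for x by (rule uniq) (use that in auto)
  have skew: "J x \<bullet> y = - (x \<bullet> J y)" for x y
    using iso[of x "J y"] by (simp add: JJ)
  \<comment> \<open>By skewness \<open>J\<close> also preserves the orthogonal complement of
    \<open>V\<close>, so \<open>J (Q x)\<close> has the two properties that characterize
    \<open>Q (J x)\<close>.\<close>
  have QJ: "Q (J x) = J (Q x)" for x
  proof (rule uniq)
    show "J (Q x) \<in> V" by (intro JV Q)
    fix w assume "w \<in> V"
    then show "(J x - J (Q x)) \<bullet> w = 0"
      using Q(3)[OF JV, of w x] by (simp add: linear_diff[OF J, symmetric] skew)
  qed
  have Qadj: "Q x \<bullet> y = x \<bullet> Q y" for x y
    using Q(3)[OF Q(2), of x y] Q(3)[OF Q(2), of y x] inner_commute[of x "Q y"] inner_commute[of "Q x" "Q y"]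
    inner_commute[of "Q x" y]
    by (simp add: inner_diff_left)
  have Padj: "P x \<bullet> y = x \<bullet> P y" for x y
    by (simp add: P_def inner_diff_left inner_diff_right Qadj)
  have PQ: "P (Q x) = 0" "Q (P x) = 0" for x
    using QV[OF Q(2)] by (simp_all add: P_def linear_diff[OF Q(1)])
  let ?T = "\<Sum>b\<in>Basis. t (Q b) (Q b)"
  have split: "t b b = t (P b) (P b) + t (P b) (Q b) + t (Q b) (P b) + t (Q b) (Q b)" for b
  proof -
    have "t b b = t (P b + Q b) (P b + Q b)" by (simp add: P_def)
    then show ?thesis by (simp only: bilinear_ladd[OF t] bilinear_radd[OF t] add.assoc)
  qed
  have "(\<Sum>b\<in>Basis. t b b) = (\<Sum>b\<in>Basis. t (P b) (P b)) + (\<Sum>b\<in>Basis. t (P b) (Q b)) +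
      (\<Sum>b\<in>Basis. t (Q b) (P b)) + ?T"
    unfolding sum.distrib[symmetric] by (rule sum.cong[OF refl split])
  moreover have "t (P b) (P b) = 0" for b
    by (rule hor) (auto simp: P_def Q)
  \<comment> \<open>Moving \<open>Q\<close> to the first argument leaves \<open>P (Q b) = 0\<close>
    there; the next sum is treated likewise.\<close>
  moreover have "(\<Sum>b\<in>Basis. t (P b) (Q b)) = 0"
    using sum_Basis_adjoint[OF t P Qadj] by (simp add: PQ bilinear_lzero[OF t])
  moreover have "(\<Sum>b\<in>Basis. t (Q b) (P b)) = 0"
    using sum_Basis_adjoint[OF t Q(1) Padj] by (simp add: PQ bilinear_lzero[OF t])
  moreover have "?T = 0"
  proof -
    \<comment> \<open>The adjoint of \<open>Q\<close> after \<open>J\<close> is \<open>- J\<close>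
      after \<open>Q\<close>. Composing the two gives back \<open>Q\<close>, so the sum over
      \<open>J b\<close> equals the sum over \<open>b\<close>.\<close>
    have "Q (J x) \<bullet> y = x \<bullet> - J (Q y)" for x y
      by (simp add: Qadj skew)
    from sum_Basis_adjoint[OF t linear_compose[OF J Q(1), unfolded o_def] this]
    have "(\<Sum>b\<in>Basis. t (Q (J b)) (Q (J b))) = (\<Sum>b\<in>Basis. t (Q b) b)"
      by (simp add: linear_neg[OF J] JJ QV[OF Q(2)])
    moreover have "?T = (\<Sum>b\<in>Basis. t (Q b) b)"
      using sum_Basis_adjoint[OF t Q(1) Qadj] by (simp add: QV[OF Q(2)])
    moreover have "t (Q (J b)) (Q (J b)) = - t (Q b) (Q b)" for b
      unfolding QJ by (rule ver[OF Q(2) Q(2)])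
    ultimately show ?thesis by (simp add: sum_negf)
  qed
  ultimately show ?thesis by simp
qed

section \<open>Riemannian metrics and connections along maps\<close>

locale riemannian = manifold A
  for A :: "('p::{t2_space, second_countable_topology}, 'a::euclidean_space) chart set" +
  fixes g :: "('p, 'a) metric"
  assumes riem: "riemannian_manifold A g"
begin

lemma metric_laws:
  assumes "u \<in> tangent_space A p" "v \<in> tangent_space A p" "w \<in> tangent_space A p"
  shows "g p u v = g p v u \<and> g p (u + v) w = g p u w + g p v w \<and>
    g p (r *\<^sub>T u) w = r * g p u w \<and> (u \<noteq> 0 \<longrightarrow> 0 < g p u u)"
  by (rule riem[unfolded riemannian_manifold_def, THEN conjunct2, THEN conjunct1, THEN spec,
        THEN bspec, OF assms(1), THEN bspec, OF assms(2), THEN bspec, OF assms(3), THEN spec])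

lemma metric_sym:
  "u \<in> tangent_space A p \<Longrightarrow> v \<in> tangent_space A p \<Longrightarrow> g p u v = g p v u"
  using metric_laws[of u p v u] by simp

lemma metric_add_left:
  "u \<in> tangent_space A p \<Longrightarrow> v \<in> tangent_space A p \<Longrightarrow> w \<in> tangent_space A p \<Longrightarrow>
    g p (u + v) w = g p u w + g p v w"
  using metric_laws[of u p v w] by simp

lemma metric_scale_left:
  "u \<in> tangent_space A p \<Longrightarrow> w \<in> tangent_space A p \<Longrightarrow> g p (r *\<^sub>T u) w = r * g p u w"
  using metric_laws[of u p u w] by simp

lemma metric_pos: "u \<in> tangent_space A p \<Longrightarrow> u \<noteq> 0 \<Longrightarrow> 0 < g p u u"
  using metric_laws[of u p u u] by simp

lemma metric_smooth:
  "open W \<Longrightarrow> vector_field A W X \<Longrightarrow> vector_field A W Y \<Longrightarrow>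
    smooth_fun_on A W (\<lambda>p. g p (X p) (Y p))"
  using riem unfolding riemannian_manifold_def by blast

lemma metric_add_right:
  "u \<in> tangent_space A p \<Longrightarrow> v \<in> tangent_space A p \<Longrightarrow> w \<in> tangent_space A p \<Longrightarrow>
    g p w (u + v) = g p w u + g p w v"
  by (metis metric_add_left metric_sym tangent_add)

lemma metric_scale_right:
  "u \<in> tangent_space A p \<Longrightarrow> w \<in> tangent_space A p \<Longrightarrow> g p w (r *\<^sub>T u) = r * g p w u"
  by (metis metric_scale_left metric_sym tangent_scale)

lemma metric_zero_left: "w \<in> tangent_space A p \<Longrightarrow> g p 0 w = 0"
  using metric_scale_left[OF tangent_zero, of w p 0] by (simp add: zero_fun_def)

lemma metric_zero_right: "w \<in> tangent_space A p \<Longrightarrow> g p w 0 = 0"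
  using metric_scale_right[OF tangent_zero, of w p 0] by (simp add: zero_fun_def)

lemma metric_uminus_left:
  "u \<in> tangent_space A p \<Longrightarrow> w \<in> tangent_space A p \<Longrightarrow> g p (- u) w = - g p u w"
  using metric_scale_left[of u p w "-1"] by (simp add: fun_Compl_def)

lemma metric_uminus_right:
  "u \<in> tangent_space A p \<Longrightarrow> w \<in> tangent_space A p \<Longrightarrow> g p w (- u) = - g p w u"
  using metric_scale_right[of u p w "-1"] by (simp add: fun_Compl_def)

lemma metric_diff_left:
  "u \<in> tangent_space A p \<Longrightarrow> v \<in> tangent_space A p \<Longrightarrow> w \<in> tangent_space A p \<Longrightarrow>
    g p (u - v) w = g p u w - g p v w"
  using metric_add_left[of u p "- v" w] by (simp add: tangent_uminus metric_uminus_left)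

lemma metric_sum_left:
  "(\<And>i. i \<in> S \<Longrightarrow> u i \<in> tangent_space A p) \<Longrightarrow> w \<in> tangent_space A p \<Longrightarrow>
    g p (\<Sum>i\<in>S. u i) w = (\<Sum>i\<in>S. g p (u i) w)"
  by (induction S rule: infinite_finite_induct)
     (auto simp: metric_zero_left metric_add_left tangent_sum)

lemma metric_sum_right:
  "(\<And>i. i \<in> S \<Longrightarrow> u i \<in> tangent_space A p) \<Longrightarrow> w \<in> tangent_space A p \<Longrightarrow>
    g p w (\<Sum>i\<in>S. u i) = (\<Sum>i\<in>S. g p w (u i))"
  by (induction S rule: infinite_finite_induct)
     (auto simp: metric_zero_right metric_add_right tangent_sum)

lemma metric_nonneg: "u \<in> tangent_space A p \<Longrightarrow> 0 \<le> g p u u"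
  using metric_pos metric_zero_left tangent_zero by (metis less_eq_real_def order_refl)

end

locale connection_map = manifold_map A B F
  for A :: "('p::{t2_space, second_countable_topology}, 'a::euclidean_space) chart set"
    and B :: "('q::{t2_space, second_countable_topology}, 'b::euclidean_space) chart set"
    and F :: "'p \<Rightarrow> 'q" +
  fixes D :: "('p, 'a, 'q, 'b) connection"
  assumes conn: "connection_along A B F D"
begin

lemma D_laws:
  assumes "open W" "section_along A B F W \<xi>" "p \<in> W" "v \<in> tangent_space A p" "w \<in> tangent_space A p"
  shows "D p v \<xi> \<in> tangent_space B (F p) \<and> D p (v + w) \<xi> = D p v \<xi> + D p w \<xi> \<and>
    D p (r *\<^sub>T v) \<xi> = r *\<^sub>T D p v \<xi>"
  by (rule conn[unfolded connection_along_def, THEN conjunct1, THEN spec, THEN spec, THEN mp,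
        OF assms(1), THEN mp, OF assms(2), THEN bspec, OF assms(3), THEN bspec, OF assms(4),
        THEN bspec, OF assms(5), THEN spec])

lemma D_tangent:
  "open W \<Longrightarrow> section_along A B F W \<xi> \<Longrightarrow> p \<in> W \<Longrightarrow> v \<in> tangent_space A p \<Longrightarrow>
    D p v \<xi> \<in> tangent_space B (F p)"
  using D_laws[of W \<xi> p v v] by simp

lemma D_dir_add:
  "open W \<Longrightarrow> section_along A B F W \<xi> \<Longrightarrow> p \<in> W \<Longrightarrow> v \<in> tangent_space A p \<Longrightarrow>
    w \<in> tangent_space A p \<Longrightarrow> D p (v + w) \<xi> = D p v \<xi> + D p w \<xi>"
  using D_laws[of W \<xi> p v w] by simp

lemma D_dir_scale:
  "open W \<Longrightarrow> section_along A B F W \<xi> \<Longrightarrow> p \<in> W \<Longrightarrow> v \<in> tangent_space A p \<Longrightarrow>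
    D p (r *\<^sub>T v) \<xi> = r *\<^sub>T D p v \<xi>"
  using D_laws[of W \<xi> p v v] by simp

lemma D_add:
  assumes "open W" "section_along A B F W \<xi>" "section_along A B F W \<eta>" "p \<in> W"
    "v \<in> tangent_space A p"
  shows "D p v (\<lambda>q. \<xi> q + \<eta> q) = D p v \<xi> + D p v \<eta>"
  by (rule conn[unfolded connection_along_def, THEN conjunct2, THEN conjunct1, THEN spec, THEN spec,
        THEN spec, THEN mp, OF assms(1), THEN mp, OF assms(2), THEN mp, OF assms(3), THEN bspec,
        OF assms(4), THEN bspec, OF assms(5)])

lemma D_Leibniz:
  assumes "open W" "smooth_fun_on A W f" "section_along A B F W \<xi>" "p \<in> W" "v \<in> tangent_space A p"
  shows "D p v (\<lambda>q. f q *\<^sub>T \<xi> q) = dfun A f p v *\<^sub>T \<xi> p + f p *\<^sub>T D p v \<xi>"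
  by (rule conn[unfolded connection_along_def, THEN conjunct2, THEN conjunct2, THEN conjunct1,
        THEN spec, THEN spec, THEN spec, THEN mp, OF assms(1), THEN mp, OF assms(2), THEN mp,
        OF assms(3), THEN bspec, OF assms(4), THEN bspec, OF assms(5)])

lemma D_cong:
  assumes "open W" "section_along A B F W \<xi>" "section_along A B F W \<eta>"
    "\<And>q. q \<in> W \<Longrightarrow> \<xi> q = \<eta> q" "p \<in> W" "v \<in> tangent_space A p"
  shows "D p v \<xi> = D p v \<eta>"
proof -
  have eq: "\<forall>q\<in>W. \<xi> q = \<eta> q" using assms(4) by blast
  show ?thesis
    by (rule conn[unfolded connection_along_def, THEN conjunct2, THEN conjunct2, THEN conjunct2,
        THEN conjunct1, THEN spec, THEN spec, THEN spec, THEN mp, OF assms(1), THEN mp, OF assms(2),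
        THEN mp, OF assms(3), THEN mp, OF eq, THEN bspec, OF assms(5), THEN bspec,
        OF assms(6)])
qed

lemma D_zero:
  assumes "v \<in> tangent_space A p"
  shows "D p v (\<lambda>q. 0) = 0"
  using D_add[OF open_UNIV section_zero section_zero UNIV_I assms] by simp

lemma D_sum:
  assumes "open W" "\<And>i. i \<in> S \<Longrightarrow> section_along A B F W (\<xi> i)" "p \<in> W" "v \<in> tangent_space A p"
  shows "D p v (\<lambda>q. \<Sum>i\<in>S. \<xi> i q) = (\<Sum>i\<in>S. D p v (\<xi> i))"
  using assms(2)
proof (induction S rule: infinite_finite_induct)
  case (insert i S)
  then have "D p v (\<lambda>q. \<xi> i q + (\<Sum>i\<in>S. \<xi> i q)) = D p v (\<xi> i) + D p v (\<lambda>q. \<Sum>i\<in>S. \<xi> i q)"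
    by (intro D_add[OF assms(1) _ _ assms(3,4)] section_sum assms(1)) auto
  moreover have "D p v (\<lambda>q. \<Sum>i\<in>S. \<xi> i q) = (\<Sum>i\<in>S. D p v (\<xi> i))"
    by (rule insert.IH) (simp add: insert.prems)
  ultimately show ?case by (simp only: sum.insert[OF insert.hyps])
qed (use D_zero[OF assms(4)] in simp_all)

lemma D_dir_zero:
  assumes "open W" "section_along A B F W \<xi>" "p \<in> W"
  shows "D p 0 \<xi> = 0"
  using D_dir_add[OF assms dom.tangent_zero dom.tangent_zero] by simp

lemma D_dir_sum:
  assumes "open W" "section_along A B F W \<xi>" "p \<in> W" "\<And>i. i \<in> S \<Longrightarrow> v i \<in> tangent_space A p"
  shows "D p (\<Sum>i\<in>S. v i) \<xi> = (\<Sum>i\<in>S. D p (v i) \<xi>)"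
  using assms(4)
  by (induction S rule: infinite_finite_induct)
     (auto simp: D_dir_zero[OF assms(1-3)] D_dir_add[OF assms(1-3)] dom.tangent_sum)

end

section \<open>Coordinate frames and the symmetry of Christoffel symbols\<close>

context manifold
begin

lemma frame_vector_field:
  assumes d: "d \<in> A"
  shows "vector_field A (chart_dom d) (coord_vec d b)"
  unfolding section_along_def
proof (intro conjI ballI)
  fix p assume "p \<in> chart_dom d"
  then show "coord_vec d b p \<in> tangent_space A (id p)"
    using d by (simp add: coord_vec_tangent)
next
  fix c e assume c: "c \<in> A" and e: "e \<in> A"
  let ?S = "coord c ` (chart_dom c \<inter> chart_dom d \<inter> id -` chart_dom e)"
  let ?T = "coord d ` (chart_dom d \<inter> chart_dom e)"
  have S: "open ?S"
    using open_coord_image[OF c open_Int[OF open_chart_dom[OF d] open_chart_dom[OF e]]]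
    by (simp add: Int_assoc)
  have "smooth_on ?S (\<lambda>x. frechet_derivative (\<lambda>y. coord e (param d y)) (at (coord d (param c x))) b)"
  proof (rule smooth_on_compose[OF S open_coord_image[OF d open_chart_dom[OF e]],
        of "\<lambda>x. coord d (param c x)" "\<lambda>z. frechet_derivative (\<lambda>y. coord e (param d y)) (at z) b"])
    show "(\<lambda>x. coord d (param c x)) ` ?S \<subseteq> ?T" using c by auto
    show "smooth_on ?S (\<lambda>x. coord d (param c x))"
      by (rule smooth_on_subset[OF smooth_transition[OF c d]]) auto
    show "smooth_on ?T (\<lambda>x. frechet_derivative (\<lambda>y. coord e (param d y)) (at x) b)"
      by (rule smooth_on_frechet_derivative[OF smooth_transition[OF d e]])
  qed
  then show "smooth_on ?S (\<lambda>x. coord_vec d b (param c x) e)"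
    by (rule smooth_on_cong[OF S]) (use c e in \<open>auto simp: coord_vec_def\<close>)
qed

lemma tangent_frame_expansion:
  assumes "v \<in> tangent_space A p" "d \<in> A" "p \<in> chart_dom d"
  shows "v = (\<Sum>b\<in>Basis. (v d \<bullet> b) *\<^sub>T coord_vec d b p)"
proof (rule tangent_space_eqI[OF assms(1) _ assms(2,3)])
  show "(\<Sum>b\<in>Basis. (v d \<bullet> b) *\<^sub>T coord_vec d b p) \<in> tangent_space A p"
    by (intro tangent_sum tangent_scale coord_vec_tangent assms)
  show "v d = (\<Sum>b\<in>Basis. (v d \<bullet> b) *\<^sub>T coord_vec d b p) d"
    by (simp add: sum_fun_apply coord_vec_self assms euclidean_representation)
qed

text \<open>Coordinate fields have constant components in their own chart, so their Lie bracket
  vanishes there. In classical terms the Christoffel symbols are symmetric in the lower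
  indices.\<close>

lemma frame_torsion_free:
  assumes lc: "levi_civita A g nabla" and d: "d \<in> A" "p \<in> chart_dom d"
  shows "nabla p (coord_vec d a p) (coord_vec d b) = nabla p (coord_vec d b p) (coord_vec d a)"
proof -
  interpret connection_map A A id nabla
    using lc manifold_map_id by (simp add: connection_map_def connection_map_axioms_def levi_civita_def)
  note e = open_chart_dom[OF d(1)] frame_vector_field[OF d(1)]
  have deriv: "frechet_derivative (\<lambda>x. coord_vec d b (param d x) d) (at (coord d p)) v = 0" for b v
  proof (rule frechet_derivative_at_apply)
    have "((\<lambda>x. b) has_derivative (\<lambda>v. 0)) (at (coord d p))" by simp
    then show "((\<lambda>x. coord_vec d b (param d x) d) has_derivative (\<lambda>v. 0)) (at (coord d p))"
      by (rule has_derivative_transform_within_open[OF _ open_coord_image[OF d(1) open_UNIV]])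
         (use d in \<open>auto simp: coord_vec_self\<close>)
  qed
  have "nabla p (coord_vec d a p) (coord_vec d b) - nabla p (coord_vec d b p) (coord_vec d a) =
      lie_bracket A (coord_vec d a) (coord_vec d b) p"
    using lc e d unfolding levi_civita_def by blast
  then have "(nabla p (coord_vec d a p) (coord_vec d b) - nabla p (coord_vec d b p) (coord_vec d a)) d =
      lie_bracket A (coord_vec d a) (coord_vec d b) p d" by simp
  also have "\<dots> = 0" using deriv d by (simp add: lie_bracket_def)
  finally show ?thesis
    using D_tangent[OF e d(2) coord_vec_tangent[OF d]]
    by (intro tangent_space_eqI[OF _ _ d]) auto
qed

end

section \<open>The pullback connection: coordinate formula, torsion and metric compatibility\<close>

locale pullback_map = connection_map A B F D + cod: riemannian B h
  for A :: "('p::{t2_space, second_countable_topology}, 'a::euclidean_space) chart set"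
    and B :: "('q::{t2_space, second_countable_topology}, 'b::euclidean_space) chart set"
    and F :: "'p \<Rightarrow> 'q" and D :: "('p, 'a, 'q, 'b) connection" and h :: "('q, 'b) metric" +
  fixes nabla' :: "('q, 'b, 'q, 'b) connection"
  assumes lc': "levi_civita B h nabla'" and pullback: "pullback_connection A B F nabla' D"
begin

sublocale N: connection_map B B id nabla'
  using lc' cod.manifold_map_id
  by (simp add: connection_map_def connection_map_axioms_def levi_civita_def)

lemma section_compose:
  assumes "open W" "vector_field B W Y"
  shows "section_along A B F (F -` W) (\<lambda>q. Y (F q))"
  unfolding section_along_def
proof (intro conjI ballI)
  fix p assume "p \<in> F -` W"
  then show "Y (F p) \<in> tangent_space B (F p)"
    using assms by (auto simp: section_along_def)
next
  fix c d assume c: "c \<in> A" and d: "d \<in> B"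
  let ?S = "coord c ` (chart_dom c \<inter> F -` W \<inter> F -` chart_dom d)"
  have S: "open ?S" by (intro open_section_dom c d open_preimage assms)
  have "smooth_on ?S (\<lambda>x. Y (param d (coord d (F (param c x)))) d)"
  proof (rule smooth_on_compose[OF S N.open_section_dom[OF d d assms(1)],
        of "\<lambda>x. coord d (F (param c x))" "\<lambda>y. Y (param d y) d"])
    show "smooth_on ?S (\<lambda>x. coord d (F (param c x)))"
      by (rule smooth_on_subset[OF smooth_coord_rep[OF c d]]) auto
    show "smooth_on (coord d ` (chart_dom d \<inter> W \<inter> id -` chart_dom d)) (\<lambda>y. Y (param d y) d)"
      by (rule N.section_smooth[OF assms(2) d d])
  qed (use c in auto)
  then show "smooth_on ?S (\<lambda>x. Y (F (param c x)) d)"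
    by (rule smooth_on_cong[OF S]) (use c d in auto)
qed

lemma D_pullback:
  assumes "open W" "vector_field B W Y" "F p \<in> W" "v \<in> tangent_space A p"
  shows "D p v (\<lambda>q. Y (F q)) = nabla' (F p) (dmap A B F p v) Y"
  using pullback assms unfolding pullback_connection_def by blast

lemma frame_section:
  "d \<in> B \<Longrightarrow> section_along A B F (F -` chart_dom d) (\<lambda>q. cod.coord_vec d b (F q))"
  by (rule section_compose[OF cod.open_chart_dom cod.frame_vector_field])

lemma section_frame_expansion:
  assumes "section_along A B F W \<xi>" "d \<in> B" "q \<in> W \<inter> F -` chart_dom d"
  shows "\<xi> q = (\<Sum>b\<in>Basis. (\<xi> q d \<bullet> b) *\<^sub>T cod.coord_vec d b (F q))"
  using assms by (intro cod.tangent_frame_expansion section_tangent) auto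

text \<open>The pullback axiom covers only composites of \<open>F\<close> with fields on the target.
  Expanding \<open>\<xi>\<close> near \<open>p\<close> in the coordinate frame along
  \<open>F\<close> and applying the Leibniz rule reduces \<open>D\<close> to those, leaving the
  derivative of the components and the Christoffel terms.\<close>

lemma D_in_chart:
  assumes W: "open W" "section_along A B F W \<xi>" "p \<in> W"
    and c: "c \<in> A" "p \<in> chart_dom c" and d: "d \<in> B" "F p \<in> chart_dom d"
    and v: "v \<in> tangent_space A p"
  shows "D p v \<xi> d = frechet_derivative (\<lambda>x. \<xi> (param c x) d) (at (coord c p)) (v c) +
    (\<Sum>b\<in>Basis. (\<xi> p d \<bullet> b) *\<^sub>R nabla' (F p) (dmap A B F p v) (cod.coord_vec d b) d)"
proof -
  let ?U = "W \<inter> F -` chart_dom d"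
  let ?e = "\<lambda>b q. cod.coord_vec d b (F q)"
  have U: "open ?U" "p \<in> ?U"
    using W open_preimage[OF cod.open_chart_dom[OF d(1)]] d by auto
  have e: "section_along A B F ?U (?e b)" for b
    by (rule section_subset[OF frame_section[OF d(1)]]) auto
  note sm = section_component[OF W(1,2) d(1)]
  have "D p v \<xi> = D p v (\<lambda>q. \<Sum>b\<in>Basis. (\<xi> q d \<bullet> b) *\<^sub>T ?e b q)"
    by (rule D_cong[OF U(1) section_subset[OF W(2)] section_sum[OF U(1) section_scale[OF U(1) sm e]] _ U(2) v])
       (use section_frame_expansion[OF W(2) d(1)] in auto)
  also have "\<dots> = (\<Sum>b\<in>Basis. dfun A (\<lambda>q. \<xi> q d \<bullet> b) p v *\<^sub>T ?e b p + (\<xi> p d \<bullet> b) *\<^sub>T D p v (?e b))"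
    by (subst D_sum[OF U(1) section_scale[OF U(1) sm e] U(2) v])
       (rule sum.cong[OF refl D_Leibniz[OF U(1) sm e U(2) v]])
  finally have "D p v \<xi> d = (\<Sum>b\<in>Basis. dfun A (\<lambda>q. \<xi> q d \<bullet> b) p v *\<^sub>R b) +
      (\<Sum>b\<in>Basis. (\<xi> p d \<bullet> b) *\<^sub>R D p v (?e b) d)"
    using d by (simp add: sum_fun_apply sum.distrib cod.coord_vec_self)
  moreover have "D p v (?e b) = nabla' (F p) (dmap A B F p v) (cod.coord_vec d b)" for b
    by (rule D_pullback[OF cod.open_chart_dom cod.frame_vector_field]) (use d v in auto)
  moreover have "dfun A (\<lambda>q. \<xi> q d \<bullet> b) p v =
      frechet_derivative (\<lambda>x. \<xi> (param c x) d) (at (coord c p)) (v c) \<bullet> b" for b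
  proof -
    have "(\<lambda>x. \<xi> (param c x) d) differentiable (at (coord c p))"
      by (rule smooth_on_imp_differentiable[OF section_smooth[OF W(2) c(1) d(1)]])
         (use c d W in auto)
    from frechet_derivative_inner_left[OF this] dom.dfun_eq[OF sm U(2) c v]
    show ?thesis by simp
  qed
  ultimately show ?thesis by (simp add: euclidean_representation)
qed

text \<open>In charts three kinds of terms arise: second derivatives of \<open>F\<close>, equal in
  both orders; Christoffel terms, also equal by symmetry; and the derivative of \<open>F\<close>
  applied to the bracket, which remains.\<close>

lemma pullback_torsion_free:
  assumes W: "open W" "p \<in> W" and X: "vector_field A W X" and Y: "vector_field A W Y"
    and bracket: "lie_bracket A X Y p \<in> tangent_space A p"
  shows "D p (X p) (\<lambda>q. dmap A B F q (Y q)) - D p (Y p) (\<lambda>q. dmap A B F q (X q)) =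
    dmap A B F p (lie_bracket A X Y p)"
proof -
  interpret M: manifold_map A A id by (rule dom.manifold_map_id)
  let ?c = "chart_at A p" and ?d = "chart_at B (F p)"
  note c = dom.chart_at[of p] and d = cod.chart_at[of "F p"]
  let ?x = "coord ?c p"
  let ?S = "coord ?c ` (chart_dom ?c \<inter> W \<inter> F -` chart_dom ?d)"
  let ?F = "\<lambda>x. coord ?d (F (param ?c x))"
  let ?f = "\<lambda>Y x. Y (param ?c x) ?c"
  have S: "open ?S" "?x \<in> ?S" using open_section_dom[OF c(1) d(1) W(1)] W c d by auto
  have smF: "smooth_on ?S ?F"
    by (rule smooth_on_subset[OF smooth_coord_rep[OF c(1) d(1)]]) auto
  have key: "frechet_derivative (\<lambda>x. dmap A B F (param ?c x) (Y (param ?c x)) ?d) (at ?x) z =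
      frechet_derivative (\<lambda>y. frechet_derivative ?F (at y) (Y p ?c)) (at ?x) z +
      frechet_derivative ?F (at ?x) (frechet_derivative (?f Y) (at ?x) z)"
    if Y: "vector_field A W Y" for Y z
  proof -
    have smY: "smooth_on ?S (?f Y)"
      by (rule smooth_on_subset[OF M.section_smooth[OF Y c(1) c(1)]]) auto
    have "frechet_derivative (\<lambda>x. frechet_derivative ?F (at x) (?f Y x)) (at ?x) =
        frechet_derivative (\<lambda>x. dmap A B F (param ?c x) (Y (param ?c x)) ?d) (at ?x)"
    proof (rule frechet_derivative_transform_within_open[OF _ S])
      show "(\<lambda>x. frechet_derivative ?F (at x) (?f Y x)) differentiable (at ?x)"
        by (rule smooth_on_imp_differentiable[OF smooth_on_frechet_derivative_apply[OF S(1) smF smY] S(2)])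
      fix x assume "x \<in> ?S"
      then show "frechet_derivative ?F (at x) (?f Y x) = dmap A B F (param ?c x) (Y (param ?c x)) ?d"
        using c d M.section_tangent[OF Y] by (auto simp: dmap_eq[OF c(1) d(1)])
    qed
    with frechet_derivative_apply_field[OF S(1) smF smY S(2), of z] c show ?thesis by simp
  qed
  have tX: "X p \<in> tangent_space A p" and tY: "Y p \<in> tangent_space A p"
    using M.section_tangent[OF X W(2)] M.section_tangent[OF Y W(2)] by simp_all
  \<comment> \<open>\<open>G a b\<close> collects the Christoffel symbols of the target at
    \<open>F p\<close> as one coordinate vector.\<close>
  define G where "G = (\<lambda>a b. nabla' (F p) (cod.coord_vec ?d a (F p)) (cod.coord_vec ?d b) ?d)"
  have G_sym: "G a b = G b a" for a b
    unfolding G_def cod.frame_torsion_free[OF lc' d, of a b] ..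
  have G: "nabla' (F p) w (cod.coord_vec ?d b) ?d = (\<Sum>a\<in>Basis. (w ?d \<bullet> a) *\<^sub>R G a b)"
    if w: "w \<in> tangent_space B (F p)" for w b
  proof -
    note N = cod.open_chart_dom[OF d(1)] cod.frame_vector_field[OF d(1)] d(2)
    have "nabla' (F p) w (cod.coord_vec ?d b) =
        nabla' (F p) (\<Sum>a\<in>Basis. (w ?d \<bullet> a) *\<^sub>T cod.coord_vec ?d a (F p)) (cod.coord_vec ?d b)"
      using cod.tangent_frame_expansion[OF w d] by simp
    also have "\<dots> = (\<Sum>a\<in>Basis. (w ?d \<bullet> a) *\<^sub>T nabla' (F p) (cod.coord_vec ?d a (F p)) (cod.coord_vec ?d b))"
      by (subst N.D_dir_sum[OF N]) (auto simp: N.D_dir_scale[OF N] cod.coord_vec_tangent[OF d]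
            intro: cod.tangent_scale)
    finally show ?thesis by (simp add: sum_fun_apply G_def)
  qed
  let ?DX = "dmap A B F p (X p)" and ?DY = "dmap A B F p (Y p)"
  have D_eq: "D p (X p) (\<lambda>q. dmap A B F q (Y q)) ?d =
      frechet_derivative (\<lambda>x. dmap A B F (param ?c x) (Y (param ?c x)) ?d) (at ?x) (X p ?c) +
      (\<Sum>b\<in>Basis. \<Sum>a\<in>Basis. ((dmap A B F p (Y p) ?d \<bullet> b) * (dmap A B F p (X p) ?d \<bullet> a)) *\<^sub>R G a b)"
    if X: "X p \<in> tangent_space A p" and Y: "vector_field A W Y" for X Y
    unfolding D_in_chart[OF W(1) section_dmap[OF W(1) Y] W(2) c d X] G[OF dmap_tangent[OF X]]
    by (simp add: scaleR_sum_right)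
  \<comment> \<open>Exchanging the summation indices and using \<open>G_sym\<close> shows that both
    orders of \<open>X\<close> and \<open>Y\<close> give the same Christoffel contribution.\<close>
  have "(\<Sum>b\<in>Basis. \<Sum>a\<in>Basis. ((?DY ?d \<bullet> b) * (?DX ?d \<bullet> a)) *\<^sub>R G a b) =
      (\<Sum>b\<in>Basis. \<Sum>a\<in>Basis. ((?DX ?d \<bullet> b) * (?DY ?d \<bullet> a)) *\<^sub>R G a b)"
    by (subst sum.swap) (simp add: G_sym mult.commute)
  then have "(D p (X p) (\<lambda>q. dmap A B F q (Y q)) - D p (Y p) (\<lambda>q. dmap A B F q (X q))) ?d =
      frechet_derivative (\<lambda>x. dmap A B F (param ?c x) (Y (param ?c x)) ?d) (at ?x) (X p ?c) -
      frechet_derivative (\<lambda>x. dmap A B F (param ?c x) (X (param ?c x)) ?d) (at ?x) (Y p ?c)"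
    by (simp add: D_eq[of X Y, OF tX Y] D_eq[of Y X, OF tY X])
  also have "\<dots> = frechet_derivative ?F (at ?x) (frechet_derivative (?f Y) (at ?x) (X p ?c)) -
      frechet_derivative ?F (at ?x) (frechet_derivative (?f X) (at ?x) (Y p ?c))"
    using symmetric_second_derivative[OF S(1) smF S(2), of "Y p ?c" "X p ?c"]
    by (simp add: key[OF X] key[OF Y])
  also have "\<dots> = frechet_derivative ?F (at ?x) (lie_bracket A X Y p ?c)"
    using c by (simp add: lie_bracket_def linear_diff[OF linear_coord_rep_derivative[OF c(1) d(1) c(2) d(2)]])
  also have "\<dots> = dmap A B F p (lie_bracket A X Y p) ?d"
    by (simp add: dmap_eq[OF c(1) d(1) c(2) d(2) bracket])
  finally show ?thesis
    by (intro cod.tangent_space_eqI[OF _ _ d] cod.tangent_diff dmap_tangent bracket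
          D_tangent[OF W(1) section_dmap[OF W(1)] W(2)] tX tY X Y)
qed

text \<open>Compatibility of \<open>D\<close> with the metric at a pair of sections. It is preserved by linear
  combinations with smooth coefficients, so it is enough to check it on the coordinate frame.\<close>

definition metric_pair :: "'p set \<Rightarrow> 'p \<Rightarrow> ('p \<Rightarrow> ('q, 'b) tvec) \<Rightarrow> ('p \<Rightarrow> ('q, 'b) tvec) \<Rightarrow> bool" where
  "metric_pair W p \<xi> \<eta> \<longleftrightarrow> section_along A B F W \<xi> \<and> section_along A B F W \<eta> \<and>
     smooth_fun_on A W (\<lambda>q. h (F q) (\<xi> q) (\<eta> q)) \<and>
     (\<forall>v\<in>tangent_space A p. dfun A (\<lambda>q. h (F q) (\<xi> q) (\<eta> q)) p v =
        h (F p) (D p v \<xi>) (\<eta> p) + h (F p) (\<xi> p) (D p v \<eta>))"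

lemma metric_pair_sym:
  assumes "open W" "p \<in> W" "metric_pair W p \<xi> \<eta>"
  shows "metric_pair W p \<eta> \<xi>"
proof -
  have sec: "section_along A B F W \<xi>" "section_along A B F W \<eta>"
    using assms(3) by (simp_all add: metric_pair_def)
  have eq: "h (F q) (\<xi> q) (\<eta> q) = h (F q) (\<eta> q) (\<xi> q)" if "q \<in> W" for q
    using section_tangent[OF sec(1) that] section_tangent[OF sec(2) that] by (rule cod.metric_sym)
  have sm: "smooth_fun_on A W (\<lambda>q. h (F q) (\<xi> q) (\<eta> q))"
    using assms(3) by (simp add: metric_pair_def)
  have "dfun A (\<lambda>q. h (F q) (\<eta> q) (\<xi> q)) p v =
      h (F p) (D p v \<eta>) (\<xi> p) + h (F p) (\<eta> p) (D p v \<xi>)" if v: "v \<in> tangent_space A p" for v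
  proof -
    have "dfun A (\<lambda>q. h (F q) (\<eta> q) (\<xi> q)) p v = dfun A (\<lambda>q. h (F q) (\<xi> q) (\<eta> q)) p v"
      by (rule dom.dfun_cong[OF assms(1) sm assms(2) eq, symmetric])
    also have "\<dots> = h (F p) (D p v \<xi>) (\<eta> p) + h (F p) (\<xi> p) (D p v \<eta>)"
      using assms(3) v by (simp add: metric_pair_def)
    also have "\<dots> = h (F p) (D p v \<eta>) (\<xi> p) + h (F p) (\<eta> p) (D p v \<xi>)"
      using cod.metric_sym D_tangent[OF assms(1) _ assms(2) v] section_tangent[OF _ assms(2)] sec
      by (metis add.commute)
    finally show ?thesis .
  qed
  with sec dom.smooth_fun_on_cong[OF assms(1) sm eq] show ?thesis
    by (simp add: metric_pair_def)
qed

lemma metric_pair_zero: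
  assumes "section_along A B F W \<eta>" "open W" "p \<in> W"
  shows "metric_pair W p (\<lambda>q. 0) \<eta>"
proof -
  have z: "h (F q) 0 (\<eta> q) = 0" if "q \<in> W" for q
    using section_tangent[OF assms(1) that] by (rule cod.metric_zero_left)
  have sm: "smooth_fun_on A W (\<lambda>q. h (F q) 0 (\<eta> q))"
    by (rule dom.smooth_fun_on_cong[OF assms(2) dom.smooth_fun_on_const[of W 0]]) (simp add: z)
  have "dfun A (\<lambda>q. h (F q) 0 (\<eta> q)) p v = 0" for v
    using dom.dfun_cong[OF assms(2) sm assms(3) z] by (simp add: dom.dfun_const)
  with sm show ?thesis
    using assms D_tangent[OF assms(2,1,3)] section_tangent[OF assms(1,3)]
    by (simp add: metric_pair_def section_zero D_zero cod.metric_zero_left)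
qed

lemma metric_pair_add:
  assumes "open W" "p \<in> W" "metric_pair W p \<xi> \<eta>" "metric_pair W p \<xi>' \<eta>"
  shows "metric_pair W p (\<lambda>q. \<xi> q + \<xi>' q) \<eta>"
proof -
  have sec: "section_along A B F W \<xi>" "section_along A B F W \<xi>'" "section_along A B F W \<eta>"
    and sm: "smooth_fun_on A W (\<lambda>q. h (F q) (\<xi> q) (\<eta> q))" "smooth_fun_on A W (\<lambda>q. h (F q) (\<xi>' q) (\<eta> q))"
    using assms(3,4) by (simp_all add: metric_pair_def)
  have eq: "h (F q) (\<xi> q) (\<eta> q) + h (F q) (\<xi>' q) (\<eta> q) = h (F q) (\<xi> q + \<xi>' q) (\<eta> q)" if "q \<in> W" for q
    using section_tangent[OF sec(1) that] section_tangent[OF sec(2) that] section_tangent[OF sec(3) that]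
    by (rule cod.metric_add_left[symmetric])
  note sum = dom.smooth_fun_on_add[OF assms(1) sm]
  have "dfun A (\<lambda>q. h (F q) (\<xi> q + \<xi>' q) (\<eta> q)) p v =
      h (F p) (D p v (\<lambda>q. \<xi> q + \<xi>' q)) (\<eta> p) + h (F p) (\<xi> p + \<xi>' p) (D p v \<eta>)"
    if v: "v \<in> tangent_space A p" for v
  proof -
    have "dfun A (\<lambda>q. h (F q) (\<xi> q + \<xi>' q) (\<eta> q)) p v =
        dfun A (\<lambda>q. h (F q) (\<xi> q) (\<eta> q)) p v + dfun A (\<lambda>q. h (F q) (\<xi>' q) (\<eta> q)) p v"
      using dom.dfun_cong[OF assms(1) sum assms(2) eq] dom.dfun_add[OF sm assms(2)] by simp
    also have "\<dots> = (h (F p) (D p v \<xi>) (\<eta> p) + h (F p) (\<xi> p) (D p v \<eta>)) +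
        (h (F p) (D p v \<xi>') (\<eta> p) + h (F p) (\<xi>' p) (D p v \<eta>))"
      using assms(3,4) v by (simp add: metric_pair_def)
    finally show ?thesis
      using D_tangent[OF assms(1) _ assms(2) v] section_tangent[OF _ assms(2)] sec
      by (simp add: D_add[OF assms(1) sec(1,2) assms(2) v] cod.metric_add_left)
  qed
  with sec section_add[OF assms(1) sec(1,2)] dom.smooth_fun_on_cong[OF assms(1) sum eq] show ?thesis
    by (simp add: metric_pair_def)
qed

lemma metric_pair_scale:
  assumes "open W" "p \<in> W" "metric_pair W p \<xi> \<eta>" "smooth_fun_on A W f"
  shows "metric_pair W p (\<lambda>q. f q *\<^sub>T \<xi> q) \<eta>"
proof -
  have sec: "section_along A B F W \<xi>" "section_along A B F W \<eta>"
    and sm: "smooth_fun_on A W (\<lambda>q. h (F q) (\<xi> q) (\<eta> q))"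
    using assms(3) by (simp_all add: metric_pair_def)
  have eq: "f q * h (F q) (\<xi> q) (\<eta> q) = h (F q) (f q *\<^sub>T \<xi> q) (\<eta> q)" if "q \<in> W" for q
    using section_tangent[OF sec(1) that] section_tangent[OF sec(2) that]
    by (rule cod.metric_scale_left[symmetric])
  note prod = dom.smooth_fun_on_mult[OF assms(1,4) sm]
  have "dfun A (\<lambda>q. h (F q) (f q *\<^sub>T \<xi> q) (\<eta> q)) p v =
      h (F p) (D p v (\<lambda>q. f q *\<^sub>T \<xi> q)) (\<eta> p) + h (F p) (f p *\<^sub>T \<xi> p) (D p v \<eta>)"
    if v: "v \<in> tangent_space A p" for v
  proof -
    have t: "D p v \<xi> \<in> tangent_space B (F p)" "D p v \<eta> \<in> tangent_space B (F p)"
      "\<xi> p \<in> tangent_space B (F p)" "\<eta> p \<in> tangent_space B (F p)"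
      using D_tangent[OF assms(1) _ assms(2) v] section_tangent[OF _ assms(2)] sec by auto
    have "dfun A (\<lambda>q. h (F q) (f q *\<^sub>T \<xi> q) (\<eta> q)) p v =
        dfun A f p v * h (F p) (\<xi> p) (\<eta> p) + f p * dfun A (\<lambda>q. h (F q) (\<xi> q) (\<eta> q)) p v"
      using dom.dfun_cong[OF assms(1) prod assms(2) eq] dom.dfun_mult[OF assms(4) sm assms(2)] by simp
    also have "\<dots> = dfun A f p v * h (F p) (\<xi> p) (\<eta> p) +
        f p * (h (F p) (D p v \<xi>) (\<eta> p) + h (F p) (\<xi> p) (D p v \<eta>))"
      using assms(3) v by (simp add: metric_pair_def)
    finally show ?thesis
      by (simp add: D_Leibniz[OF assms(1,4) sec(1) assms(2) v] cod.metric_add_left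
          cod.metric_scale_left cod.tangent_scale t algebra_simps)
  qed
  with sec section_scale[OF assms(1,4) sec(1)] dom.smooth_fun_on_cong[OF assms(1) prod eq] show ?thesis
    by (simp add: metric_pair_def)
qed

lemma metric_pair_sum:
  assumes "open W" "p \<in> W" "section_along A B F W \<eta>" "\<And>i. i \<in> S \<Longrightarrow> metric_pair W p (\<xi> i) \<eta>"
  shows "metric_pair W p (\<lambda>q. \<Sum>i\<in>S. \<xi> i q) \<eta>"
  using assms(4)
  by (induction S rule: infinite_finite_induct)
     (auto intro: metric_pair_zero[OF assms(3,1,2)] metric_pair_add[OF assms(1,2)])

lemma metric_pair_cong:
  assumes "open W" "p \<in> W" "metric_pair W p \<xi> \<eta>" "section_along A B F W \<xi>'"
    and eq: "\<And>q. q \<in> W \<Longrightarrow> \<xi> q = \<xi>' q"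
  shows "metric_pair W p \<xi>' \<eta>"
proof -
  have sec: "section_along A B F W \<xi>" "section_along A B F W \<eta>"
    and sm: "smooth_fun_on A W (\<lambda>q. h (F q) (\<xi> q) (\<eta> q))"
    using assms(3) by (simp_all add: metric_pair_def)
  have eq': "h (F q) (\<xi> q) (\<eta> q) = h (F q) (\<xi>' q) (\<eta> q)" if "q \<in> W" for q
    using eq[OF that] by simp
  have "dfun A (\<lambda>q. h (F q) (\<xi>' q) (\<eta> q)) p v =
      h (F p) (D p v \<xi>') (\<eta> p) + h (F p) (\<xi>' p) (D p v \<eta>)" if v: "v \<in> tangent_space A p" for v
    using assms(3) v eq[OF assms(2)] dom.dfun_cong[OF assms(1) sm assms(2) eq', of v]
      D_cong[OF assms(1) sec(1) assms(4) eq assms(2) v]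
    by (simp add: metric_pair_def)
  with assms(4) sec dom.smooth_fun_on_cong[OF assms(1) sm eq'] show ?thesis
    by (simp add: metric_pair_def)
qed

text \<open>Both frame sections are composites with \<open>F\<close>. The chain rule
  \<open>dfun_compose\<close> and \<open>D_pullback\<close> turn the claim into metric compatibility
  of \<open>nabla'\<close> on the target, in the direction \<open>dmap A B F p v\<close>.\<close>

lemma metric_pair_frame:
  assumes "d \<in> B" "F p \<in> chart_dom d"
  shows "metric_pair (F -` chart_dom d) p (\<lambda>q. cod.coord_vec d a (F q)) (\<lambda>q. cod.coord_vec d b (F q))"
proof -
  note op = cod.open_chart_dom[OF assms(1)] and vf = cod.frame_vector_field[OF assms(1)]
  note sm = cod.metric_smooth[OF op vf vf]
  have "dfun A (\<lambda>q. h (F q) (cod.coord_vec d a (F q)) (cod.coord_vec d b (F q))) p v =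
      h (F p) (D p v (\<lambda>q. cod.coord_vec d a (F q))) (cod.coord_vec d b (F p)) +
      h (F p) (cod.coord_vec d a (F p)) (D p v (\<lambda>q. cod.coord_vec d b (F q)))"
    if v: "v \<in> tangent_space A p" for v
    unfolding dfun_compose[OF op sm assms(2) v] D_pullback[OF op vf assms(2) v]
    by (rule lc'[unfolded levi_civita_def, THEN conjunct2, THEN conjunct2, THEN spec, THEN spec,
          THEN spec, THEN mp, OF op, THEN mp, OF vf, THEN mp, OF vf, THEN bspec, OF assms(2),
          THEN bspec, OF dmap_tangent[OF v]])
  with smooth_fun_on_compose[OF op sm] frame_section[OF assms(1)] show ?thesis
    by (simp add: metric_pair_def)
qed

lemma metric_pair_subset:
  assumes "metric_pair W p \<xi> \<eta>" "V \<subseteq> W"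
  shows "metric_pair V p \<xi> \<eta>"
  using assms section_subset dom.smooth_fun_on_subset by (meson metric_pair_def)

text \<open>The neighbourhood shrinks because the frame lives over one chart of the target
  only.\<close>

lemma pullback_metric:
  assumes W: "open W" "p \<in> W" and \<xi>: "section_along A B F W \<xi>" and \<eta>: "section_along A B F W \<eta>"
  obtains U where "open U" "p \<in> U" "U \<subseteq> W" "metric_pair U p \<xi> \<eta>"
proof -
  let ?d = "chart_at B (F p)"
  note d = cod.chart_at[of "F p"]
  let ?U = "W \<inter> F -` chart_dom ?d"
  let ?e = "\<lambda>b q. cod.coord_vec ?d b (F q)"
  have U: "open ?U" "p \<in> ?U"
    using W open_preimage[OF cod.open_chart_dom[OF d(1)]] d by auto
  \<comment> \<open>Passes from the frame to an arbitrary section in the first argument. It is used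
    once with a frame section as second argument, hence \<open>\<eta>\<close> given on
    \<open>?U\<close> only, and after a swap once more for the other argument.\<close>
  have extend: "metric_pair ?U p \<xi> \<eta>"
    if \<xi>: "section_along A B F W \<xi>" and \<eta>: "section_along A B F ?U \<eta>"
      and e: "\<And>b. metric_pair ?U p (?e b) \<eta>" for \<xi> \<eta>
  proof -
    have "metric_pair ?U p (\<lambda>q. \<Sum>b\<in>Basis. (\<xi> q ?d \<bullet> b) *\<^sub>T ?e b q) \<eta>"
      by (intro metric_pair_sum metric_pair_scale U \<eta> e section_component[OF W(1) \<xi> d(1)])
    then show ?thesis
      by (rule metric_pair_cong[OF U _ section_subset[OF \<xi>]])
         (use section_frame_expansion[OF \<xi> d(1)] in auto)
  qed
  have e: "section_along A B F ?U (?e b)" for b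
    by (rule section_subset[OF frame_section[OF d(1)]]) auto
  have "metric_pair ?U p (?e a) (?e b)" for a b
    by (rule metric_pair_subset[OF metric_pair_frame[OF d]]) auto
  then have "metric_pair ?U p \<xi> (?e b)" for b
    by (rule extend[OF \<xi> e])
  then have "metric_pair ?U p (?e b) \<xi>" for b
    by (rule metric_pair_sym[OF U])
  then have "metric_pair ?U p \<eta> \<xi>"
    by (rule extend[OF \<eta> section_subset[OF \<xi> Int_lower1]])
  from that[OF U Int_lower1 metric_pair_sym[OF U this]] show thesis .
qed

end

section \<open>Uniqueness of the Levi-Civita connection\<close>

text \<open>Alternating the two exchanges six times returns to the same triple with three changes of
  sign, so the value equals its own negative. It serves both the uniqueness of the Levi-Civita
  connection and the horizontal part of \<open>S\<close>.\<close>

lemma skew_symmetric_trilinear_zero: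
  fixes a :: "'x \<Rightarrow> 'x \<Rightarrow> 'x \<Rightarrow> real"
  assumes sym: "\<And>x y z. x \<in> S \<Longrightarrow> y \<in> S \<Longrightarrow> z \<in> S \<Longrightarrow> a x y z = a y x z"
    and skew: "\<And>x y z. x \<in> S \<Longrightarrow> y \<in> S \<Longrightarrow> z \<in> S \<Longrightarrow> a x y z = - a x z y"
    and "x \<in> S" "y \<in> S" "z \<in> S"
  shows "a x y z = 0"
  using sym[of x y z] skew[of y x z] sym[of y z x] skew[of z y x] sym[of z x y] skew[of x z y] assms(3-5)
  by simp

context riemannian
begin

lemma LC_metric:
  assumes "levi_civita A g nabla" "open W" "vector_field A W X" "vector_field A W Y" "p \<in> W"
    "v \<in> tangent_space A p"
  shows "dfun A (\<lambda>q. g q (X q) (Y q)) p v = g p (nabla p v X) (Y p) + g p (X p) (nabla p v Y)"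
  by (rule assms(1)[unfolded levi_civita_def, THEN conjunct2, THEN conjunct2, THEN spec, THEN spec,
        THEN spec, THEN mp, OF assms(2), THEN mp, OF assms(3), THEN mp, OF assms(4), THEN bspec,
        OF assms(5), THEN bspec, OF assms(6)])

lemma LC_torsion_free:
  assumes "levi_civita A g nabla" "open W" "vector_field A W X" "vector_field A W Y" "p \<in> W"
  shows "nabla p (X p) Y - nabla p (Y p) X = lie_bracket A X Y p"
  by (rule assms(1)[unfolded levi_civita_def, THEN conjunct2, THEN conjunct1, THEN spec, THEN spec,
        THEN spec, THEN mp, OF assms(2), THEN mp, OF assms(3), THEN mp, OF assms(4), THEN bspec,
        OF assms(5)])

lemma LC_connection_map:
  "levi_civita A g nabla \<Longrightarrow> connection_map A A id nabla"
  using manifold_map_id by (simp add: connection_map_def connection_map_axioms_def levi_civita_def)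

text \<open>Pair the difference of the connections with a third field: equal torsion makes this
  symmetric in the first two fields, and metric compatibility makes it skew in the last two.\<close>

lemma levi_civita_unique:
  assumes lc: "levi_civita A g nabla" and lc': "levi_civita A g nabla'"
    and W: "open W" "vector_field A W Y" "p \<in> W" and v: "v \<in> tangent_space A p"
  shows "nabla p v Y = nabla' p v Y"
proof -
  interpret C: connection_map A A id nabla by (rule LC_connection_map[OF lc])
  interpret C': connection_map A A id nabla' by (rule LC_connection_map[OF lc'])
  let ?d = "chart_at A p"
  note d = chart_at[of p]
  let ?U = "W \<inter> chart_dom ?d"
  have U: "open ?U" "p \<in> ?U" using W d open_chart_dom[OF d(1)] by auto
  have ext: "vector_field A ?U (coord_vec ?d z)" for z
    by (rule C.section_subset[OF frame_vector_field[OF d(1)]]) auto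
  define a where "a = (\<lambda>X Y Z. g p (nabla p (X p) Y - nabla' p (X p) Y) (Z p))"
  note t = C.section_tangent[OF _ U(2), simplified]
  note nt = C.D_tangent[OF U(1) _ U(2), simplified] C'.D_tangent[OF U(1) _ U(2), simplified]
  have zero: "a X Y Z = 0"
    if "X \<in> {X. vector_field A ?U X}" "Y \<in> {X. vector_field A ?U X}" "Z \<in> {X. vector_field A ?U X}"
    for X Y Z
    using _ _ that
  proof (rule skew_symmetric_trilinear_zero)
    fix X Y Z
    assume "X \<in> {X. vector_field A ?U X}" "Y \<in> {X. vector_field A ?U X}" "Z \<in> {X. vector_field A ?U X}"
    then have X: "vector_field A ?U X" and Y: "vector_field A ?U Y" and Z: "vector_field A ?U Z"
      by auto
    have "nabla p (X p) Y - nabla p (Y p) X = nabla' p (X p) Y - nabla' p (Y p) X"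
      using LC_torsion_free[OF lc U(1) X Y U(2)] LC_torsion_free[OF lc' U(1) X Y U(2)] by simp
    then have "nabla p (X p) Y - nabla' p (X p) Y = nabla p (Y p) X - nabla' p (Y p) X"
      by (simp add: algebra_simps)
    then show "a X Y Z = a Y X Z" by (simp add: a_def)
    have "g p (nabla p (X p) Y) (Z p) + g p (Y p) (nabla p (X p) Z) =
        g p (nabla' p (X p) Y) (Z p) + g p (Y p) (nabla' p (X p) Z)"
      using LC_metric[OF lc U(1) Y Z U(2) t[OF X]] LC_metric[OF lc' U(1) Y Z U(2) t[OF X]] by simp
    moreover have "g p (Y p) (nabla p (X p) Z) = g p (nabla p (X p) Z) (Y p)"
      "g p (Y p) (nabla' p (X p) Z) = g p (nabla' p (X p) Z) (Y p)"
      by (intro metric_sym t[OF Y] nt(1)[OF Z t[OF X]] nt(2)[OF Z t[OF X]])+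
    moreover have "a X Y Z = g p (nabla p (X p) Y) (Z p) - g p (nabla' p (X p) Y) (Z p)"
      "a X Z Y = g p (nabla p (X p) Z) (Y p) - g p (nabla' p (X p) Z) (Y p)"
      unfolding a_def
      by (intro metric_diff_left nt(1)[OF Y t[OF X]] nt(2)[OF Y t[OF X]] t[OF Y] t[OF Z]
          nt(1)[OF Z t[OF X]] nt(2)[OF Z t[OF X]])+
    ultimately show "a X Y Z = - a X Z Y" by simp
  qed
  have Y: "vector_field A ?U Y" by (rule C.section_subset[OF W(2)]) auto
  let ?u = "nabla p v Y - nabla' p v Y"
  have u: "?u \<in> tangent_space A p"
    by (intro tangent_diff nt(1)[OF Y v] nt(2)[OF Y v])
  \<comment> \<open>Coordinate fields extend \<open>v\<close> and \<open>?u\<close> from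
    \<open>p\<close> to \<open>?U\<close>. Taking the extension of \<open>?u\<close> as third field
    gives the squared length of the difference.\<close>
  have "g p ?u ?u = 0"
    using zero[of "coord_vec ?d (v ?d)" Y "coord_vec ?d (?u ?d)"] ext Y
    by (simp add: a_def coord_vec_tangent_eq[OF v d] coord_vec_tangent_eq[OF u d] del: minus_apply)
  then have "?u = 0" using metric_pos[OF u] by force
  then show ?thesis by simp
qed

end

section \<open>Riemannian submersions\<close>

locale riemannian_submersion_map = pullback_map A B F D h nabla' + dom: riemannian A g
  for A :: "('p::{t2_space, second_countable_topology}, 'a::euclidean_space) chart set"
    and B :: "('q::{t2_space, second_countable_topology}, 'b::euclidean_space) chart set"
    and F :: "'p \<Rightarrow> 'q" and D :: "('p, 'a, 'q, 'b) connection" and h :: "('q, 'b) metric"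
    and nabla' :: "('q, 'b, 'q, 'b) connection" and g :: "('p, 'a) metric" +
  fixes nabla :: "('p, 'a, 'p, 'a) connection"
  assumes lc: "levi_civita A g nabla" and rs: "riemannian_submersion A g B h F"
begin

sublocale M: connection_map A A id nabla
  by (rule dom.LC_connection_map[OF lc])

abbreviation V where "V \<equiv> vertical_space A B F"
abbreviation H where "H \<equiv> horizontal_space A g B F"
abbreviation dF where "dF \<equiv> dmap A B F"
abbreviation S where "S \<equiv> second_fundamental_form A B F nabla D"

lemma vertical_tangent: "v \<in> V p \<Longrightarrow> v \<in> tangent_space A p"
  by (simp add: vertical_space_def)

lemma horizontal_tangent: "v \<in> H p \<Longrightarrow> v \<in> tangent_space A p"
  by (simp add: horizontal_space_def)

lemma dF_vertical: "v \<in> V p \<Longrightarrow> dF p v = 0"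
  by (simp add: vertical_space_def)

lemma horizontal_vertical: "u \<in> H p \<Longrightarrow> v \<in> V p \<Longrightarrow> g p u v = 0"
  by (simp add: horizontal_space_def)

lemma dF_isometry: "u \<in> H p \<Longrightarrow> v \<in> H p \<Longrightarrow> h (F p) (dF p u) (dF p v) = g p u v"
  using rs unfolding riemannian_submersion_def by blast

lemma dF_onto: "y \<in> tangent_space B (F p) \<Longrightarrow> \<exists>u\<in>tangent_space A p. y = dF p u"
  using rs unfolding riemannian_submersion_def by blast

lemma horizontal_add: "u \<in> H p \<Longrightarrow> v \<in> H p \<Longrightarrow> u + v \<in> H p"
  by (auto simp: horizontal_space_def dom.tangent_add dom.metric_add_left vertical_space_def)

text \<open>A chart identifies the tangent space with \<open>'a\<close>, where the metric becomes an
  inner product \<open>?\<beta>\<close>, the vertical space becomes a subspace, and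
  \<open>orthogonal_decomposition\<close> applies.\<close>

lemma vertical_horizontal_decomposition:
  assumes u: "u \<in> tangent_space A p"
  obtains v w where "v \<in> V p" "w \<in> H p" "u = v + w"
proof -
  let ?c = "chart_at A p"
  note c = dom.chart_at[of p]
  let ?e = "\<lambda>x. dom.coord_vec ?c x p"
  note t = dom.coord_vec_tangent[OF c]
  let ?\<beta> = "\<lambda>x y. g p (?e x) (?e y)"
  let ?V = "{x. ?e x \<in> V p}"
  have e0: "?e 0 = 0"
    by (rule dom.tangent_space_eqI[OF t dom.tangent_zero c]) (simp add: dom.coord_vec_self c)
  have bil: "bilinear ?\<beta>"
    unfolding bilinear_def
    by (auto intro!: linearI simp: dom.coord_vec_add[OF c] dom.coord_vec_scale[OF c]
        dom.metric_add_left dom.metric_add_right dom.metric_scale_left dom.metric_scale_right t)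
  have pos: "?\<beta> x x > 0" if "x \<noteq> 0" for x
  proof (rule dom.metric_pos[OF t])
    show "?e x \<noteq> 0" using that dom.coord_vec_self[OF c, of x] by (auto simp: zero_fun_def)
  qed
  have sub: "subspace ?V"
    by (auto simp: subspace_def vertical_space_def t dom.tangent_zero e0 dmap_zero
        dom.coord_vec_add[OF c] dom.coord_vec_scale[OF c] dmap_add dmap_scale dom.tangent_add
        dom.tangent_scale dmap_zero[unfolded zero_fun_def] dom.tangent_zero[unfolded zero_fun_def]
        zero_fun_def)
  obtain x where x: "x \<in> ?V" "\<And>w. w \<in> ?V \<Longrightarrow> ?\<beta> (u ?c - x) w = 0"
    using orthogonal_decomposition[OF bil dom.metric_sym[OF t t] pos sub] by blast
  have diff: "?e (u ?c - x) = u - ?e x"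
    by (rule dom.tangent_space_eqI[OF t dom.tangent_diff[OF u t] c]) (simp add: dom.coord_vec_self c)
  have "g p (?e (u ?c - x)) w = 0" if w: "w \<in> V p" for w
    using x(2)[of "w ?c"] w dom.coord_vec_tangent_eq[OF vertical_tangent[OF w] c] by simp
  then have "u - ?e x \<in> H p"
    using t[of "u ?c - x"] by (simp add: horizontal_space_def diff)
  with x(1) show thesis by (intro that[of "?e x" "u - ?e x"]) auto
qed

lemma dF_horizontal:
  assumes u: "u \<in> tangent_space A p" and w: "w \<in> H p"
  shows "h (F p) (dF p u) (dF p w) = g p u w"
proof -
  obtain a b where ab: "a \<in> V p" "b \<in> H p" "u = a + b"
    using vertical_horizontal_decomposition[OF u] .
  note t = vertical_tangent[OF ab(1)] horizontal_tangent[OF ab(2)] horizontal_tangent[OF w]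
  have "g p a w = 0" using horizontal_vertical[OF w ab(1)] dom.metric_sym[OF t(1,3)] by simp
  with ab t show ?thesis
    by (simp add: dmap_add dF_vertical dF_isometry w dom.metric_add_left)
qed

text \<open>The differential forgets the vertical part and is isometric on the horizontal one. This
  is the inequality behind the minimum argument, with equality at horizontal vectors.\<close>

lemma dF_contraction:
  assumes u: "u \<in> tangent_space A p"
  shows "h (F p) (dF p u) (dF p u) \<le> g p u u"
proof -
  obtain a b where ab: "a \<in> V p" "b \<in> H p" "u = a + b"
    using vertical_horizontal_decomposition[OF u] .
  note t = vertical_tangent[OF ab(1)] horizontal_tangent[OF ab(2)]
  have 0: "g p b a = 0" "g p a b = 0"
    using horizontal_vertical[OF ab(2,1)] dom.metric_sym[OF t] by simp_all
  have "h (F p) (dF p u) (dF p u) = g p b b"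
    using ab t by (simp add: dmap_add dF_vertical dF_isometry)
  also have "\<dots> \<le> g p a a + g p b b" using dom.metric_nonneg[OF t(1)] by simp
  also have "\<dots> = g p u u"
    using t 0 by (simp add: ab(3) dom.metric_add_left dom.metric_add_right dom.tangent_add)
  finally show ?thesis .
qed

lemma field_tangent: "vector_field A W Y \<Longrightarrow> p \<in> W \<Longrightarrow> Y p \<in> tangent_space A p"
  using M.section_tangent[of W Y p] by simp

lemma nabla_tangent:
  "open W \<Longrightarrow> vector_field A W Y \<Longrightarrow> p \<in> W \<Longrightarrow> v \<in> tangent_space A p \<Longrightarrow>
    nabla p v Y \<in> tangent_space A p"
  using M.D_tangent[of W Y p v] by simp

section \<open>The second fundamental form as a tensor, and its horizontal part\<close>

context
  fixes W :: "'p set" and p :: 'p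
  assumes W: "open W" "p \<in> W"
begin

lemma S_tangent:
  assumes "vector_field A W U" "vector_field A W Y"
  shows "S U Y p \<in> tangent_space B (F p)"
  unfolding second_fundamental_form_def
  by (intro cod.tangent_diff D_tangent[OF W(1) section_dmap[OF W(1)] W(2)] dmap_tangent
      nabla_tangent[OF W(1) _ W(2)] field_tangent[OF _ W(2)] assms)

lemma S_sym:
  assumes U: "vector_field A W U" and Y: "vector_field A W Y"
  shows "S U Y p = S Y U p"
proof -
  note t = field_tangent[OF U W(2)] field_tangent[OF Y W(2)]
  note n = nabla_tangent[OF W(1) Y W(2) t(1)] nabla_tangent[OF W(1) U W(2) t(2)]
  note br = dom.LC_torsion_free[OF lc W(1) U Y W(2)]
  \<comment> \<open>\<open>br\<close> writes the Lie bracket as a difference of two tangent vectors,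
    which also supplies the tangency premise of \<open>pullback_torsion_free\<close>.\<close>
  have "D p (U p) (\<lambda>q. dF q (Y q)) - D p (Y p) (\<lambda>q. dF q (U q)) =
      dF p (nabla p (U p) Y) - dF p (nabla p (Y p) U)"
    using pullback_torsion_free[OF W U Y] dom.tangent_diff[OF n]
    by (simp add: br[symmetric] dmap_diff[OF n])
  then show ?thesis by (simp add: second_fundamental_form_def algebra_simps)
qed

text \<open>By definition only the value at \<open>p\<close> of the first argument enters; symmetry
  carries this over to the second.\<close>

lemma S_cong:
  assumes "vector_field A W U" "vector_field A W Y" "vector_field A W U'" "vector_field A W Y'"
    and "U p = U' p" "Y p = Y' p"
  shows "S U Y p = S U' Y' p"
proof -
  have "S U Y p = S U' Y p" by (simp add: second_fundamental_form_def assms(5))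
  also have "\<dots> = S Y U' p" by (rule S_sym[OF assms(3,2)])
  also have "\<dots> = S Y' U' p" by (simp add: second_fundamental_form_def assms(6))
  also have "\<dots> = S U' Y' p" by (rule S_sym[OF assms(4,3)])
  finally show ?thesis .
qed

lemma S_add_left:
  assumes "vector_field A W U" "vector_field A W U'" "vector_field A W Y"
  shows "S (\<lambda>q. U q + U' q) Y p = S U Y p + S U' Y p"
proof -
  note t = field_tangent[OF assms(1) W(2)] field_tangent[OF assms(2) W(2)]
  show ?thesis
    unfolding second_fundamental_form_def
      D_dir_add[OF W(1) section_dmap[OF W(1) assms(3)] W(2) t] M.D_dir_add[OF W(1) assms(3) W(2) t]
      dmap_add[OF nabla_tangent[OF W(1) assms(3) W(2) t(1)] nabla_tangent[OF W(1) assms(3) W(2) t(2)]]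
    by (simp only: add_diff_add)
qed

lemma S_scale_left:
  assumes "vector_field A W U" "vector_field A W Y"
  shows "S (\<lambda>q. r *\<^sub>T U q) Y p = r *\<^sub>T S U Y p"
proof -
  note t = field_tangent[OF assms(1) W(2)]
  show ?thesis
    unfolding second_fundamental_form_def
      D_dir_scale[OF W(1) section_dmap[OF W(1) assms(2)] W(2) t] M.D_dir_scale[OF W(1) assms(2) W(2) t]
      dmap_scale[OF nabla_tangent[OF W(1) assms(2) W(2) t]]
    by (simp add: fun_eq_iff scaleR_diff_right)
qed

lemma S_add_right:
  assumes "vector_field A W U" "vector_field A W Y" "vector_field A W Y'"
  shows "S U (\<lambda>q. Y q + Y' q) p = S U Y p + S U Y' p"
  using S_add_left[OF assms(2,3,1)] S_sym[OF assms(1) M.section_add[OF W(1) assms(2,3)]]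
    S_sym[OF assms(1,2)] S_sym[OF assms(1,3)] by simp

lemma S_scale_right:
  assumes "vector_field A W U" "vector_field A W Y"
  shows "S U (\<lambda>q. r *\<^sub>T Y q) p = r *\<^sub>T S U Y p"
  using S_scale_left[OF assms(2,1)] S_sym[OF assms(1) M.section_scale_const[OF W(1) assms(2)]]
    S_sym[OF assms] by simp

text \<open>The vanishing derivative equates \<open>h\<close> of \<open>D p ?v ?\<xi>\<close> and
  \<open>?\<xi> p\<close> with \<open>g\<close> of \<open>nabla p ?v Y\<close> and
  \<open>Y p\<close>, both Leibniz rules contributing the same factor 2. As \<open>Y p\<close> is
  horizontal, \<open>dF_horizontal\<close> turns the latter into a product in the target.\<close>

lemma S_horizontal_diagonal:
  assumes U: "vector_field A W U" and Y: "vector_field A W Y" and hor: "Y p \<in> H p"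
  shows "h (F p) (S U Y p) (dF p (Y p)) = 0"
proof -
  let ?\<xi> = "\<lambda>q. dF q (Y q)"
  let ?v = "U p"
  note v = field_tangent[OF U W(2)]
  note sec = section_dmap[OF W(1) Y]
  obtain X where X: "open X" "p \<in> X" "X \<subseteq> W" and mp: "metric_pair X p ?\<xi> ?\<xi>"
    using pullback_metric[OF W sec sec] .
  have smh: "smooth_fun_on A X (\<lambda>q. h (F q) (?\<xi> q) (?\<xi> q))"
    and dh: "dfun A (\<lambda>q. h (F q) (?\<xi> q) (?\<xi> q)) p ?v =
      h (F p) (D p ?v ?\<xi>) (?\<xi> p) + h (F p) (?\<xi> p) (D p ?v ?\<xi>)"
    using mp v by (simp_all add: metric_pair_def)
  have smg: "smooth_fun_on A X (\<lambda>q. g q (Y q) (Y q))"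
    by (rule dom.smooth_fun_on_subset[OF dom.metric_smooth[OF W(1) Y Y] X(3)])
  have "dfun A (\<lambda>q. g q (Y q) (Y q) - h (F q) (?\<xi> q) (?\<xi> q)) p ?v = 0"
  proof (rule dom.dfun_local_min[OF X(1) dom.smooth_fun_on_diff[OF X(1) smg smh] X(2)])
    fix q assume "q \<in> X"
    then have "Y q \<in> tangent_space A q" using field_tangent[OF Y] X(3) by auto
    from dF_contraction[OF this] dF_isometry[OF hor hor]
    show "g p (Y p) (Y p) - h (F p) (?\<xi> p) (?\<xi> p) \<le> g q (Y q) (Y q) - h (F q) (?\<xi> q) (?\<xi> q)"
      by simp
  qed
  then have eq: "dfun A (\<lambda>q. g q (Y q) (Y q)) p ?v = dfun A (\<lambda>q. h (F q) (?\<xi> q) (?\<xi> q)) p ?v"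
    using dom.dfun_diff[OF smg smh X(2)] by simp
  note Yt = field_tangent[OF Y W(2)] and nt = nabla_tangent[OF W(1) Y W(2) v]
    and Dt = D_tangent[OF W(1) sec W(2) v]
  have "h (F p) (D p ?v ?\<xi>) (?\<xi> p) = g p (nabla p ?v Y) (Y p)"
    using eq dh dom.LC_metric[OF lc W(1) Y Y W(2) v] dom.metric_sym[OF Yt nt]
      cod.metric_sym[OF dmap_tangent[OF Yt] Dt] by simp
  also have "\<dots> = h (F p) (dF p (nabla p ?v Y)) (dF p (Y p))"
    by (rule dF_horizontal[OF nt hor, symmetric])
  finally show ?thesis
    by (simp add: second_fundamental_form_def cod.metric_diff_left[OF Dt dmap_tangent[OF nt] dmap_tangent[OF Yt]])
qed

lemma S_horizontal:
  assumes "vector_field A W X" "X p \<in> H p" "vector_field A W Y" "Y p \<in> H p"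
    and "vector_field A W Z" "Z p \<in> H p"
  shows "h (F p) (S X Y p) (dF p (Z p)) = 0"
proof -
  let ?H = "{X. vector_field A W X \<and> X p \<in> H p}"
  have "X \<in> ?H" "Y \<in> ?H" "Z \<in> ?H" using assms by auto
  with _ _ show ?thesis
  proof (rule skew_symmetric_trilinear_zero[where a = "\<lambda>X Y Z. h (F p) (S X Y p) (dF p (Z p))"])
    fix X Y Z assume "X \<in> ?H" "Y \<in> ?H" "Z \<in> ?H"
    then have X: "vector_field A W X" and Y: "vector_field A W Y" "Y p \<in> H p"
      and Z: "vector_field A W Z" "Z p \<in> H p" by auto
    show "h (F p) (S X Y p) (dF p (Z p)) = h (F p) (S Y X p) (dF p (Z p))"
      by (simp add: S_sym[OF X Y(1)])
    note t = S_tangent[OF X Y(1)] S_tangent[OF X Z(1)] dmap_tangent[OF field_tangent[OF Y(1) W(2)]]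
      dmap_tangent[OF field_tangent[OF Z(1) W(2)]]
    \<comment> \<open>Polarization: the diagonal identity for \<open>Y + Z\<close>, minus those for
      \<open>Y\<close> and \<open>Z\<close>, is skewness in these two fields.\<close>
    have "h (F p) (S X (\<lambda>q. Y q + Z q) p) (dF p (Y p + Z p)) = 0"
      by (rule S_horizontal_diagonal[OF X M.section_add[OF W(1) Y(1) Z(1)] horizontal_add[OF Y(2) Z(2)]])
    then show "h (F p) (S X Y p) (dF p (Z p)) = - h (F p) (S X Z p) (dF p (Y p))"
      using S_horizontal_diagonal[OF X Y] S_horizontal_diagonal[OF X Z]
      by (simp add: S_add_right[OF X Y(1) Z(1)] dmap_add field_tangent[OF _ W(2)] Y(1) Z(1)
          cod.metric_add_left cod.metric_add_right cod.tangent_add t)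
  qed
qed

end

end

section \<open>Submersions with complex fibres\<close>

locale complex_submersion_map = riemannian_submersion_map A B F D h nabla' g nabla
  for A :: "('p::{t2_space, second_countable_topology}, 'a::euclidean_space) chart set"
    and B :: "('q::{t2_space, second_countable_topology}, 'b::euclidean_space) chart set"
    and F :: "'p \<Rightarrow> 'q" and D :: "('p, 'a, 'q, 'b) connection" and h :: "('q, 'b) metric"
    and nabla' :: "('q, 'b, 'q, 'b) connection" and g :: "('p, 'a) metric"
    and nabla :: "('p, 'a, 'p, 'a) connection" +
  fixes J :: "'p \<Rightarrow> ('p, 'a) tvec \<Rightarrow> ('p, 'a) tvec"
  assumes J: "endomorphism_field A J"
    and JJ: "\<And>p v. v \<in> tangent_space A p \<Longrightarrow> J p (J p v) = - v"
    and J_iso: "\<And>p v w. v \<in> tangent_space A p \<Longrightarrow> w \<in> tangent_space A p \<Longrightarrow>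
      g p (J p v) (J p w) = g p v w"
    and J_parallel: "parallel_endomorphism A nabla J"
    and J_vertical: "\<And>p v. v \<in> V p \<Longrightarrow> J p v \<in> V p"
begin

lemma J_laws:
  assumes "v \<in> tangent_space A p" "w \<in> tangent_space A p"
  shows "J p v \<in> tangent_space A p \<and> J p (v + w) = J p v + J p w \<and> J p (r *\<^sub>T v) = r *\<^sub>T J p v"
  by (rule J[unfolded endomorphism_field_def, THEN conjunct1, THEN spec, THEN bspec, OF assms(1),
        THEN bspec, OF assms(2), THEN spec])

lemma J_tangent: "v \<in> tangent_space A p \<Longrightarrow> J p v \<in> tangent_space A p"
  using J_laws[of v p v] by simp

lemma J_add:
  "v \<in> tangent_space A p \<Longrightarrow> w \<in> tangent_space A p \<Longrightarrow> J p (v + w) = J p v + J p w"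
  using J_laws[of v p w] by simp

lemma J_scale: "v \<in> tangent_space A p \<Longrightarrow> J p (r *\<^sub>T v) = r *\<^sub>T J p v"
  using J_laws[of v p v] by simp

lemma J_field:
  assumes "open W" "vector_field A W Y"
  shows "vector_field A W (\<lambda>q. J q (Y q))"
  by (rule J[unfolded endomorphism_field_def, THEN conjunct2, THEN spec, THEN spec, THEN mp,
        OF assms(1), THEN mp, OF assms(2)])

lemma nabla_J:
  assumes "open W" "vector_field A W Y" "p \<in> W" "v \<in> tangent_space A p"
  shows "nabla p v (\<lambda>q. J q (Y q)) = J p (nabla p v Y)"
  by (rule J_parallel[unfolded parallel_endomorphism_def, THEN spec, THEN spec, THEN mp,
        OF assms(1), THEN mp, OF assms(2), THEN bspec, OF assms(3), THEN bspec, OF assms(4)])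

lemma J_skew:
  assumes "v \<in> tangent_space A p" "w \<in> tangent_space A p"
  shows "g p (J p v) w = - g p v (J p w)"
  using J_iso[OF assms(1) J_tangent[OF assms(2)]]
  by (simp add: JJ assms dom.metric_uminus_right J_tangent)

text \<open>Skewness moves \<open>J\<close> onto the vertical test vector, which stays
  vertical.\<close>

lemma J_horizontal:
  assumes "u \<in> H p"
  shows "J p u \<in> H p"
  using assms J_vertical
  by (auto simp: horizontal_space_def J_tangent J_skew vertical_tangent)

text \<open>The differential sees only horizontal parts, \<open>J\<close> respects the splitting,
  and on horizontal vectors the claim is the skewness of \<open>J\<close> for
  \<open>g\<close>.\<close>

lemma dF_J_skew:
  assumes u: "u \<in> tangent_space A p" and w: "w \<in> tangent_space A p"
  shows "h (F p) (dF p (J p u)) (dF p w) = - h (F p) (dF p u) (dF p (J p w))"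
proof -
  obtain a b where ab: "a \<in> V p" "b \<in> H p" "u = a + b"
    using vertical_horizontal_decomposition[OF u] .
  obtain c d where cd: "c \<in> V p" "d \<in> H p" "w = c + d"
    using vertical_horizontal_decomposition[OF w] .
  note t = vertical_tangent[OF ab(1)] horizontal_tangent[OF ab(2)]
    vertical_tangent[OF cd(1)] horizontal_tangent[OF cd(2)]
  have "dF p u = dF p b" "dF p (J p u) = dF p (J p b)" "dF p w = dF p d" "dF p (J p w) = dF p (J p d)"
    using t by (simp_all add: ab(3) cd(3) J_add dmap_add J_tangent dF_vertical ab(1) cd(1) J_vertical)
  then show ?thesis
    using t by (simp add: dF_isometry J_horizontal ab(2) cd(2) J_skew)
qed

section \<open>The vertical part of the second fundamental form and its trace\<close>

context
  fixes W :: "'p set" and p :: 'p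
  assumes W: "open W" "p \<in> W"
begin

text \<open>\<open>dF_J_skew\<close> makes \<open>?f + ?k\<close> vanish at every point of
  \<open>W\<close>, so it can be differentiated at \<open>p\<close> although \<open>Y\<close> is
  vertical at \<open>p\<close> only.\<close>

lemma S_J_right:
  assumes U: "vector_field A W U" and Y: "vector_field A W Y" "Y p \<in> V p" and Z: "vector_field A W Z"
  shows "h (F p) (S U (\<lambda>q. J q (Y q)) p) (dF p (Z p)) = - h (F p) (S U Y p) (dF p (J p (Z p)))"
proof -
  let ?v = "U p"
  let ?JY = "\<lambda>q. J q (Y q)" and ?JZ = "\<lambda>q. J q (Z q)"
  note v = field_tangent[OF U W(2)]
  note JY = J_field[OF W(1) Y(1)] and JZ = J_field[OF W(1) Z]
  note sec = section_dmap[OF W(1)]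
  let ?f = "\<lambda>q. h (F q) (dF q (?JY q)) (dF q (Z q))" and ?k = "\<lambda>q. h (F q) (dF q (Y q)) (dF q (?JZ q))"
  obtain X1 where X1: "open X1" "p \<in> X1" "X1 \<subseteq> W"
    "metric_pair X1 p (\<lambda>q. dF q (?JY q)) (\<lambda>q. dF q (Z q))"
    using pullback_metric[OF W sec[OF JY] sec[OF Z]] .
  obtain X2 where X2: "open X2" "p \<in> X2" "X2 \<subseteq> W"
    "metric_pair X2 p (\<lambda>q. dF q (Y q)) (\<lambda>q. dF q (?JZ q))"
    using pullback_metric[OF W sec[OF Y(1)] sec[OF JZ]] .
  let ?X = "X1 \<inter> X2"
  have X: "open ?X" "p \<in> ?X" using X1 X2 by auto
  have sm: "smooth_fun_on A ?X ?f" "smooth_fun_on A ?X ?k"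
    using X1(4) X2(4) dom.smooth_fun_on_subset[of X1 ?f ?X] dom.smooth_fun_on_subset[of X2 ?k ?X]
    by (auto simp: metric_pair_def)
  have "dfun A (\<lambda>q. ?f q + ?k q) p ?v = dfun A (\<lambda>q. 0) p ?v"
  proof (rule dom.dfun_cong[OF X(1) dom.smooth_fun_on_add[OF X(1) sm] X(2)])
    fix q assume "q \<in> ?X"
    then have q: "q \<in> W" using X1(3) by auto
    show "?f q + ?k q = 0"
      using dF_J_skew[OF field_tangent[OF Y(1) q] field_tangent[OF Z q]] by simp
  qed
  then have sum0: "dfun A ?f p ?v + dfun A ?k p ?v = 0"
    using dom.dfun_add[OF sm X(2)] by (simp add: dom.dfun_const)
  have df: "dfun A ?f p ?v = h (F p) (D p ?v (\<lambda>q. dF q (?JY q))) (dF p (Z p)) +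
      h (F p) (dF p (?JY p)) (D p ?v (\<lambda>q. dF q (Z q)))"
    "dfun A ?k p ?v = h (F p) (D p ?v (\<lambda>q. dF q (Y q))) (dF p (?JZ p)) +
      h (F p) (dF p (Y p)) (D p ?v (\<lambda>q. dF q (?JZ q)))"
    using X1(4) X2(4) v by (simp_all add: metric_pair_def)
  note Dt = D_tangent[OF W(1) sec W(2) v]
  note tY = field_tangent[OF Y(1) W(2)] and tZ = field_tangent[OF Z W(2)]
  note n = nabla_tangent[OF W(1) Y(1) W(2) v]
  \<comment> \<open>The terms in which \<open>Y\<close> or \<open>?JY\<close> stays undifferentiated
    vanish, since both are vertical at \<open>p\<close>.\<close>
  have "h (F p) (D p ?v (\<lambda>q. dF q (?JY q))) (dF p (Z p)) +
      h (F p) (D p ?v (\<lambda>q. dF q (Y q))) (dF p (?JZ p)) = 0"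
    using sum0 unfolding df
    by (simp add: dF_vertical[OF Y(2)] dF_vertical[OF J_vertical[OF Y(2)]]
        cod.metric_zero_left[OF Dt[OF Z]] cod.metric_zero_left[OF Dt[OF JZ]])
  \<comment> \<open>As \<open>J\<close> is parallel, the \<open>nabla\<close> part of
    \<open>S\<close> satisfies the same identity; subtracting it leaves the claim for
    \<open>S\<close>.\<close>
  moreover have "h (F p) (dF p (nabla p ?v ?JY)) (dF p (Z p)) =
      - h (F p) (dF p (nabla p ?v Y)) (dF p (?JZ p))"
    unfolding nabla_J[OF W(1) Y(1) W(2) v] by (rule dF_J_skew[OF n tZ])
  moreover have "nabla p ?v ?JY \<in> tangent_space A p"
    by (rule nabla_tangent[OF W(1) JY W(2) v])
  ultimately show ?thesis
    by (simp add: second_fundamental_form_def cod.metric_diff_left dmap_tangent tZ n J_tangent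
        Dt[OF JY] Dt[OF Y(1)])
qed

text \<open>\<open>S_J_right\<close> moves one \<open>J\<close> to the test vector, symmetry brings
  the other into position, and a second application leaves \<open>J\<close> squared on
  \<open>Z p\<close>.\<close>

lemma S_J_J:
  assumes X: "vector_field A W X" "X p \<in> V p" and Y: "vector_field A W Y" "Y p \<in> V p"
    and Z: "vector_field A W Z"
  shows "h (F p) (S (\<lambda>q. J q (X q)) (\<lambda>q. J q (Y q)) p) (dF p (Z p)) =
    - h (F p) (S X Y p) (dF p (Z p))"
proof -
  note JX = J_field[OF W(1) X(1)] and JZ = J_field[OF W(1) Z] and tZ = field_tangent[OF Z W(2)]
  have "h (F p) (S (\<lambda>q. J q (X q)) (\<lambda>q. J q (Y q)) p) (dF p (Z p)) =
      - h (F p) (S Y (\<lambda>q. J q (X q)) p) (dF p (J p (Z p)))"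
    by (simp add: S_J_right[OF JX Y Z] S_sym[OF W JX Y(1)])
  also have "\<dots> = h (F p) (S Y X p) (dF p (J p (J p (Z p))))"
    by (simp add: S_J_right[OF Y(1) X JZ])
  also have "\<dots> = - h (F p) (S X Y p) (dF p (Z p))"
    by (simp add: JJ tZ dmap_uminus S_sym[OF W Y(1) X(1)]
        cod.metric_uminus_right[OF dmap_tangent[OF tZ] S_tangent[OF W X(1) Y(1)]])
  finally show ?thesis .
qed

text \<open>The fields \<open>E b\<close> are orthonormal at \<open>p\<close> only. Their values
  there define an isometry \<open>\<phi>\<close> from \<open>'a\<close> onto the tangent space,
  which transports \<open>J\<close> and the vertical space to \<open>'a\<close>;
  \<open>trace_eq_zero\<close> then applies to each component of \<open>S\<close>.\<close>

lemma trace_second_fundamental_form: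
  assumes E: "\<And>b. b \<in> Basis \<Longrightarrow> vector_field A W (E b)"
    and orth: "\<And>b b'. b \<in> Basis \<Longrightarrow> b' \<in> Basis \<Longrightarrow> g p (E b p) (E b' p) = (if b = b' then 1 else 0)"
  shows "(\<Sum>b\<in>(Basis::'a set). S (E b) (E b) p) = 0"
proof -
  \<comment> \<open>Constant coefficients make \<open>e\<close> additive and homogeneous in
    \<open>x\<close> as a family of fields, so \<open>S (e x) (e y) p\<close> is bilinear in
    \<open>x\<close> and \<open>y\<close>.\<close>
  define e where "e = (\<lambda>x q. \<Sum>b\<in>Basis. (x \<bullet> b) *\<^sub>T E b q)"
  have e: "vector_field A W (e x)" for x
    unfolding e_def by (intro M.section_sum M.section_scale_const W E)
  define \<phi> where "\<phi> = (\<lambda>x. e x p)"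
  have e_add: "e (x + y) = (\<lambda>q. e x q + e y q)" for x y
    by (simp add: e_def fun_eq_iff sum_fun_apply inner_add_left scaleR_add_left sum.distrib)
  have e_scale: "e (r *\<^sub>R x) = (\<lambda>q. r *\<^sub>T e x q)" for r x
    by (simp add: e_def fun_eq_iff sum_fun_apply scaleR_sum_right)
  have e_Basis: "e b = E b" if "b \<in> Basis" for b
  proof (intro ext)
    fix q c
    have "e b q c = (\<Sum>b'\<in>Basis. if b' = b then E b q c else 0)"
      unfolding e_def sum_fun_apply
      by (rule sum.cong[OF refl]) (use that in \<open>auto simp: inner_Basis\<close>)
    then show "e b q c = E b q c" using that by simp
  qed
  have \<phi>_t: "\<phi> x \<in> tangent_space A p" for x
    unfolding \<phi>_def by (rule field_tangent[OF e W(2)])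
  have \<phi>_add: "\<phi> (x + y) = \<phi> x + \<phi> y" and \<phi>_scale: "\<phi> (r *\<^sub>R x) = r *\<^sub>T \<phi> x" for x y r
    by (simp_all add: \<phi>_def e_add e_scale)
  have Et: "E b p \<in> tangent_space A p" if "b \<in> Basis" for b
    by (rule field_tangent[OF E[OF that] W(2)])
  have inner_E: "g p (\<phi> x) (E b p) = x \<bullet> b" if "b \<in> Basis" for x b
  proof -
    have "g p (\<phi> x) (E b p) = (\<Sum>b'\<in>Basis. g p ((x \<bullet> b') *\<^sub>T E b' p) (E b p))"
      unfolding \<phi>_def e_def by (rule dom.metric_sum_left[OF dom.tangent_scale[OF Et] Et[OF that]])
    also have "\<dots> = (\<Sum>b'\<in>Basis. if b' = b then x \<bullet> b else 0)"
      by (rule sum.cong[OF refl]) (simp add: that Et dom.metric_scale_left orth)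
    finally have "g p (\<phi> x) (E b p) = (\<Sum>b'\<in>Basis. if b' = b then x \<bullet> b else 0)" .
    then show ?thesis using that by simp
  qed
  have \<phi>_iso: "g p (\<phi> x) (\<phi> y) = x \<bullet> y" for x y
  proof -
    have "g p (\<phi> x) (\<phi> y) = g p (\<phi> x) (\<Sum>b\<in>Basis. (y \<bullet> b) *\<^sub>T E b p)"
      by (simp only: \<phi>_def e_def)
    also have "\<dots> = (\<Sum>b\<in>Basis. g p (\<phi> x) ((y \<bullet> b) *\<^sub>T E b p))"
      by (rule dom.metric_sum_right[OF dom.tangent_scale[OF Et] \<phi>_t])
    also have "\<dots> = (\<Sum>b\<in>Basis. (y \<bullet> b) * (x \<bullet> b))"
      by (rule sum.cong[OF refl]) (simp add: dom.metric_scale_right Et \<phi>_t inner_E)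
    finally show ?thesis by (simp add: euclidean_inner[of x y] mult.commute)
  qed
  \<comment> \<open>The coefficients with respect to the orthonormal basis \<open>E b p\<close>:
    this is the inverse of \<open>\<phi>\<close>.\<close>
  define \<kappa> where "\<kappa> = (\<lambda>u. \<Sum>b\<in>Basis. g p u (E b p) *\<^sub>R b)"
  have \<kappa>\<phi>: "\<kappa> (\<phi> x) = x" for x
    by (simp add: \<kappa>_def inner_E euclidean_representation)
  have \<phi>_surj: "\<exists>x. u = \<phi> x" if u: "u \<in> tangent_space A p" for u
  proof -
    let ?c = "chart_at A p"
    note c = dom.chart_at[of p]
    have lin: "linear (\<lambda>x. \<phi> x ?c)"
      by (rule linearI) (simp_all add: \<phi>_add \<phi>_scale)
    have "inj (\<lambda>x. \<phi> x ?c)"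
    proof (rule injI)
      fix x y assume "\<phi> x ?c = \<phi> y ?c"
      then have "\<phi> x = \<phi> y" by (rule dom.tangent_space_eqI[OF \<phi>_t \<phi>_t c])
      then show "x = y" using \<kappa>\<phi> by metis
    qed
    \<comment> \<open>Read in one chart, \<open>\<phi>\<close> is an injective linear endomorphism
      of \<open>'a\<close>, hence onto. Here it matters that the orthonormal fields are
      \<open>DIM('a)\<close> in number.\<close>
    then have "surj (\<lambda>x. \<phi> x ?c)" by (rule linear_injective_imp_surjective[OF lin _ refl])
    then obtain x where "u ?c = \<phi> x ?c" by (meson surjD)
    then have "u = \<phi> x" by (rule dom.tangent_space_eqI[OF u \<phi>_t c])
    then show ?thesis ..
  qed
  have \<phi>\<kappa>: "\<phi> (\<kappa> u) = u" if "u \<in> tangent_space A p" for u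
    using \<phi>_surj[OF that] \<kappa>\<phi> by auto
  have \<kappa>_add: "\<kappa> (u + v) = \<kappa> u + \<kappa> v" if "u \<in> tangent_space A p" "v \<in> tangent_space A p" for u v
    using that by (simp add: \<kappa>_def dom.metric_add_left Et scaleR_add_left sum.distrib)
  have \<kappa>_scale: "\<kappa> (r *\<^sub>T u) = r *\<^sub>R \<kappa> u" if "u \<in> tangent_space A p" for u r
    using that by (simp add: \<kappa>_def dom.metric_scale_left Et scaleR_sum_right)
  define J' where "J' = (\<lambda>x. \<kappa> (J p (\<phi> x)))"
  have \<phi>J': "\<phi> (J' x) = J p (\<phi> x)" for x
    unfolding J'_def by (rule \<phi>\<kappa>[OF J_tangent[OF \<phi>_t]])
  have linJ': "linear J'"
    by (rule linearI) (simp_all add: J'_def \<phi>_add \<phi>_scale J_add J_scale \<kappa>_add \<kappa>_scale \<phi>_t J_tangent)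
  have J'J': "J' (J' x) = - x" for x
  proof -
    have "J' (J' x) = \<kappa> (J p (\<phi> (J' x)))" by (simp only: J'_def)
    also have "\<dots> = \<kappa> (- \<phi> x)" by (simp add: \<phi>J' JJ \<phi>_t)
    also have "- \<phi> x = \<phi> (- x)" using \<phi>_scale[of "-1" x] by (simp add: fun_Compl_def)
    finally show ?thesis by (simp add: \<kappa>\<phi>)
  qed
  have J'_iso: "J' x \<bullet> J' y = x \<bullet> y" for x y
    by (simp add: \<phi>_iso[symmetric] \<phi>J' J_iso \<phi>_t)
  define V' where "V' = {x. \<phi> x \<in> V p}"
  have \<phi>0: "\<phi> 0 = 0" using \<phi>_scale[of 0 0] by (simp add: zero_fun_def)
  have V': "subspace V'"
    by (auto simp: subspace_def V'_def vertical_space_def \<phi>0 \<phi>_add \<phi>_scale dmap_zero dmap_add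
        dmap_scale dom.tangent_zero dom.tangent_add dom.tangent_scale zero_fun_def
        dmap_zero[unfolded zero_fun_def] dom.tangent_zero[unfolded zero_fun_def])
  have J'V': "J' x \<in> V'" if "x \<in> V'" for x
    using that by (simp add: V'_def \<phi>J' J_vertical)
  have hor: "\<phi> x \<in> H p" if "\<And>w. w \<in> V' \<Longrightarrow> x \<bullet> w = 0" for x
  proof -
    have "g p (\<phi> x) w = 0" if w: "w \<in> V p" for w
    proof -
      have "\<phi> (\<kappa> w) = w" by (rule \<phi>\<kappa>[OF vertical_tangent[OF w]])
      with w \<open>\<And>w. w \<in> V' \<Longrightarrow> x \<bullet> w = 0\<close>[of "\<kappa> w"] \<phi>_iso[of x "\<kappa> w"] show ?thesis
        by (simp add: V'_def)
    qed
    then show ?thesis by (simp add: horizontal_space_def \<phi>_t)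
  qed
  have tr: "(\<Sum>b\<in>Basis. h (F p) (S (e b) (e b) p) (dF p (\<phi> z))) = 0" for z
  proof (rule trace_eq_zero[where t = "\<lambda>x y. h (F p) (S (e x) (e y) p) (dF p (\<phi> z))",
        OF _ linJ' J'J' J'_iso V' J'V'])
    let ?t = "\<lambda>x y. h (F p) (S (e x) (e y) p) (dF p (\<phi> z))"
    note St = S_tangent[OF W e e] and zt = dmap_tangent[OF \<phi>_t]
    show "bilinear ?t"
      unfolding bilinear_def
      by (auto intro!: linearI simp: e_add e_scale S_add_left[OF W e e e] S_add_right[OF W e e e]
          S_scale_left[OF W e e] S_scale_right[OF W e e] cod.metric_add_left cod.metric_scale_left St zt)
    show "?t x y = 0" if "\<And>w. w \<in> V' \<Longrightarrow> x \<bullet> w = 0" "\<And>w. w \<in> V' \<Longrightarrow> y \<bullet> w = 0" for x y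
    proof -
      obtain a b where ab: "a \<in> V p" "b \<in> H p" "\<phi> z = a + b"
        using vertical_horizontal_decomposition[OF \<phi>_t] .
      have "dF p (\<phi> z) = dF p b"
        using ab by (simp add: dmap_add vertical_tangent horizontal_tangent dF_vertical)
      \<comment> \<open>\<open>S_horizontal\<close> takes fields on \<open>W\<close>;
        \<open>e (\<kappa> b)\<close> is one whose value at \<open>p\<close> is the horizontal part
        of \<open>\<phi> z\<close>.\<close>
      moreover have "b = e (\<kappa> b) p"
        using \<phi>\<kappa>[OF horizontal_tangent[OF ab(2)]] by (simp add: \<phi>_def)
      ultimately show ?thesis
        using S_horizontal[OF W e _ e _ e, of x y "\<kappa> b"] hor[OF that(1)] hor[OF that(2)] ab(2)
        by (simp add: \<phi>_def)
    qed
    show "?t (J' x) (J' y) = - ?t x y" if "x \<in> V'" "y \<in> V'" for x y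
    proof -
      \<comment> \<open>The fields \<open>e (J' x)\<close> and
        \<open>\<lambda>q. J q (e x q)\<close> are known to agree at \<open>p\<close> only, which
        suffices because \<open>S\<close> is tensorial.\<close>
      have "S (e (J' x)) (e (J' y)) p = S (\<lambda>q. J q (e x q)) (\<lambda>q. J q (e y q)) p"
        by (rule S_cong[OF W e e J_field[OF W(1) e] J_field[OF W(1) e]])
           (simp_all add: \<phi>J'[unfolded \<phi>_def])
      then show ?thesis
        using S_J_J[OF e _ e _ e, of x y z] that by (simp add: V'_def \<phi>_def)
    qed
  qed
  let ?y = "\<Sum>b\<in>(Basis::'a set). S (E b) (E b) p"
  have St: "S (E b) (E b) p \<in> tangent_space B (F p)" if "b \<in> Basis" for b
    by (rule S_tangent[OF W E E]) (rule that)+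
  have y: "?y \<in> tangent_space B (F p)" by (rule cod.tangent_sum[OF St])
  \<comment> \<open>Surjectivity of the differential makes the trace its own test vector, so its
    squared length is zero.\<close>
  then obtain u where u: "u \<in> tangent_space A p" "?y = dF p u" using dF_onto by blast
  then obtain z where z: "u = \<phi> z" using \<phi>_surj by blast
  have "h (F p) ?y (dF p (\<phi> z)) = (\<Sum>b\<in>Basis. h (F p) (S (E b) (E b) p) (dF p (\<phi> z)))"
    by (rule cod.metric_sum_left[OF St dmap_tangent[OF \<phi>_t]])
  also have "\<dots> = 0" using tr[of z] by (simp add: e_Basis)
  finally have "h (F p) ?y ?y = 0" unfolding u(2) z .
  with cod.metric_pos[OF y] show ?thesis by force
qed

end

end

section \<open>From the hyperkaehler hypotheses to harmonicity\<close>

theorem lemma3p18: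
  fixes A :: "('p::{t2_space, second_countable_topology}, 'a::euclidean_space) chart set"
    and B :: "('q::{t2_space, second_countable_topology}, 'b::euclidean_space) chart set"
    and I J K :: "'p \<Rightarrow> ('p, 'a) tvec \<Rightarrow> ('p, 'a) tvec"
    and gM :: "('p, 'a) metric" and gN :: "('q, 'b) metric"
    and F :: "'p \<Rightarrow> 'q"
  assumes "hyperkaehler_manifold A I J K gM"
    and "riemannian_manifold B gN"
    and "h_lagrangian_submersion A I J K gM B gN F"
  shows "harmonic_map A gM B gN F"
  unfolding harmonic_map_def
proof (intro conjI allI impI)
  have rs: "riemannian_submersion A gM B gN F"
    using assms(3) by (simp add: h_lagrangian_submersion_def)
  then show smooth: "smooth_map A B F" by (simp add: riemannian_submersion_def)
  fix nabla nabla' D p W and E :: "'a \<Rightarrow> 'p \<Rightarrow> ('p, 'a) tvec"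
  assume lc: "levi_civita A gM nabla" and lc': "levi_civita B gN nabla'"
    and pb: "pullback_connection A B F nabla' D" and W: "open W" "p \<in> W"
    and E: "\<forall>b\<in>Basis. vector_field A W (E b)"
    and orth: "\<forall>b\<in>Basis. \<forall>b'\<in>Basis. gM p (E b p) (E b' p) = (if b = b' then 1 else 0)"
  have riem: "riemannian_manifold A gM"
    using assms(1) by (simp add: hyperkaehler_manifold_def)
  interpret M: riemannian A gM
    using riem by unfold_locales (simp_all add: riemannian_manifold_def)
  obtain nabla0 where nabla0: "levi_civita A gM nabla0" "parallel_endomorphism A nabla0 J"
    using assms(1) unfolding hyperkaehler_manifold_def by blast
  have endo: "endomorphism_field A J"
    using assms(1) by (simp add: hyperkaehler_manifold_def)
  \<comment> \<open>The hypothesis yields some Levi-Civita connection \<open>nabla0\<close> with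
    \<open>J\<close> parallel, whereas \<open>nabla\<close> is arbitrary. Uniqueness, applied to
    \<open>Y\<close> and to \<open>J\<close> applied to \<open>Y\<close>, transfers the
    property.\<close>
  have par: "parallel_endomorphism A nabla J"
    unfolding parallel_endomorphism_def
  proof (intro allI impI ballI)
    fix W Y p v
    assume WY: "open W" "vector_field A W Y" and p: "p \<in> W" and v: "v \<in> tangent_space A p"
    have JY: "vector_field A W (\<lambda>q. J q (Y q))"
      using endo WY unfolding endomorphism_field_def by blast
    have "nabla0 p v (\<lambda>q. J q (Y q)) = J p (nabla0 p v Y)"
      using nabla0(2) WY p v unfolding parallel_endomorphism_def by blast
    then show "nabla p v (\<lambda>q. J q (Y q)) = J p (nabla p v Y)"
      by (simp add: M.levi_civita_unique[OF lc nabla0(1) WY(1) JY p v]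
          M.levi_civita_unique[OF lc nabla0(1) WY p v])
  qed
  interpret complex_submersion_map A B F D gN nabla' gM nabla J
  proof unfold_locales
    show "smooth_atlas B" using assms(2) by (simp add: riemannian_manifold_def)
    show "connection_along A B F D" using pb by (simp add: pullback_connection_def)
    show "J p (J p v) = - v" if "v \<in> tangent_space A p" for p v
      using assms(1) that by (simp add: hyperkaehler_manifold_def)
    show "gM p (J p v) (J p w) = gM p v w"
      if "v \<in> tangent_space A p" "w \<in> tangent_space A p" for p v w
      using assms(1) that by (simp add: hyperkaehler_manifold_def)
    show "J p v \<in> vertical_space A B F p" if "v \<in> vertical_space A B F p" for p v
      using assms(3) that unfolding h_lagrangian_submersion_def by blast
  qed (fact smooth assms(2) lc' pb lc rs endo par)+
  show "(\<Sum>b\<in>(Basis::'a set). second_fundamental_form A B F nabla D (E b) (E b) p) = 0"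
    by (rule trace_second_fundamental_form[OF W]) (use E orth in auto)
qed

end
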